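(* Let $\mathcal{P}\in\mathbb{P}$, $\epsilon,\tau\in\mathbb{R}_{>0}$. Let $\tilde Q^\star$ be an optimal Youla parameter for OP3 and $\gamma^\star$ the optimal objective of OP3. For $n\in\mathbb{Z}_{>0}$ let $\tilde Q_{1,n}^\star$ and $\gamma_n^\star$ be the solution and optimal objective of OP4, and let $\tilde Q_n^\star\triangleq\tilde Q_0+\tilde M_0\tilde Q_{1,n}^\star\tilde N_0$ be the corresponding total Youla parameter. Then $\gamma_n^\star$ is monotonically nonincreasing in $n$, and $$\lim_{n\to\infty}\gamma_n^\star=\gamma^\star .$$ Furthermore, if the set $\mathbb{W}'=[-\pi,\pi]\setminus\mathbb{W}$ has zero Lebesgue measure, where $$\mathbb{W}=\{\Omega\in[-\pi,\pi]:\ \tilde P_{uz}^H(e^{j\Omega})\tilde P_{uz}(e^{j\Omega})\succ0\ \text{ and }\ \tilde P_{fy}(e^{j\Omega})\tilde P_{fy}^H(e^{j\Omega})\succ0\},$$ then $$\lim_{n\to\infty}\|\tilde Q^\star-\tilde Q_n^\star\|_{\tilde{\mathbb{H}}_2}=0 .$$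
   Context: Notation. $X^H$ is the conjugate transpose, $\succeq,\succ$ the Hermitian order, $\mathbb{C}_{>0}$ the open right half-plane, $\mathbb{O}_{>1}=\{q\in\mathbb{C}:|q|>1\}$. $\hat{\mathbb{H}}_\infty$ (resp. $\tilde{\mathbb{H}}_\infty$) is the set of matrix functions analytic and uniformly bounded on $\mathbb{C}_{>0}$ (resp. $\mathbb{O}_{>1}$). $\tilde{\mathbb{H}}_2$ is the set of matrix functions $\tilde S$ analytic on $\mathbb{O}_{>1}$ with $\|\tilde S\|_{\tilde{\mathbb{H}}_2}^2=\sup_{\beta>0}\frac1{2\pi}\int_{-\pi}^{\pi}\mathrm{tr}(\tilde S^H\tilde S)(e^{\beta+j\Omega})\,d\Omega<\infty$. Values on the unit circle are boundary limits (existing a.e.). The Markov coefficients $\bar S(k)$ of $\tilde S$ are those in $\tilde S(q)=\sum_{k\ge0}\bar S(k)q^{-k}$. $\left[\begin{array}{c|c} A & B \\ \hline C & D \end{array}\right]$ denotes $C(sI-A)^{-1}B+D$. Plant class $\mathbb{P}$. $\mathcal{P}:\{w,u\}\mapsto\{z,y\}$ is finite-dimensional LTI with $y(t),u(t)\in\mathbb{C}^{n_u}$, $\hat P_{ij}(s)=C_j(sI-A)^{-1}B_i+D_{ij}$, $i\in\{w,u\}$, $j\in\{z,y\}$, constant complex matrices, $D_{wz}=0$, $D_{wy}=0$, overall realization minimal; all $\hat P_{ij}\in\hat{\mathbb{H}}_\infty$; and $u\mapsto y$ is passive, i.e. $\hat P_{uy}(s)+\hat P_{uy}^H(s)\succeq0$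 on $\mathbb{C}_{>0}$. Bilinear transformation. For $\tau>0$ and $s=\frac1{2\tau}\frac{q-1}{q+1}$, put $\tilde P_{ij}(q)=\hat P_{ij}(s)$, and $\tilde P_{fz}(q)=\frac1{1+q}\tilde P_{wz}(q)$, $\tilde P_{fy}(q)=\frac1{1+q}\tilde P_{wy}(q)$ (these are in $\tilde{\mathbb{H}}_2\cap\tilde{\mathbb{H}}_\infty$). Factor $\tilde F$: the rational matrix function with $\tilde F,\tilde F^{-1}\in\tilde{\mathbb{H}}_\infty$, $\tilde F(\infty)$ Hermitian, and $[\tilde P_{uy}+\tilde P_{uy}^H+\epsilon I]^{-1}=\tilde F+\tilde F^H$ on $|q|=1$. Objective: $\gamma(\tilde Q)=\frac1\tau\|\tilde P_{fz}-\tilde P_{uz}\tilde Q\tilde P_{fy}\|_{\tilde{\mathbb{H}}_2}^2$. Passivity constraint (PC) on $\tilde Q\in\tilde{\mathbb{H}}_\infty$ ($n_u\times n_u$): $\tilde U=\begin{bmatrix} \tilde Q & \tilde Q \\ 0 & \tilde F \end{bmatrix}$ satisfies $\tilde U(e^{j\Omega})+\tilde U^H(e^{j\Omega})\succeq0$ for all $\Omega\in[-\pi,\pi]$. OP3: minimize $\gamma(\tilde Q)$ over $\tilde Q\in\tilde{\mathbb{H}}_\infty$ (parametrized by all its Markov coefficients $\bar Q(k)$, $k\ge0$) subject to (PC). Reference controller $\hat K_0$. Assume $R=D_{uz}^HD_{uz}\succ0$ and that the Hamiltonian matrix $\begin{bmatrix} A-B_uR^{-1}D_{uz}^HC_z &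 -B_uR^{-1}B_u^H \\ -C_z^H(I-D_{uz}R^{-1}D_{uz}^H)C_z & -(A-B_uR^{-1}D_{uz}^HC_z)^H \end{bmatrix}$ has no purely imaginary eigenvalues. Let $J=J^H$ be the stabilizing solution of $0=A^HJ+JA+C_z^HC_z-C_K^HRC_K$ with $C_K=-R^{-1}(B_u^HJ+D_{uz}^HC_z)$ (so $A_Z=A+B_uC_K$ is Hurwitz). Let $E=\epsilon I+D_{uy}+D_{uy}^H$, $G_p=E^{1/2}C_K+E^{-1/2}C_y$, $G_n=E^{-1/2}C_y$. Let $Z_0=Z_0^H\succ0$ satisfy $Z_0A_Z+A_Z^HZ_0+G_p^HG_p\preceq0$, $A_C=A+Z_0^{-1}C_K^HC_y$ (Hurwitz), and let $X_0=X_0^H\succ0$ satisfy $A_CX_0+X_0A_C^H+B_wB_w^H\preceq0$. Fix $\Psi=\Psi^H\succ0$. OP2: minimize $\mathrm{tr}(C_KXC_K^HR)$ over Hermitian $X\succ0$, $Y\succ0$ subject to ($\star$ = completion by Hermitian symmetry) $$\begin{bmatrix} \mathcal{A} & \star & \star \\ C_K(Y-Z_0^{-1}) & -\Psi^{-1} & \star \\ C_y(X-X_0) & 0 & -\Psi \end{bmatrix}\preceq0,\qquad \begin{bmatrix} \mathcal{B} & \star \\ G_pY & -I \end{bmatrix}\preceq0,$$ $\mathcal{A}=A_C(X-X_0)+(X-X_0)A_C^H+(Y-Z_0^{-1})C_K^HC_yX_0+X_0C_y^HC_K(Y-Z_0^{-1})$, $\mathcal{B}=A_ZY+YA_Z^H+Z_0^{-1}G_n^HG_nZ_0^{-1}-YG_n^HG_nZ_0^{-1}-Z_0^{-1}G_n^HG_nY$.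 With $(X,Y)$ a solution of OP2 and $B_K=YC_K^H$, $$\hat K_0=\left[\begin{array}{c|c} A+B_uC_K+B_K(C_y+D_{uy}C_K) & -B_K \\ \hline -C_K & 0 \end{array}\right].$$ Put $\tilde K_0(q)=\hat K_0\big(\frac1{2\tau}\frac{q-1}{q+1}\big)$, $\tilde Q_0=\tilde K_0[I+\tilde P_{uy}\tilde K_0]^{-1}$, $\tilde M_0=[I+\tilde K_0\tilde P_{uy}]^{-1}$, $\tilde N_0=[I+\tilde P_{uy}\tilde K_0]^{-1}$. OP4 (for given $n\in\mathbb{Z}_{>0}$): minimize $\gamma(\tilde Q)$ over $\tilde Q=\tilde Q_0+\tilde M_0\tilde Q_1\tilde N_0$ with $\tilde Q_1(q)=\sum_{k=0}^n\bar Q_1(k)q^{-k}$, $\bar Q_1(k)\in\mathbb{C}^{n_u\times n_u}$, subject to (PC). *)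

theory Defs
  imports "HOL-Analysis.Analysis" "HOL-Computational_Algebra.Polynomial"
begin

(* A matrix with rows indexed by 'm and columns indexed by 'n has type complex^'n^'m.
   The scalar matrix c I is "mat c", so "mat c ** M" is the scalar multiple c M. *)

section \<open>Complex matrices\<close>

definition ctransp :: "complex^'n^'m \<Rightarrow> complex^'m^'n"  ("_\<^sup>H" [1000] 999)
  where "M\<^sup>H = (\<chi> i j. cnj (M $ j $ i))"

definition hform :: "complex^'n^'n \<Rightarrow> complex^'n \<Rightarrow> complex"
  where "hform M v = (\<Sum>i\<in>UNIV. cnj (v $ i) * (M *v v) $ i)"

definition hpsd :: "complex^'n^'n \<Rightarrow> bool"
  where "hpsd M \<longleftrightarrow> M\<^sup>H = M \<and> (\<forall>v. 0 \<le> Re (hform M v))"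

definition hpd :: "complex^'n^'n \<Rightarrow> bool"
  where "hpd M \<longleftrightarrow> M\<^sup>H = M \<and> (\<forall>v. v \<noteq> 0 \<longrightarrow> 0 < Re (hform M v))"

definition hnsd :: "complex^'n^'n \<Rightarrow> bool"
  where "hnsd M \<longleftrightarrow> hpsd (- M)"

text \<open>\<open>S\<close> is the principal square root \<open>E\<^sup>1\<^sup>/\<^sup>2\<close> (unique when \<open>E\<close> is positive semidefinite).\<close>
definition is_hsqrt :: "complex^'n^'n \<Rightarrow> complex^'n^'n \<Rightarrow> bool"
  where "is_hsqrt S E \<longleftrightarrow> hpsd S \<and> S ** S = E"

definition eigval :: "complex^'n^'n \<Rightarrow> complex \<Rightarrow> bool"
  where "eigval M l \<longleftrightarrow> (\<exists>v. v \<noteq> 0 \<and> M *v v = l *s v)"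

definition hurwitz :: "complex^'n^'n \<Rightarrow> bool"
  where "hurwitz M \<longleftrightarrow> (\<forall>l. eigval M l \<longrightarrow> Re l < 0)"

definition hcat :: "complex^'n1^'m \<Rightarrow> complex^'n2^'m \<Rightarrow> complex^('n1 + 'n2)^'m"
  where "hcat M N = (\<chi> i j. case j of Inl j1 \<Rightarrow> M $ i $ j1 | Inr j2 \<Rightarrow> N $ i $ j2)"

definition vcat :: "complex^'n^'m1 \<Rightarrow> complex^'n^'m2 \<Rightarrow> complex^'n^('m1 + 'm2)"
  where "vcat M N = (\<chi> i j. case i of Inl i1 \<Rightarrow> M $ i1 $ j | Inr i2 \<Rightarrow> N $ i2 $ j)"

definition block2 :: "complex^'n1^'m1 \<Rightarrow> complex^'n2^'m1 \<Rightarrow> complex^'n1^'m2 \<Rightarrow> complex^'n2^'m2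
    \<Rightarrow> complex^('n1 + 'n2)^('m1 + 'm2)"
  where "block2 K L M N = vcat (hcat K L) (hcat M N)"

section \<open>Function spaces\<close>

abbreviation rhp :: "complex set"
  where "rhp \<equiv> {s. 0 < Re s}"

abbreviation ext_disc :: "complex set"
  where "ext_disc \<equiv> {q. 1 < norm q}"

definition mat_holomorphic_on :: "(complex \<Rightarrow> complex^'n^'m) \<Rightarrow> complex set \<Rightarrow> bool"
  where "mat_holomorphic_on G S \<longleftrightarrow> (\<forall>i j. (\<lambda>s. G s $ i $ j) holomorphic_on S)"

definition Hinf_rhp :: "(complex \<Rightarrow> complex^'n^'m) set"
  where "Hinf_rhp = {G. mat_holomorphic_on G rhp \<and> bounded (G ` rhp)}"

definition Hinf_ext :: "(complex \<Rightarrow> complex^'n^'m) set"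
  where "Hinf_ext = {G. mat_holomorphic_on G ext_disc \<and> bounded (G ` ext_disc)}"

definition h2_mean :: "(complex \<Rightarrow> complex^'n^'m) \<Rightarrow> real \<Rightarrow> real"
  where "h2_mean S b = 1 / (2 * pi) * integral {-pi..pi}
    (\<lambda>\<Omega>. let q = exp (of_real b + \<i> * of_real \<Omega>) in Re (trace ((S q)\<^sup>H ** S q)))"

definition H2_ext :: "(complex \<Rightarrow> complex^'n^'m) set"
  where "H2_ext = {S. mat_holomorphic_on S ext_disc \<and> bdd_above (h2_mean S ` {0<..})}"

text \<open>Only meaningful on \<^const>\<open>H2_ext\<close>, where the supremum is taken over a bounded set.\<close>
definition h2_norm :: "(complex \<Rightarrow> complex^'n^'m) \<Rightarrow> real"
  where "h2_norm S = sqrt (SUP b\<in>{0<..}. h2_mean S b)"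

text \<open>Values on the unit circle are radial limits from outside the disc. Evaluating at
  \<open>cis \<Omega>\<close> directly would be wrong, for instance at \<open>q = -1\<close>, where the bilinear
  transformation has its pole.\<close>
definition boundary_limit :: "(complex \<Rightarrow> complex^'n^'m) \<Rightarrow> real \<Rightarrow> complex^'n^'m \<Rightarrow> bool"
  where "boundary_limit G \<Omega> L \<longleftrightarrow> ((\<lambda>r. G (of_real r * cis \<Omega>)) \<longlongrightarrow> L) (at_right (1::real))"

definition rational_ext :: "(complex \<Rightarrow> complex^'n^'m) \<Rightarrow> bool"
  where "rational_ext G \<longleftrightarrow> (\<forall>i j. \<exists>p d :: complex poly. \<forall>q\<in>ext_disc.
    poly d q \<noteq> 0 \<and> G q $ i $ j = poly p q / poly d q)"

section \<open>Plants\<close>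

definition transfer :: "complex^'x^'x \<Rightarrow> complex^'i^'x \<Rightarrow> complex^'x^'o \<Rightarrow> complex^'i^'o
    \<Rightarrow> complex \<Rightarrow> complex^'i^'o"
  where "transfer A B C D s = C ** matrix_inv (mat s - A) ** B + D"

text \<open>No realization of the same transfer matrix has fewer states. Up to relabelling, a
  realization with fewer states is one that uses only a proper (possibly empty) subset
  \<open>I\<close> of the index type: the remaining states are neither driven nor observed.\<close>
definition minimal_realization ::
  "complex^'x^'x \<Rightarrow> complex^'i^'x \<Rightarrow> complex^'x^'o \<Rightarrow> complex^'i^'o \<Rightarrow> bool"
  where "minimal_realization A B C D \<longleftrightarrow> \<not> (\<exists>(I :: 'x set) A' B' C' D'.
    I \<noteq> UNIV \<and>
    (\<forall>i j. i \<notin> I \<or> j \<notin> I \<longrightarrow> A' $ i $ j = 0) \<and>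
    (\<forall>i j. i \<notin> I \<longrightarrow> B' $ i $ j = 0) \<and>
    (\<forall>i j. j \<notin> I \<longrightarrow> C' $ i $ j = 0) \<and>
    (\<forall>s. invertible (mat s - A) \<and> invertible (mat s - A') \<longrightarrow>
      transfer A' B' C' D' s = transfer A B C D s))"

record ('x, 'w, 'u, 'z) plant =
  pA :: "complex^'x::finite^'x"
  pBw :: "complex^'w::finite^'x"
  pBu :: "complex^'u::finite^'x"
  pCz :: "complex^'x^'z::finite"
  pCy :: "complex^'x^'u"
  pDwz :: "complex^'w^'z"
  pDuz :: "complex^'u^'z"
  pDwy :: "complex^'w^'u"
  pDuy :: "complex^'u^'u"

definition Phat_wz where "Phat_wz P = transfer (pA P) (pBw P) (pCz P) (pDwz P)"
definition Phat_uz where "Phat_uz P = transfer (pA P) (pBu P) (pCz P) (pDuz P)"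
definition Phat_wy where "Phat_wy P = transfer (pA P) (pBw P) (pCy P) (pDwy P)"
definition Phat_uy where "Phat_uy P = transfer (pA P) (pBu P) (pCy P) (pDuy P)"

definition plant_class :: "('x::finite, 'w::finite, 'u::finite, 'z::finite) plant \<Rightarrow> bool"
  where "plant_class P \<longleftrightarrow>
    pDwz P = 0 \<and> pDwy P = 0 \<and>
    minimal_realization (pA P) (hcat (pBw P) (pBu P)) (vcat (pCz P) (pCy P))
      (block2 (pDwz P) (pDuz P) (pDwy P) (pDuy P)) \<and>
    Phat_wz P \<in> Hinf_rhp \<and> Phat_uz P \<in> Hinf_rhp \<and>
    Phat_wy P \<in> Hinf_rhp \<and> Phat_uy P \<in> Hinf_rhp \<and>
    (\<forall>s\<in>rhp. hpsd (Phat_uy P s + (Phat_uy P s)\<^sup>H))"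

section \<open>Bilinear transformation\<close>

definition tilde :: "real \<Rightarrow> (complex \<Rightarrow> complex^'n^'m) \<Rightarrow> complex \<Rightarrow> complex^'n^'m"
  where "tilde \<tau> G q = G (1 / (2 * of_real \<tau>) * ((q - 1) / (q + 1)))"

definition Pt_uz where "Pt_uz P \<tau> = tilde \<tau> (Phat_uz P)"
definition Pt_uy where "Pt_uy P \<tau> = tilde \<tau> (Phat_uy P)"
definition Pt_fz where "Pt_fz P \<tau> q = mat (1 / (1 + q)) ** tilde \<tau> (Phat_wz P) q"
definition Pt_fy where "Pt_fy P \<tau> q = mat (1 / (1 + q)) ** tilde \<tau> (Phat_wy P) q"

text \<open>These four conditions determine \<open>F\<close> uniquely on the exterior of the disc.\<close>
definition is_factor ::
  "('x::finite, 'w::finite, 'u::finite, 'z::finite) plant \<Rightarrow> real \<Rightarrow> real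
    \<Rightarrow> (complex \<Rightarrow> complex^'u^'u) \<Rightarrow> bool"
  where "is_factor P \<epsilon> \<tau> F \<longleftrightarrow>
    rational_ext F \<and>
    F \<in> Hinf_ext \<and> (\<forall>q\<in>ext_disc. invertible (F q)) \<and> (\<lambda>q. matrix_inv (F q)) \<in> Hinf_ext \<and>
    (\<exists>L. (F \<longlongrightarrow> L) at_infinity \<and> L\<^sup>H = L) \<and>
    (\<forall>\<Omega>\<in>{-pi..pi}. \<exists>V W. boundary_limit (Pt_uy P \<tau>) \<Omega> V \<and> boundary_limit F \<Omega> W \<and>
      matrix_inv (V + V\<^sup>H + mat (of_real \<epsilon>)) = W + W\<^sup>H)"

section \<open>Optimization over Youla parameters\<close>

definition objective ::
  "('x::finite, 'w::finite, 'u::finite, 'z::finite) plant \<Rightarrow> real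
    \<Rightarrow> (complex \<Rightarrow> complex^'u^'u) \<Rightarrow> real"
  where "objective P \<tau> Q =
    1 / \<tau> * (h2_norm (\<lambda>q. Pt_fz P \<tau> q - Pt_uz P \<tau> q ** Q q ** Pt_fy P \<tau> q))\<^sup>2"

text \<open>The boundary values of a bounded analytic function exist only almost everywhere, so the
  inequality is imposed at every frequency where they do. The first conjunct is automatic for
  \<open>Q\<close> and \<open>F\<close> in \<^const>\<open>Hinf_ext\<close>, by Fatou's theorem.\<close>
definition passivity_constraint ::
  "(complex \<Rightarrow> complex^'u^'u) \<Rightarrow> (complex \<Rightarrow> complex^'u^'u) \<Rightarrow> bool"
  where "passivity_constraint F Q \<longleftrightarrow> (let U = (\<lambda>q. block2 (Q q) (Q q) 0 (F q)) in
    (AE \<Omega> in lebesgue_on {-pi..pi}. \<exists>L. boundary_limit U \<Omega> L) \<and>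
    (\<forall>\<Omega>\<in>{-pi..pi}. \<forall>L. boundary_limit U \<Omega> L \<longrightarrow> hpsd (L + L\<^sup>H)))"

definition OP3_feasible :: "(complex \<Rightarrow> complex^'u^'u) \<Rightarrow> (complex \<Rightarrow> complex^'u^'u) set"
  where "OP3_feasible F = {Q \<in> Hinf_ext. passivity_constraint F Q}"

definition OP3_value where
  "OP3_value P \<tau> F = (INF Q\<in>OP3_feasible F. objective P \<tau> Q)"

definition OP3_solution where
  "OP3_solution P \<tau> F Q \<longleftrightarrow>
    Q \<in> OP3_feasible F \<and> (\<forall>Q'\<in>OP3_feasible F. objective P \<tau> Q \<le> objective P \<tau> Q')"

section \<open>Reference controller\<close>

definition Rmat where "Rmat P = (pDuz P)\<^sup>H ** pDuz P"

definition hamiltonian ::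
  "('x::finite, 'w::finite, 'u::finite, 'z::finite) plant \<Rightarrow> complex^('x + 'x)^('x + 'x)"
  where "hamiltonian P = (let
      A0 = pA P - pBu P ** matrix_inv (Rmat P) ** (pDuz P)\<^sup>H ** pCz P
    in block2
      A0
      (- (pBu P ** matrix_inv (Rmat P) ** (pBu P)\<^sup>H))
      (- ((pCz P)\<^sup>H ** (mat 1 - pDuz P ** matrix_inv (Rmat P) ** (pDuz P)\<^sup>H) ** pCz P))
      (- (A0\<^sup>H)))"

definition C_K ::
  "('x::finite, 'w::finite, 'u::finite, 'z::finite) plant \<Rightarrow> complex^'x^'x \<Rightarrow> complex^'x^'u"
  where "C_K P J = - (matrix_inv (Rmat P) ** ((pBu P)\<^sup>H ** J + (pDuz P)\<^sup>H ** pCz P))"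

definition A_Z where "A_Z P J = pA P + pBu P ** C_K P J"

definition stabilizing_solution where
  "stabilizing_solution P J \<longleftrightarrow> J\<^sup>H = J \<and>
    0 = (pA P)\<^sup>H ** J + J ** pA P + (pCz P)\<^sup>H ** pCz P - (C_K P J)\<^sup>H ** Rmat P ** C_K P J \<and>
    hurwitz (A_Z P J)"

definition Emat where "Emat P \<epsilon> = mat (of_real \<epsilon>) + pDuy P + (pDuy P)\<^sup>H"

(* In G_p and G_n, S stands for the square root of Emat P \<epsilon>. *)
definition G_p where "G_p P J S = S ** C_K P J + matrix_inv S ** pCy P"
definition G_n where "G_n P S = matrix_inv S ** pCy P"

definition A_C where "A_C P J Z0 = pA P + matrix_inv Z0 ** (C_K P J)\<^sup>H ** pCy P"

definition OP2_feasible ::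
  "('x::finite, 'w::finite, 'u::finite, 'z::finite) plant \<Rightarrow> complex^'x^'x \<Rightarrow> complex^'u^'u
    \<Rightarrow> complex^'x^'x \<Rightarrow> complex^'x^'x \<Rightarrow> complex^'u^'u \<Rightarrow> ((complex^'x^'x) \<times> (complex^'x^'x)) set"
  where "OP2_feasible P J S Z0 X0 \<Psi> = {(X, Y). hpd X \<and> hpd Y \<and> (let
      CK = C_K P J; Cy = pCy P; AC = A_C P J Z0; AZ = A_Z P J; Z0i = matrix_inv Z0;
      Gp = G_p P J S; N = (G_n P S)\<^sup>H ** G_n P S;
      AA = AC ** (X - X0) + (X - X0) ** AC\<^sup>H
        + (Y - Z0i) ** CK\<^sup>H ** Cy ** X0 + X0 ** Cy\<^sup>H ** CK ** (Y - Z0i);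
      BB = AZ ** Y + Y ** AZ\<^sup>H + Z0i ** N ** Z0i - Y ** N ** Z0i - Z0i ** N ** Y;
      L1 = CK ** (Y - Z0i); L2 = Cy ** (X - X0)
    in hnsd (vcat (hcat AA (hcat (L1\<^sup>H)             (L2\<^sup>H)))
            (vcat (hcat L1 (hcat (- matrix_inv \<Psi>) 0))
                  (hcat L2 (hcat 0                (- \<Psi>)))))
     \<and> hnsd (block2 BB         ((Gp ** Y)\<^sup>H)
                   (Gp ** Y)  (- mat 1)))}"

definition OP2_objective where
  "OP2_objective P J X = Re (trace (C_K P J ** X ** (C_K P J)\<^sup>H ** Rmat P))"

definition OP2_solution where
  "OP2_solution P J S Z0 X0 \<Psi> X Y \<longleftrightarrow> (X, Y) \<in> OP2_feasible P J S Z0 X0 \<Psi> \<and>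
    (\<forall>(X', Y')\<in>OP2_feasible P J S Z0 X0 \<Psi>. OP2_objective P J X \<le> OP2_objective P J X')"

text \<open>The data \<open>(J, S, Z0, X0, \<Psi>, X, Y)\<close> produced by the design of the reference controller.\<close>
definition reference_design ::
  "('x::finite, 'w::finite, 'u::finite, 'z::finite) plant \<Rightarrow> real \<Rightarrow> complex^'x^'x
    \<Rightarrow> complex^'u^'u \<Rightarrow> complex^'x^'x \<Rightarrow> complex^'x^'x \<Rightarrow> complex^'u^'u
    \<Rightarrow> complex^'x^'x \<Rightarrow> complex^'x^'x \<Rightarrow> bool"
  where "reference_design P \<epsilon> J S Z0 X0 \<Psi> X Y \<longleftrightarrow>
    hpd (Rmat P) \<and>
    (\<forall>l. eigval (hamiltonian P) l \<longrightarrow> Re l \<noteq> 0) \<and>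
    stabilizing_solution P J \<and>
    is_hsqrt S (Emat P \<epsilon>) \<and>
    hpd Z0 \<and> hnsd (Z0 ** A_Z P J + (A_Z P J)\<^sup>H ** Z0 + (G_p P J S)\<^sup>H ** G_p P J S) \<and>
    hurwitz (A_C P J Z0) \<and>
    hpd X0 \<and> hnsd (A_C P J Z0 ** X0 + X0 ** (A_C P J Z0)\<^sup>H + pBw P ** (pBw P)\<^sup>H) \<and>
    hpd \<Psi> \<and>
    OP2_solution P J S Z0 X0 \<Psi> X Y"

definition Khat0 ::
  "('x::finite, 'w::finite, 'u::finite, 'z::finite) plant \<Rightarrow> complex^'x^'x \<Rightarrow> complex^'x^'x
    \<Rightarrow> complex \<Rightarrow> complex^'u^'u"
  where "Khat0 P J Y = (let CK = C_K P J; BK = Y ** CK\<^sup>H in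
    transfer (pA P + pBu P ** CK + BK ** (pCy P + pDuy P ** CK)) (- BK) (- CK) 0)"

definition Kt0 where "Kt0 P \<tau> J Y = tilde \<tau> (Khat0 P J Y)"

definition Qt0 where
  "Qt0 P \<tau> J Y q = Kt0 P \<tau> J Y q ** matrix_inv (mat 1 + Pt_uy P \<tau> q ** Kt0 P \<tau> J Y q)"

definition Mt0 where
  "Mt0 P \<tau> J Y q = matrix_inv (mat 1 + Kt0 P \<tau> J Y q ** Pt_uy P \<tau> q)"

definition Nt0 where
  "Nt0 P \<tau> J Y q = matrix_inv (mat 1 + Pt_uy P \<tau> q ** Kt0 P \<tau> J Y q)"

section \<open>Finite-dimensional restriction\<close>

definition fir :: "nat \<Rightarrow> (nat \<Rightarrow> complex^'u^'u) \<Rightarrow> complex \<Rightarrow> complex^'u^'u"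
  where "fir n Qc q = (\<Sum>k\<le>n. mat (inverse q ^ k) ** Qc k)"

definition OP4_youla where
  "OP4_youla P \<tau> J Y n Qc q =
    Qt0 P \<tau> J Y q + Mt0 P \<tau> J Y q ** fir n Qc q ** Nt0 P \<tau> J Y q"

text \<open>The decision variable is the coefficient sequence; only its entries \<open>0, \<dots>, n\<close> matter.\<close>
definition OP4_feasible where
  "OP4_feasible P \<tau> F J Y n = {Qc. passivity_constraint F (OP4_youla P \<tau> J Y n Qc)}"

definition OP4_value where
  "OP4_value P \<tau> F J Y n =
    (INF Qc\<in>OP4_feasible P \<tau> F J Y n. objective P \<tau> (OP4_youla P \<tau> J Y n Qc))"

definition OP4_solution where
  "OP4_solution P \<tau> F J Y n Qc \<longleftrightarrow> Qc \<in> OP4_feasible P \<tau> F J Y n \<and>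
    (\<forall>Qc'\<in>OP4_feasible P \<tau> F J Y n.
      objective P \<tau> (OP4_youla P \<tau> J Y n Qc) \<le> objective P \<tau> (OP4_youla P \<tau> J Y n Qc'))"

definition regular_frequencies ::
  "('x::finite, 'w::finite, 'u::finite, 'z::finite) plant \<Rightarrow> real \<Rightarrow> real set"
  where "regular_frequencies P \<tau> = {\<Omega>\<in>{-pi..pi}. \<exists>V W.
    boundary_limit (Pt_uz P \<tau>) \<Omega> V \<and> boundary_limit (Pt_fy P \<tau>) \<Omega> W \<and>
    hpd (V\<^sup>H ** V) \<and> hpd (W ** W\<^sup>H)}"

end

theory Submission
  imports Defs "HOL-Complex_Analysis.Conformal_Mappings"
begin

text \<open>Since \<open>F + F\<^sup>H\<close> is bounded below, the scalar parameters \<open>m I\<close> with small \<open>m > 0\<close> are strictly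
  feasible, and moving a feasible \<open>Q\<close> slightly towards one of them makes \<open>Q\<close> strictly feasible at
  small cost. The quadratic form of (PC) is the real part of a bounded analytic function, so the
  boundary inequality extends to the whole domain \<open>\<bar>q\<bar> > 1\<close> and survives the dilation
  \<open>q \<mapsto> r q\<close>. The linear matrix inequalities of OP2 make the reference controller output
  strictly passive; hence \<open>M\<^sub>0\<close>, \<open>N\<^sub>0\<close> and their inverses are bounded, and as bounded rational
  functions of \<open>q\<close> they are continuous up to the circle. Every strictly feasible \<open>Q\<close> is thus
  \<open>Q\<^sub>0 + M\<^sub>0 Q\<^sub>1 N\<^sub>0\<close> with \<open>Q\<^sub>1\<close> bounded, and a truncated expansion of \<open>Q\<^sub>1(r q)\<close>, which converges
  uniformly on \<open>\<bar>q\<bar> \<ge> 1\<close>, is feasible and close to \<open>Q\<close> in the Hardy norm. For the parameters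
  themselves, the parallelogram identity at the midpoint of two feasible points gives convergence
  of \<open>P\<^sub>u\<^sub>z (Q - Q\<^sub>n) P\<^sub>f\<^sub>y\<close>, which controls \<open>Q - Q\<^sub>n\<close> away from the degenerate frequencies.\<close>

section \<open>Complex matrices and the real inner product\<close>

text \<open>Why dilate: the expansion of a bounded analytic function need not converge uniformly up
  to the circle, while (PC) is a pointwise inequality and tolerates only uniformly small errors.
  Passing to r q multiplies the k-th coefficient by r^(-k), which gives geometric convergence, but
  it also moves \<open>F\<close>, \<open>Mc\<close>, \<open>Nc\<close> and \<open>Qc0\<close>. Their
  continuity up to the circle, including q = -1 (that is, s = infinity), keeps this shift uniformly
  small, so that the strict margin absorbs it. The objective asks for less: Q(r q) tends to Q in the
  Hardy norm even when it does not do so uniformly. Why the parameters converge: a small residual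
  difference says nothing about Q - Q_n at frequencies where \<open>Puz\<close> or
  \<open>Pfy\<close> degenerates. There a bound independent of n is needed, and (PC) itself supplies
  it: the zero block of U forces a bound on Q in terms of a bound on \<open>F\<close> alone
  (\<open>interior_pc_bound\<close>). Hermitian inequalities are treated as real quadratic forms
  throughout. The Hardy norm is handled on bounded functions, where it is a limit of circle means,
  so that identities and inequalities under the integral pass to it.\<close>

lemma inner_complex_cnj: "(a::complex) \<bullet> b = Re (cnj a * b)"
  by (simp add: inner_complex_def)

lemma Re_hform: "Re (hform M v) = v \<bullet> (M *v v)"
  by (simp add: hform_def inner_vec_def inner_complex_cnj)

text \<open>The real inner product on complex vectors is the real part of the Hermitian one, so the
  conjugate transpose is still the adjoint. This rule moves factors across the quadratic forms
  below.\<close>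

lemma inner_ctransp: "(x::complex^'m) \<bullet> (A *v y) = (A\<^sup>H *v x) \<bullet> y"
proof -
  have "x \<bullet> (A *v y) = Re (\<Sum>i\<in>UNIV. \<Sum>j\<in>UNIV. cnj (x $ i) * (A $ i $ j * y $ j))"
    by (simp only: inner_vec_def inner_complex_cnj matrix_vector_mult_def sum_distrib_left vec_lambda_beta Re_sum)
  also have "\<dots> = Re (\<Sum>j\<in>UNIV. \<Sum>i\<in>UNIV. cnj (x $ i) * (A $ i $ j * y $ j))"
    by (subst sum.swap) simp
  also have "\<dots> = (A\<^sup>H *v x) \<bullet> y"
    by (simp only: inner_vec_def inner_complex_cnj matrix_vector_mult_def ctransp_def
        cnj_sum complex_cnj_mult complex_cnj_cnj sum_distrib_right sum_distrib_left vec_lambda_beta Re_sum mult_ac)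
  finally show ?thesis .
qed

lemma ctransp_ctransp [simp]: "(A\<^sup>H)\<^sup>H = A"
  by (simp add: ctransp_def vec_eq_iff)

lemma ctransp_add [simp]: "(A + B)\<^sup>H = A\<^sup>H + B\<^sup>H"
  by (simp add: ctransp_def vec_eq_iff)

lemma ctransp_mult: "(A ** B)\<^sup>H = B\<^sup>H ** A\<^sup>H"
  by (simp add: ctransp_def vec_eq_iff matrix_matrix_mult_def mult.commute)

lemma ctransp_mat [simp]: "(mat c)\<^sup>H = mat (cnj c)"
  by (auto simp add: ctransp_def vec_eq_iff mat_def)

lemma mat_mult_vec [simp]: "mat c *v x = c *s (x :: complex^'n)"
  by (simp add: vec_eq_iff matrix_vector_mult_def mat_def if_distrib if_distribR cong: if_cong)

lemma matrix_vec_neg: "A *v (- u) = - (A *v (u :: complex^'n))"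
  by (simp add: vec_eq_iff matrix_vector_mult_def sum_negf)

lemma of_real_vec_scale: "complex_of_real r *s w = r *\<^sub>R w"
  by (simp add: vec_eq_iff scaleR_conv_of_real[where 'a = complex])

lemma matrix_vec_distrib:
  "(A + B) *v x = A *v x + B *v (x :: complex^'n)" "(A - B) *v x = A *v x - B *v x"
  "(A ** C) *v y = A *v (C *v y)"
  by (simp_all add: matrix_vector_mult_add_rdistrib matrix_vector_mult_diff_rdistrib matrix_vector_mul_assoc)

lemma matrix_mult_distribs:
  fixes A B :: "complex^'k^'m" and C D :: "complex^'n^'k"
  shows "(A - B) ** C = A ** C - B ** C" "A ** (C - D) = A ** C - A ** D"
    "(A + B) ** C = A ** C + B ** C" "A ** (C + D) = A ** C + A ** D"
  by (simp_all add: vec_eq_iff matrix_matrix_mult_def algebra_simps sum_subtractf sum.distrib)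

lemma matrix_mult_scaleR:
  fixes A :: "complex^'k^'m" and C :: "complex^'n^'k"
  shows "(c *\<^sub>R A) ** C = c *\<^sub>R (A ** C)" "A ** (c *\<^sub>R C) = c *\<^sub>R (A ** C)"
  by (simp_all add: vec_eq_iff matrix_matrix_mult_def scaleR_sum_right)

lemma mat_mult_nth: "(mat c ** A) $ i $ j = c * (A :: complex^'n^'m) $ i $ j"
  by (simp add: matrix_matrix_mult_def mat_def if_distrib if_distribR cong: if_cong)

lemma mat_mult_commute: "A ** mat c = mat c ** (A :: complex^'n^'m)"
  by (simp add: vec_eq_iff matrix_matrix_mult_def mat_def if_distrib if_distribR mult.commute cong: if_cong)

lemma mat_mult_mat: "mat a ** mat b = (mat (a * b) :: complex^'n^'n)"
  by (simp add: vec_eq_iff mat_mult_nth) (simp add: mat_def)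

lemma inner_herm_part: "v \<bullet> ((L + L\<^sup>H) *v v) = 2 * (v \<bullet> (L *v v))"
  by (simp add: matrix_vector_mult_add_rdistrib inner_add_right)
     (metis ctransp_ctransp inner_commute inner_ctransp)

text \<open>Since \<open>Y\<close> is Hermitian, the Hermitian product of \<open>y\<close> with
  \<open>Y *v y\<close> is a real number, and only the real part of \<open>s\<close> survives. In
  real terms: multiplication by i is skew, which makes \<open>y\<close> orthogonal to i times
  \<open>Y *v y\<close>.\<close>

lemma inner_herm_scale:
  assumes "Y\<^sup>H = Y"
  shows "y \<bullet> (s *s (Y *v y)) = Re s * (y \<bullet> (Y *v y))"
proof -
  have im: "u \<bullet> (\<i> *s w) = - ((\<i> *s u) \<bullet> w)" for u w :: "complex^'a"
    by (simp add: inner_vec_def inner_complex_def sum_negf[symmetric] algebra_simps)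
  have "(\<i> *s y) \<bullet> (Y *v y) = (\<i> *s (Y *v y)) \<bullet> y"
    by (metis assms inner_ctransp vector_scalar_commute)
  then have 0: "y \<bullet> (\<i> *s (Y *v y)) = 0"
    using im[of y "Y *v y"] by (simp add: inner_commute)
  have "s *s w = Re s *\<^sub>R w + Im s *\<^sub>R (\<i> *s w)" for w :: "complex^'a"
    by (simp add: vec_eq_iff complex_eq_iff)
  then show ?thesis by (simp add: inner_add_right 0)
qed

text \<open>The right-hand form is the real part of an expression linear in \<open>L\<close>. Along
  an analytic matrix function it is therefore the real part of an analytic function, which is what
  carries (PC) into the domain.\<close>

lemma hpsd_herm_part: "hpsd (L + L\<^sup>H) \<longleftrightarrow> (\<forall>v. 0 \<le> v \<bullet> (L *v v))"
  by (simp add: hpsd_def Re_hform inner_herm_part add.commute)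

lemma hpsd_inner: "hpsd M \<Longrightarrow> 0 \<le> v \<bullet> (M *v v)"
  by (simp add: hpsd_def Re_hform)

lemma hpd_inner: "hpd M \<Longrightarrow> v \<noteq> 0 \<Longrightarrow> 0 < v \<bullet> (M *v v)"
  by (simp add: hpd_def Re_hform)

lemma matrix_neg_vec: "(- (M :: complex^'n^'m)) *v v = - (M *v v)"
  by (simp add: vec_eq_iff matrix_vector_mult_def sum_negf)

lemma hnsd_inner: "hnsd M \<Longrightarrow> v \<bullet> (M *v v) \<le> 0"
  using hpsd_inner[of "- M" v] by (simp add: hnsd_def matrix_neg_vec)

section \<open>Estimates for the Frobenius norm\<close>

lemma norm_matrix_sq: "(norm (A :: complex^'n^'m))\<^sup>2 = (\<Sum>i\<in>UNIV. \<Sum>j\<in>UNIV. (cmod (A $ i $ j))\<^sup>2)"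
  by (simp add: norm_vec_def L2_set_def sum_nonneg)

lemma cmod_sum_mult_le:
  fixes a b :: "'a::finite \<Rightarrow> complex"
  shows "(cmod (\<Sum>j\<in>UNIV. a j * b j))\<^sup>2 \<le> (\<Sum>j\<in>UNIV. (cmod (a j))\<^sup>2) * (\<Sum>j\<in>UNIV. (cmod (b j))\<^sup>2)"
proof -
  have "cmod (\<Sum>j\<in>UNIV. a j * b j) \<le> (\<Sum>j\<in>UNIV. \<bar>cmod (a j)\<bar> * \<bar>cmod (b j)\<bar>)"
    by (intro norm_sum[THEN order_trans]) (simp add: norm_mult)
  also have "\<dots> \<le> L2_set (\<lambda>j. cmod (a j)) UNIV * L2_set (\<lambda>j. cmod (b j)) UNIV"
    by (rule L2_set_mult_ineq)
  finally have "(cmod (\<Sum>j\<in>UNIV. a j * b j))\<^sup>2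
      \<le> (L2_set (\<lambda>j. cmod (a j)) UNIV * L2_set (\<lambda>j. cmod (b j)) UNIV)\<^sup>2"
    by (intro power_mono) auto
  then show ?thesis
    by (simp add: power_mult_distrib L2_set_def sum_nonneg)
qed

lemma norm_matrix_vector_le: "norm (A *v x) \<le> norm A * norm (x :: complex^'n)"
proof -
  have "(norm (A *v x))\<^sup>2 = (\<Sum>i\<in>UNIV. (cmod (\<Sum>j\<in>UNIV. A $ i $ j * x $ j))\<^sup>2)"
    by (simp add: norm_vec_def L2_set_def sum_nonneg matrix_vector_mult_def)
  also have "\<dots> \<le> (\<Sum>i\<in>UNIV. (\<Sum>j\<in>UNIV. (cmod (A $ i $ j))\<^sup>2) * (\<Sum>j\<in>UNIV. (cmod (x $ j))\<^sup>2))"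
    by (intro sum_mono cmod_sum_mult_le)
  also have "\<dots> = (norm A * norm x)\<^sup>2"
    by (simp add: norm_matrix_sq power_mult_distrib sum_distrib_right)
       (simp add: norm_vec_def L2_set_def sum_nonneg)
  finally show ?thesis
    by (rule power2_le_imp_le) simp
qed

lemma norm_matrix_mult_le: "norm (A ** B) \<le> norm A * norm (B :: complex^'n^'k)"
  for A :: "complex^'k^'m"
proof -
  have "(norm (A ** B))\<^sup>2 = (\<Sum>i\<in>UNIV. \<Sum>l\<in>UNIV. (cmod (\<Sum>j\<in>UNIV. A $ i $ j * B $ j $ l))\<^sup>2)"
    by (simp add: norm_matrix_sq matrix_matrix_mult_def)
  also have "\<dots> \<le> (\<Sum>i\<in>UNIV. \<Sum>l\<in>UNIV.
      (\<Sum>j\<in>UNIV. (cmod (A $ i $ j))\<^sup>2) * (\<Sum>j\<in>UNIV. (cmod (B $ j $ l))\<^sup>2))"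
    by (intro sum_mono cmod_sum_mult_le)
  also have "\<dots> = (\<Sum>i\<in>UNIV. \<Sum>j\<in>UNIV. (cmod (A $ i $ j))\<^sup>2) * (\<Sum>l\<in>UNIV. \<Sum>j\<in>UNIV. (cmod (B $ j $ l))\<^sup>2)"
    by (simp only: sum_product)
  also have "(\<Sum>l\<in>UNIV. \<Sum>j\<in>UNIV. (cmod (B $ j $ l))\<^sup>2) = (\<Sum>j\<in>UNIV. \<Sum>l\<in>UNIV. (cmod (B $ j $ l))\<^sup>2)"
    by (rule sum.swap)
  finally have "(norm (A ** B))\<^sup>2 \<le> (norm A * norm B)\<^sup>2"
    by (simp only: norm_matrix_sq power_mult_distrib)
  then show ?thesis
    by (rule power2_le_imp_le) simp
qed

lemma norm_matrix_vector_le':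
  "norm (A :: complex^'n^'m) \<le> c \<Longrightarrow> norm (A *v x) \<le> c * norm x"
  using norm_matrix_vector_le[of A x] mult_right_mono[of "norm A" c "norm x"] by simp

lemma norm_ctransp [simp]: "norm (A\<^sup>H) = norm (A :: complex^'n^'m)"
proof -
  have "(norm (A\<^sup>H))\<^sup>2 = (norm A)\<^sup>2"
    unfolding norm_matrix_sq ctransp_def by (subst sum.swap) simp
  then show ?thesis by (simp add: power2_eq_iff_nonneg)
qed

lemma norm_mat_mult: "norm (mat c ** A) = cmod c * norm (A :: complex^'n^'m)"
proof -
  have "(norm (mat c ** A))\<^sup>2 = (cmod c * norm A)\<^sup>2"
    unfolding norm_matrix_sq power_mult_distrib mat_mult_nth norm_mult
    by (simp add: sum_distrib_left)
  then show ?thesis by (simp add: power2_eq_iff_nonneg)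
qed

lemma norm_triple_le:
  fixes A :: "complex^'k^'m" and B :: "complex^'l^'k" and C :: "complex^'n^'l"
  assumes "norm A \<le> a" "norm B \<le> b" "norm C \<le> c"
  shows "norm (A ** B ** C) \<le> a * b * c"
proof -
  have "norm (A ** B ** C) \<le> norm A * norm B * norm C"
    using norm_matrix_mult_le[of "A ** B" C] mult_right_mono[OF norm_matrix_mult_le[of A B], of "norm C"]
    by simp
  also have "\<dots> \<le> a * b * c"
    using assms order_trans[OF norm_ge_zero assms(1)] order_trans[OF norm_ge_zero assms(2)]
    by (intro mult_mono) auto
  finally show ?thesis .
qed

lemma norm_le_of_mult_le:
  assumes "norm w * norm w \<le> norm w * c" "0 \<le> c"
  shows "norm w \<le> c"
  using assms mult_left_le_imp_le[OF assms(1)] by (cases "norm w = 0") auto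

lemma norm_entry_le: "cmod (A $ i $ j) \<le> norm (A :: complex^'n^'m)"
  by (metis Finite_Cartesian_Product.norm_nth_le order_trans)

lemma norm_matrix_le_sum: "norm (A :: complex^'n^'m) \<le> (\<Sum>i\<in>UNIV. \<Sum>j\<in>UNIV. cmod (A $ i $ j))"
proof -
  have "norm A \<le> (\<Sum>i\<in>UNIV. norm (A $ i))"
    unfolding norm_vec_def[of A] by (rule L2_set_le_sum) simp
  also have "\<dots> \<le> (\<Sum>i\<in>UNIV. \<Sum>j\<in>UNIV. cmod (A $ i $ j))"
    unfolding norm_vec_def[of "A $ i" for i] by (intro sum_mono L2_set_le_sum) simp
  finally show ?thesis .
qed

lemma matrix_vector_axis_nth: "(A *v axis j 1) $ i = (A :: complex^'n^'m) $ i $ j"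
  by (simp add: matrix_vector_mult_def axis_def if_distrib cong: if_cong)

text \<open>The norm of a matrix is its Frobenius norm, so a bound on the action on vectors
  transfers with a dimension factor. The crude factor from summing over all entries is enough: it
  only serves to establish boundedness.\<close>

lemma norm_matrix_le_onorm:
  fixes C :: real
  assumes "\<And>x. norm (A *v x) \<le> C * norm x"
  shows "norm (A :: complex^'n^'m) \<le> CARD('m) * CARD('n) * C"
proof -
  have "cmod (A $ i $ j) \<le> C" for i j
  proof -
    have "cmod (A $ i $ j) \<le> norm (A *v axis j 1)"
      by (metis Finite_Cartesian_Product.norm_nth_le matrix_vector_axis_nth)
    also have "\<dots> \<le> C" using assms[of "axis j 1"] by (simp add: axis_def norm_vec_def L2_set_def if_distrib[of cmod] if_distrib[of "\<lambda>x. x\<^sup>2"] cong: if_cong)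
    finally show ?thesis .
  qed
  then have "(\<Sum>i\<in>UNIV. \<Sum>j\<in>UNIV. cmod (A $ i $ j)) \<le> (\<Sum>(i::'m)\<in>UNIV. \<Sum>(j::'n)\<in>UNIV. C)"
    by (intro sum_mono)
  then show ?thesis using norm_matrix_le_sum[of A] by simp
qed

section \<open>Inverses and Cramer's rule\<close>

lemma matrix_inv_inverse:
  assumes "invertible (A :: complex^'n^'n)"
  shows "A ** matrix_inv A = mat 1" "matrix_inv A ** A = mat 1"
  using someI_ex[OF assms[unfolded invertible_def]] by (simp_all add: matrix_inv_def)

lemma matrix_inv_unique:
  assumes "A ** B = mat 1"
  shows "matrix_inv (A :: complex^'n^'n) = B"
proof -
  have "invertible A" using assms invertible_right_inverse by blast
  then show ?thesis
    by (metis assms matrix_inv_inverse(2) matrix_mul_assoc matrix_mul_lid matrix_mul_rid)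
qed

lemma invertible_kernel:
  "invertible (A :: complex^'n^'n) \<longleftrightarrow> (\<forall>x. A *v x = 0 \<longrightarrow> x = 0)"
  using invertible_left_inverse matrix_left_invertible_ker by blast

lemma matrix_inv_vec:
  assumes "invertible (A :: complex^'n^'n)"
  shows "A *v (matrix_inv A *v x) = x" "matrix_inv A *v (A *v x) = x"
  by (simp_all add: matrix_vector_mul_assoc matrix_inv_inverse[OF assms])

lemma ctransp_matrix_inv:
  assumes "invertible (A :: complex^'n^'n)" "A\<^sup>H = A"
  shows "(matrix_inv A)\<^sup>H = matrix_inv A"
proof -
  have "A ** (matrix_inv A)\<^sup>H = (matrix_inv A ** A)\<^sup>H"
    by (simp add: ctransp_mult assms(2))
  also have "\<dots> = mat 1" by (simp add: matrix_inv_inverse assms)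
  finally show ?thesis by (metis matrix_inv_unique)
qed

lemma hpd_invertible: "hpd A \<Longrightarrow> invertible A"
  unfolding invertible_kernel using hpd_inner by (metis inner_zero_right order_less_irrefl)

text \<open>The (i, j) entry of the adjugate in the form in which Cramer's rule delivers it: column
  i is replaced by the j-th unit vector. Being polynomial in the entries of \<open>A\<close>, it
  transports continuity, holomorphy and polynomiality to inverses.\<close>

definition cofac :: "complex^'n^'n \<Rightarrow> 'n \<Rightarrow> 'n \<Rightarrow> complex"
  where "cofac A i j = det (\<chi> k l. if l = i then axis j 1 $ k else A $ k $ l)"

lemma matrix_inv_cramer:
  assumes "invertible (A :: complex^'n^'n)"
  shows "matrix_inv A $ i $ j = cofac A i j / det A"
proof -
  have "A *v (matrix_inv A *v axis j 1) = axis j 1"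
    by (rule matrix_inv_vec[OF assms])
  moreover have "det A \<noteq> 0" using assms by (simp add: invertible_det_nz)
  ultimately have "matrix_inv A *v axis j 1
      = (\<chi> k. det (\<chi> i l. if l = k then axis j 1 $ i else A $ i $ l) / det A)"
    using cramer by blast
  then have "(matrix_inv A *v axis j 1) $ i = cofac A i j / det A"
    by (simp add: cofac_def)
  then show ?thesis by (simp only: matrix_vector_axis_nth)
qed

section \<open>Quadratic forms of block matrices\<close>

lemma block_quadratic:
  fixes v :: "complex^('a::finite + 'b::finite)"
  defines "x \<equiv> (\<chi> i. v $ Inl i)" and "y \<equiv> (\<chi> i. v $ Inr i)"
  shows "v \<bullet> (block2 K L M N *v v)
    = x \<bullet> (K *v x) + x \<bullet> (L *v y) + y \<bullet> (M *v x) + y \<bullet> (N *v y)"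
proof -
  have UN: "(UNIV :: ('a + 'b) set) = Inl ` UNIV \<union> Inr ` UNIV"
    by (metis UNIV_Plus_UNIV Plus_def)
  have S: "(\<Sum>i\<in>UNIV. f i) = (\<Sum>i\<in>UNIV. f (Inl i)) + (\<Sum>i\<in>UNIV. f (Inr i))"
    for f :: "('a + 'b) \<Rightarrow> 'c::comm_monoid_add"
    by (subst UN, subst sum.union_disjoint) (auto simp: sum.reindex)
  show "v \<bullet> (block2 K L M N *v v)
    = x \<bullet> (K *v x) + x \<bullet> (L *v y) + y \<bullet> (M *v x) + y \<bullet> (N *v y)"
    by (simp add: inner_vec_def S matrix_vector_mult_def block2_def vcat_def hcat_def x_def y_def
        inner_add_right sum.distrib algebra_simps)
qed

definition pair_vec :: "complex^'a \<Rightarrow> complex^'b \<Rightarrow> complex^('a::finite + 'b::finite)"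
  where "pair_vec x y = (\<chi> k. case k of Inl i \<Rightarrow> x $ i | Inr j \<Rightarrow> y $ j)"

lemma block_pair: "pair_vec x y \<bullet> (block2 K L M N *v pair_vec x y)
    = x \<bullet> (K *v x) + x \<bullet> (L *v y) + y \<bullet> (M *v x) + y \<bullet> (N *v y)"
  by (subst block_quadratic) (simp add: pair_vec_def)

lemma hnsd_block2:
  assumes "hnsd (block2 K L M N)"
  shows "x \<bullet> (K *v x) + x \<bullet> (L *v y) + y \<bullet> (M *v x) + y \<bullet> (N *v y) \<le> 0"
  using hnsd_inner[OF assms, of "pair_vec x y"] by (simp add: block_pair)

section \<open>Continuity and holomorphy of matrix operations\<close>

lemma continuous_on_matrix_mult [continuous_intros]:
  fixes f :: "'a::topological_space \<Rightarrow> complex^'k^'m" and g :: "'a \<Rightarrow> complex^'n^'k"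
  assumes "continuous_on S f" "continuous_on S g"
  shows "continuous_on S (\<lambda>x. f x ** g x)"
  unfolding matrix_matrix_mult_def
  by (intro continuous_on_vec_lambda continuous_intros assms)

lemma continuous_on_matrix_vector_mult [continuous_intros]:
  fixes f :: "'a::topological_space \<Rightarrow> complex^'k^'m" and g :: "'a \<Rightarrow> complex^'k"
  assumes "continuous_on S f" "continuous_on S g"
  shows "continuous_on S (\<lambda>x. f x *v g x)"
  unfolding matrix_vector_mult_def
  by (intro continuous_on_vec_lambda continuous_intros assms)

lemma continuous_on_det [continuous_intros]:
  fixes f :: "'a::topological_space \<Rightarrow> complex^'n^'n"
  assumes "\<And>i j. continuous_on S (\<lambda>x. f x $ i $ j)"
  shows "continuous_on S (\<lambda>x. det (f x))"
  unfolding det_def by (intro continuous_intros assms)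

lemma continuous_on_cofac [continuous_intros]:
  fixes f :: "'a::topological_space \<Rightarrow> complex^'n^'n"
  assumes "\<And>i j. continuous_on S (\<lambda>x. f x $ i $ j)"
  shows "continuous_on S (\<lambda>x. cofac (f x) i j)"
  unfolding cofac_def
proof (intro continuous_on_det)
  fix k l
  show "continuous_on S (\<lambda>x. (\<chi> k l. if l = i then axis j 1 $ k else f x $ k $ l) $ k $ l)"
    by (cases "l = i") (simp_all add: assms)
qed

lemma continuous_on_ctransp [continuous_intros]:
  fixes f :: "'a::topological_space \<Rightarrow> complex^'n^'m"
  assumes "continuous_on S f"
  shows "continuous_on S (\<lambda>x. (f x)\<^sup>H)"
  unfolding ctransp_def by (intro continuous_on_vec_lambda continuous_intros assms)

lemma holomorphic_on_det:
  fixes f :: "complex \<Rightarrow> complex^'n^'n"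
  assumes "\<And>i j. (\<lambda>x. f x $ i $ j) holomorphic_on S"
  shows "(\<lambda>x. det (f x)) holomorphic_on S"
  unfolding det_def by (intro holomorphic_intros assms)

lemma holomorphic_on_cofac:
  fixes f :: "complex \<Rightarrow> complex^'n^'n"
  assumes "\<And>i j. (\<lambda>x. f x $ i $ j) holomorphic_on S"
  shows "(\<lambda>x. cofac (f x) i j) holomorphic_on S"
  unfolding cofac_def
proof (intro holomorphic_on_det)
  fix k l
  show "(\<lambda>x. (\<chi> k l. if l = i then axis j 1 $ k else f x $ k $ l) $ k $ l) holomorphic_on S"
    by (cases "l = i") (simp_all add: assms)
qed

lemma mat_holomorphic_matrix_inv:
  fixes A :: "complex \<Rightarrow> complex^'n^'n"
  assumes "mat_holomorphic_on A S" "\<And>s. s \<in> S \<Longrightarrow> invertible (A s)"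
  shows "mat_holomorphic_on (\<lambda>s. matrix_inv (A s)) S"
proof -
  have h: "\<And>i j. (\<lambda>s. A s $ i $ j) holomorphic_on S"
    using assms(1) by (simp add: mat_holomorphic_on_def)
  show ?thesis
    unfolding mat_holomorphic_on_def
  proof (intro allI)
    fix i j
    have "(\<lambda>s. cofac (A s) i j / det (A s)) holomorphic_on S"
      using assms(2)
      by (intro holomorphic_on_divide holomorphic_on_cofac holomorphic_on_det h)
         (auto simp: invertible_det_nz)
    then show "(\<lambda>s. matrix_inv (A s) $ i $ j) holomorphic_on S"
      by (rule holomorphic_transform) (simp add: matrix_inv_cramer assms(2))
  qed
qed

lemma mat_holomorphic_add:
  "mat_holomorphic_on A S \<Longrightarrow> mat_holomorphic_on B S \<Longrightarrow> mat_holomorphic_on (\<lambda>s. A s + B s) S"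
  by (simp add: mat_holomorphic_on_def holomorphic_on_add)

lemma mat_holomorphic_diff:
  "mat_holomorphic_on A S \<Longrightarrow> mat_holomorphic_on B S \<Longrightarrow> mat_holomorphic_on (\<lambda>s. A s - B s) S"
  by (simp add: mat_holomorphic_on_def holomorphic_on_diff)

lemma mat_holomorphic_mult:
  "mat_holomorphic_on A S \<Longrightarrow> mat_holomorphic_on B S \<Longrightarrow> mat_holomorphic_on (\<lambda>s. A s ** B s) S"
  by (auto simp add: mat_holomorphic_on_def matrix_matrix_mult_def intro!: holomorphic_intros)

lemma mat_holomorphic_const: "mat_holomorphic_on (\<lambda>_. A) S"
  by (simp add: mat_holomorphic_on_def)

lemma mat_holomorphic_mat: "f holomorphic_on S \<Longrightarrow> mat_holomorphic_on (\<lambda>s. mat (f s)) S"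
  unfolding mat_holomorphic_on_def mat_def
  by (intro allI, rename_tac i j, case_tac "i = j") auto

lemma mat_holomorphic_compose:
  assumes "mat_holomorphic_on G T" "f holomorphic_on S" "f ` S \<subseteq> T"
  shows "mat_holomorphic_on (\<lambda>s. G (f s)) S"
  unfolding mat_holomorphic_on_def
proof (intro allI)
  fix i j
  have "(\<lambda>s. G s $ i $ j) holomorphic_on T" using assms(1) by (simp add: mat_holomorphic_on_def)
  then have "((\<lambda>s. G s $ i $ j) \<circ> f) holomorphic_on S"
    by (rule holomorphic_on_compose_gen[OF assms(2) _ assms(3)])
  then show "(\<lambda>s. G (f s) $ i $ j) holomorphic_on S" by (simp add: o_def)
qed

section \<open>Closure properties of bounded analytic matrix functions\<close>

lemma Hinf_ext_iff:
  "G \<in> Hinf_ext \<longleftrightarrow> mat_holomorphic_on G ext_disc \<and> (\<exists>B. \<forall>q\<in>ext_disc. norm (G q) \<le> B)"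
  by (simp add: Hinf_ext_def bounded_iff)

lemma Hinf_ext_bound:
  assumes "G \<in> Hinf_ext"
  obtains B where "0 < B" "\<And>q. 1 < norm q \<Longrightarrow> norm (G q) \<le> B"
proof -
  obtain B where B: "\<forall>q\<in>ext_disc. norm (G q) \<le> B"
    using assms by (auto simp: Hinf_ext_iff)
  show thesis
    by (rule that[of "max B 1"]) (use B in \<open>auto simp: le_max_iff_disj\<close>)
qed

lemma Hinf_ext_add: "G \<in> Hinf_ext \<Longrightarrow> H \<in> Hinf_ext \<Longrightarrow> (\<lambda>q. G q + H q) \<in> Hinf_ext"
  unfolding Hinf_ext_iff
  by (auto simp: mat_holomorphic_add) (meson add_mono norm_triangle_le)

lemma Hinf_ext_diff: "G \<in> Hinf_ext \<Longrightarrow> H \<in> Hinf_ext \<Longrightarrow> (\<lambda>q. G q - H q) \<in> Hinf_ext"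
  unfolding Hinf_ext_iff
  by (auto simp: mat_holomorphic_diff) (meson add_mono norm_triangle_le_diff)

lemma Hinf_ext_mult:
  assumes "G \<in> Hinf_ext" "H \<in> Hinf_ext"
  shows "(\<lambda>q. G q ** H q) \<in> Hinf_ext"
proof -
  obtain B where B: "0 < B" "\<And>q. 1 < norm q \<Longrightarrow> norm (G q) \<le> B"
    using Hinf_ext_bound[OF assms(1)] by blast
  obtain C where C: "0 < C" "\<And>q. 1 < norm q \<Longrightarrow> norm (H q) \<le> C"
    using Hinf_ext_bound[OF assms(2)] by blast
  have "norm (G q ** H q) \<le> B * C" if "1 < norm q" for q
    using norm_matrix_mult_le[of "G q" "H q"] mult_mono[OF B(2)[OF that] C(2)[OF that]] B C
    by auto
  then show ?thesis
    using assms by (auto simp: Hinf_ext_iff mat_holomorphic_mult)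
qed

lemma Hinf_ext_cong:
  assumes "\<And>q. 1 < norm q \<Longrightarrow> G q = H q" "G \<in> Hinf_ext"
  shows "H \<in> Hinf_ext"
proof -
  have "mat_holomorphic_on H ext_disc"
    using assms(2) unfolding mat_holomorphic_on_def Hinf_ext_def mem_Collect_eq
    by (metis (no_types, lifting) assms(1) holomorphic_transform mem_Collect_eq)
  then show ?thesis using assms by (auto simp: Hinf_ext_iff)
qed

lemma Hinf_ext_const: "(\<lambda>_. A) \<in> Hinf_ext"
  by (auto simp: Hinf_ext_iff mat_holomorphic_const)

lemma Hinf_ext_scaleR: "G \<in> Hinf_ext \<Longrightarrow> (\<lambda>q. c *\<^sub>R G q) \<in> Hinf_ext"
proof -
  assume G: "G \<in> Hinf_ext"
  have "c *\<^sub>R A = mat (of_real c) ** A" for A :: "complex^'a^'b"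
    unfolding vec_eq_iff mat_mult_nth vector_scaleR_component
    by (simp add: scaleR_conv_of_real[where 'a = complex])
  then show ?thesis using Hinf_ext_mult[OF Hinf_ext_const G] by simp
qed

lemma Hinf_ext_dilation:
  assumes "G \<in> Hinf_ext" "1 \<le> r"
  shows "(\<lambda>q. G (of_real r * q)) \<in> Hinf_ext"
proof -
  have *: "1 < norm (of_real r * q)" if "1 < norm q" for q :: complex
    using mult_mono[OF assms(2) order_refl[of "norm q"]] that assms(2) by (simp add: norm_mult)
  have "mat_holomorphic_on (\<lambda>q. G (of_real r * q)) ext_disc"
    by (rule mat_holomorphic_compose[where T = ext_disc])
       (use assms * in \<open>auto simp: Hinf_ext_iff intro!: holomorphic_intros\<close>)
  then show ?thesis
    using assms * by (auto simp: Hinf_ext_iff)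
qed

section \<open>Functions continuous up to the unit circle and at infinity\<close>

text \<open>Continuity up to the circle and up to infinity at once. The inversion q to 1/q turns
  this closed exterior into the compact unit disc, which gives boundedness and uniform
  continuity.\<close>

definition cont_ext :: "(complex \<Rightarrow> 'a::topological_space) \<Rightarrow> bool"
  where "cont_ext G \<longleftrightarrow>
    (\<exists>g. continuous_on (cball 0 1) g \<and> (\<forall>q. 1 < norm q \<longrightarrow> G q = g (inverse q)))"

lemma inverse_ext_disc: "1 < norm (q::complex) \<Longrightarrow> inverse q \<in> cball 0 1"
  "1 < norm (q::complex) \<Longrightarrow> inverse q \<in> ball 0 1"
  by (simp_all add: norm_inverse inverse_le_1_iff inverse_less_1_iff)

lemma inverse_punctured_disc: "w \<in> ball 0 1 \<Longrightarrow> w \<noteq> 0 \<Longrightarrow> 1 < norm (inverse (w::complex))"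
  by (simp add: norm_inverse one_less_inverse_iff)

lemma ext_disc_ne_minus_one: "1 < norm q \<Longrightarrow> q \<noteq> - (1 :: complex)"
  by (metis norm_minus_cancel norm_one less_irrefl)

lemma cont_ext_const: "cont_ext (\<lambda>_. c)"
  unfolding cont_ext_def by (rule exI[of _ "\<lambda>_. c"]) auto

lemma cont_ext_compose2:
  assumes "cont_ext G" "cont_ext H"
    and "\<And>g h. continuous_on (cball 0 1) g \<Longrightarrow> continuous_on (cball 0 1) h \<Longrightarrow>
      continuous_on (cball (0::complex) 1) (\<lambda>w. f (g w) (h w))"
  shows "cont_ext (\<lambda>q. f (G q) (H q))"
proof -
  obtain g h where "continuous_on (cball 0 1) g" "\<forall>q. 1 < norm q \<longrightarrow> G q = g (inverse q)"
    "continuous_on (cball 0 1) h" "\<forall>q. 1 < norm q \<longrightarrow> H q = h (inverse q)"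
    using assms(1,2) unfolding cont_ext_def by auto
  then show ?thesis
    unfolding cont_ext_def
    by (intro exI[of _ "\<lambda>w. f (g w) (h w)"]) (auto intro: assms(3))
qed

lemma cont_ext_cong:
  assumes "\<And>q. 1 < norm q \<Longrightarrow> G q = H q" "cont_ext G"
  shows "cont_ext H"
  using assms unfolding cont_ext_def by auto

lemma cont_ext_add:
  fixes G H :: "complex \<Rightarrow> 'a::real_normed_vector"
  shows "cont_ext G \<Longrightarrow> cont_ext H \<Longrightarrow> cont_ext (\<lambda>q. G q + H q)"
  by (rule cont_ext_compose2) (auto intro: continuous_intros)

lemma cont_ext_mult:
  fixes G :: "complex \<Rightarrow> complex^'k^'m" and H :: "complex \<Rightarrow> complex^'n^'k"
  shows "cont_ext G \<Longrightarrow> cont_ext H \<Longrightarrow> cont_ext (\<lambda>q. G q ** H q)"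
  by (rule cont_ext_compose2) (auto intro: continuous_intros)

lemma cont_ext_matrixI:
  fixes G :: "complex \<Rightarrow> complex^'n^'m"
  assumes "\<And>i j. cont_ext (\<lambda>q. G q $ i $ j)"
  shows "cont_ext G"
proof -
  have "\<forall>i j. \<exists>g. continuous_on (cball 0 1) g \<and> (\<forall>q. 1 < norm q \<longrightarrow> G q $ i $ j = g (inverse q))"
    using assms unfolding cont_ext_def by blast
  then obtain g where g: "\<And>i j. continuous_on (cball 0 1) (g i j)"
    "\<And>i j q. 1 < norm q \<Longrightarrow> G q $ i $ j = g i j (inverse q)"
    by metis
  show ?thesis
    unfolding cont_ext_def
    by (rule exI[of _ "\<lambda>w. \<chi> i j. g i j w"])
       (auto simp: vec_eq_iff g(2) intro!: continuous_on_vec_lambda g(1))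
qed

lemma cont_ext_bounded:
  fixes G :: "complex \<Rightarrow> 'a::real_normed_vector"
  assumes "cont_ext G"
  shows "\<exists>B. \<forall>q\<in>ext_disc. norm (G q) \<le> B"
proof -
  obtain g where g: "continuous_on (cball 0 1) g" "\<And>q. 1 < norm q \<Longrightarrow> G q = g (inverse q)"
    using assms unfolding cont_ext_def by auto
  have "bounded (g ` cball 0 1)"
    using compact_continuous_image[OF g(1)] by (simp add: compact_imp_bounded)
  then obtain B where "\<forall>w\<in>cball 0 1. norm (g w) \<le> B"
    by (auto simp: bounded_iff)
  then show ?thesis using g(2) inverse_ext_disc by (metis mem_Collect_eq)
qed

lemma eventually_radial:
  assumes "\<And>q. 1 < norm q \<Longrightarrow> R q"
  shows "eventually (\<lambda>r. R (of_real r * cis \<Omega>)) (at_right 1)"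
  unfolding eventually_at_right_field
  by (rule exI[of _ 2]) (auto simp: norm_mult intro!: assms)

text \<open>Inversion conjugates points of the circle, hence the argument
  \<open>cis (- \<Omega>)\<close>.\<close>

lemma tendsto_radial:
  assumes "continuous_on (cball 0 1) g"
  shows "((\<lambda>r. g (inverse (of_real r * cis \<Omega>))) \<longlongrightarrow> g (cis (- \<Omega>))) (at_right 1)"
proof -
  have "(\<lambda>r. inverse (of_real r * cis \<Omega>)) \<midarrow>1\<rightarrow> inverse (of_real 1 * cis \<Omega>)"
    by (intro tendsto_intros) auto
  then have "((\<lambda>r. inverse (of_real r * cis \<Omega>)) \<longlongrightarrow> cis (- \<Omega>)) (at_right 1)"
    by (metis cis_inverse filterlim_at_split mult_1 of_real_1)
  moreover have "eventually (\<lambda>r. inverse (of_real r * cis \<Omega>) \<in> cball 0 1) (at_right (1::real))"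
    by (rule eventually_radial) (rule inverse_ext_disc)
  ultimately show ?thesis
    by (auto intro: continuous_on_tendsto_compose[OF assms])
qed

lemma cont_ext_radial:
  assumes "cont_ext G"
  shows "\<exists>L. ((\<lambda>r. G (of_real r * cis \<Omega>)) \<longlongrightarrow> L) (at_right 1)"
proof -
  obtain g where g: "continuous_on (cball 0 1) g" "\<And>q. 1 < norm q \<Longrightarrow> G q = g (inverse q)"
    using assms unfolding cont_ext_def by auto
  have "eventually (\<lambda>r. g (inverse (of_real r * cis \<Omega>)) = G (of_real r * cis \<Omega>)) (at_right (1::real))"
    by (rule eventually_radial) (simp add: g(2))
  with tendsto_radial[OF g(1), of \<Omega>] show ?thesis
    by (blast intro: Lim_transform_eventually)
qed

text \<open>In the coordinate 1/q the dilation moves a point by at most 1 - 1/r, which is at most r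
  - 1. Uniform continuity on the closed disc with modulus d thus allows the bound 1 + d for
  r.\<close>

lemma cont_ext_dilation:
  fixes G :: "complex \<Rightarrow> 'a::real_normed_vector"
  assumes "cont_ext G" "0 < e"
  shows "\<exists>\<rho>>1. \<forall>r q. 1 \<le> r \<longrightarrow> r < \<rho> \<longrightarrow> 1 < norm q \<longrightarrow> norm (G (of_real r * q) - G q) < e"
proof -
  obtain g where g: "continuous_on (cball 0 1) g" "\<And>q. 1 < norm q \<Longrightarrow> G q = g (inverse q)"
    using assms unfolding cont_ext_def by auto
  obtain d where d: "0 < d" "\<And>w w'. w \<in> cball 0 1 \<Longrightarrow> w' \<in> cball 0 1 \<Longrightarrow> dist w' w < d \<Longrightarrow> dist (g w') (g w) < e"
    using compact_uniformly_continuous[OF g(1)] assms(2)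
    unfolding uniformly_continuous_on_def by (meson compact_cball)
  show ?thesis
  proof (intro exI[of _ "1 + d"] conjI allI impI)
    fix r q assume r: "1 \<le> r" "r < 1 + d" and q: "1 < norm (q::complex)"
    have rq: "1 < norm (of_real r * q)"
      using mult_mono[OF r(1) order_refl[of "norm q"]] q r(1) by (simp add: norm_mult)
    have "inverse (of_real r * q) - inverse q = of_real (inverse r - 1) * inverse q"
      by (simp add: algebra_simps)
    then have "dist (inverse (of_real r * q)) (inverse q) = \<bar>inverse r - 1\<bar> * norm (inverse q)"
      by (simp only: dist_norm norm_mult norm_of_real)
    also have "\<dots> \<le> \<bar>inverse r - 1\<bar> * 1"
      using inverse_ext_disc(1)[OF q] by (intro mult_left_mono) auto
    also have "\<bar>inverse r - 1\<bar> = (r - 1) / r"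
      using r by (simp add: field_simps)
    also have "\<dots> * 1 \<le> r - 1" using r
      by (simp add: divide_le_eq mult_le_cancel_left1)
    also have "\<dots> < d" using r by simp
    finally show "norm (G (of_real r * q) - G q) < e"
      using d(2) inverse_ext_disc(1)[OF q] inverse_ext_disc(1)[OF rq] g(2)[OF q] g(2)[OF rq]
      by (simp add: dist_norm)
  qed (use d in simp)
qed

lemma islimpt_punctured_disc:
  assumes "finite T" "x \<in> ball 0 1"
  shows "x islimpt (ball (0::complex) 1 - T)"
proof -
  have "x islimpt ball 0 1" using assms(2) by (simp add: open_imp_islimpt interior_limit_point)
  then have "x islimpt (ball 0 1 - T) \<union> T" by (rule islimpt_subset) auto
  then show ?thesis using islimpt_finite[OF assms(1)] unfolding islimpt_Un by blast
qed

lemma cball_subset_closure_punctured: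
  fixes T :: "complex set"
  assumes "finite T"
  shows "cball 0 1 \<subseteq> closure (ball 0 1 - T)"
proof -
  have "ball 0 1 \<subseteq> closure (ball 0 1 - T)"
    using islimpt_punctured_disc[OF assms] by (auto simp: closure_def)
  then have "closure (ball 0 1) \<subseteq> closure (ball 0 1 - T)"
    by (metis closure_closure closure_mono)
  then show ?thesis by simp
qed

lemma continuous_ge_cball:
  fixes f :: "complex \<Rightarrow> real"
  assumes "continuous_on (cball 0 1) f" "finite T"
    and "\<And>w. w \<in> ball 0 1 \<Longrightarrow> w \<notin> T \<Longrightarrow> a \<le> f w" and w: "w \<in> cball 0 1"
  shows "a \<le> f w"
proof -
  have "closure (ball 0 1 - T) = cball 0 1"
    using cball_subset_closure_punctured[OF assms(2)] closure_mono[of "ball 0 1 - T" "ball 0 1"]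
    by auto
  then show ?thesis
    using continuous_ge_on_closure[of "ball 0 1 - T" f w a] assms by auto
qed

text \<open>The bound on the inverse says that norm x is at most C times norm (A x). This is a
  closed condition, so it extends to the circle and to w = 0, the image of q = infinity. The
  extension is then invertible on the whole disc, and Cramer's rule shows that its inverse is
  continuous.\<close>

lemma cont_ext_matrix_inv:
  fixes A :: "complex \<Rightarrow> complex^'n^'n"
  assumes A: "cont_ext A" and inv: "\<And>q. 1 < norm q \<Longrightarrow> invertible (A q)"
    and C: "\<And>q. 1 < norm q \<Longrightarrow> norm (matrix_inv (A q)) \<le> C"
  shows "cont_ext (\<lambda>q. matrix_inv (A q))"
proof -
  obtain g where g: "continuous_on (cball 0 1) g" "\<And>q. 1 < norm q \<Longrightarrow> A q = g (inverse q)"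
    using A unfolding cont_ext_def by auto
  have low: "0 \<le> C * norm (g w *v x) - norm x" if "w \<in> cball 0 1" for w x
  proof (rule continuous_ge_cball[where T = "{0}" and f = "\<lambda>w. C * norm (g w *v x) - norm x"])
    show "continuous_on (cball 0 1) (\<lambda>w. C * norm (g w *v x) - norm x)"
      by (intro continuous_intros g(1))
    fix w :: complex assume "w \<in> ball 0 1" "w \<notin> {0}"
    then have q: "1 < norm (inverse w)" using inverse_punctured_disc by simp
    have "norm x = norm (matrix_inv (A (inverse w)) *v (A (inverse w) *v x))"
      by (simp add: matrix_inv_vec[OF inv[OF q]])
    also have "\<dots> \<le> norm (matrix_inv (A (inverse w))) * norm (A (inverse w) *v x)"
      by (rule norm_matrix_vector_le)
    also have "\<dots> \<le> C * norm (A (inverse w) *v x)"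
      by (intro mult_right_mono C q) simp
    finally show "0 \<le> C * norm (g w *v x) - norm x" using g(2)[OF q] by simp
  qed (use that in auto)
  have ginv: "invertible (g w)" if "w \<in> cball 0 1" for w
    unfolding invertible_kernel
  proof (intro allI impI)
    fix x assume "g w *v x = 0"
    then show "x = 0" using low[OF that, of x] by simp
  qed
  have "continuous_on (cball 0 1) (\<lambda>w. cofac (g w) i j / det (g w))" for i j
    using ginv by (intro continuous_intros g(1)) (auto simp: invertible_det_nz)
  then have "continuous_on (cball 0 1) (\<lambda>w. \<chi> i j. cofac (g w) i j / det (g w))"
    by (intro continuous_on_vec_lambda)
  moreover have "matrix_inv (A q) = (\<chi> i j. cofac (g (inverse q)) i j / det (g (inverse q)))"
    if "1 < norm q" for q
    unfolding g(2)[OF that, symmetric] by (simp add: vec_eq_iff matrix_inv_cramer inv that)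
  ultimately show ?thesis unfolding cont_ext_def by blast
qed

section \<open>Bounded rational functions\<close>

lemma continuous_eq_punctured_disc:
  fixes f g :: "complex \<Rightarrow> complex"
  assumes "continuous_on (ball 0 1) f" "continuous_on (ball 0 1) g" "finite T"
    and eq: "\<And>w. w \<in> ball 0 1 \<Longrightarrow> w \<notin> T \<Longrightarrow> f w = g w" and w: "w \<in> ball 0 1"
  shows "f w = g w"
proof -
  have nt: "at w within (ball 0 1 - T) \<noteq> bot"
    using islimpt_punctured_disc[OF assms(3) w] by (simp add: trivial_limit_within)
  have fg: "(f \<longlongrightarrow> f w) (at w within (ball 0 1 - T))" "(g \<longlongrightarrow> g w) (at w within (ball 0 1 - T))"
    using assms(1,2) w unfolding continuous_on_def by (meson Diff_subset tendsto_within_subset)+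
  have "eventually (\<lambda>x. f x = g x) (at w within (ball 0 1 - T))"
    unfolding eventually_at_filter using eq by (intro always_eventually) auto
  with fg(1) have "(g \<longlongrightarrow> f w) (at w within (ball 0 1 - T))"
    by (rule Lim_transform_eventually)
  then show ?thesis
    using tendsto_unique[OF nt _ fg(2)] by blast
qed

text \<open>At a root \<open>a\<close> of \<open>e\<close> in the closed disc, the inequality norm p
  <= B norm e forces p(a) = 0, so the factor w - a cancels from both. Induction on the degree ends
  with a denominator without roots in the closed disc.\<close>

lemma bounded_quotient_continuous_extension:
  assumes "continuous_on (ball 0 1) g" "\<And>w. w \<in> ball 0 1 \<Longrightarrow> norm (g w) \<le> B" "e \<noteq> 0"
    and "\<And>w. w \<in> ball 0 1 \<Longrightarrow> g w * poly e w = poly p w"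
  shows "\<exists>h. continuous_on (cball 0 1) h \<and> (\<forall>w\<in>ball 0 1. h w = (g w :: complex))"
  using assms(3,4)
proof (induction "degree e" arbitrary: e p rule: less_induct)
  case less
  show ?case
  proof (cases "\<exists>a\<in>cball 0 1. poly e a = 0")
    case False
    then have "continuous_on (cball 0 1) (\<lambda>w. poly p w / poly e w)"
      by (intro continuous_intros) auto
    moreover have "\<forall>w\<in>ball 0 1. poly p w / poly e w = g w"
      using False less.prems(2) ball_subset_cball by (metis nonzero_mult_div_cancel_right subsetD)
    ultimately show ?thesis by blast
  next
    case True
    then obtain a where a: "a \<in> cball 0 1" "poly e a = 0" by blast
    have "0 \<le> B * norm (poly e a) - norm (poly p a)"
    proof (rule continuous_ge_cball[where T = "{}" and f = "\<lambda>w. B * norm (poly e w) - norm (poly p w)"])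
      show "continuous_on (cball 0 1) (\<lambda>w. B * norm (poly e w) - norm (poly p w))"
        by (intro continuous_intros)
      fix w :: complex assume w: "w \<in> ball 0 1"
      have "norm (poly p w) = norm (g w) * norm (poly e w)"
        by (metis less.prems(2) norm_mult w)
      then show "0 \<le> B * norm (poly e w) - norm (poly p w)"
        using assms(2)[OF w] by (simp add: mult_right_mono)
    qed (use a in auto)
    then have "poly p a = 0" using a(2) by simp
    then obtain p1 e1 where p1: "p = [:- a, 1:] * p1" and e1: "e = [:- a, 1:] * e1"
      using a(2) by (metis dvdE poly_eq_0_iff_dvd)
    have e1nz: "e1 \<noteq> 0" using e1 less.prems(1) by auto
    have "degree e1 < degree e"
      using e1nz unfolding e1 by (subst degree_mult_eq) auto
    moreover have "g w * poly e1 w = poly p1 w" if "w \<in> ball 0 1" for w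
    proof (rule continuous_eq_punctured_disc[where T = "{a}" and f = "\<lambda>w. g w * poly e1 w" and g = "poly p1"])
      show "continuous_on (ball 0 1) (\<lambda>w. g w * poly e1 w)" "continuous_on (ball 0 1) (poly p1)"
        by (intro continuous_intros assms(1))+
      fix w :: complex assume w: "w \<in> ball 0 1" "w \<notin> {a}"
      have "(w - a) * (g w * poly e1 w) = (w - a) * poly p1 w"
        using less.prems(2)[OF w(1)] unfolding p1 e1 by (simp add: algebra_simps)
      then show "g w * poly e1 w = poly p1 w" using w(2) by simp
    qed (use that in auto)
    ultimately show ?thesis using less.hyps e1nz by blast
  qed
qed

text \<open>In the coordinate 1/q, infinity is a removable singularity of a bounded function, and
  the value there inherits the bound as a limit.\<close>

lemma bounded_ext_disc_function:
  assumes "f holomorphic_on ext_disc" "\<And>q. 1 < norm q \<Longrightarrow> norm (f q) \<le> B"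
  obtains g where "g holomorphic_on ball 0 1" "\<And>w. w \<in> ball 0 1 \<Longrightarrow> norm (g w) \<le> B"
    "\<And>q. 1 < norm q \<Longrightarrow> f q = g (inverse q)"
proof -
  have hol: "(\<lambda>w. f (inverse w)) holomorphic_on ball 0 1 - {0}"
    by (rule holomorphic_on_compose_gen[OF _ assms(1), unfolded o_def])
       (use inverse_punctured_disc in \<open>auto intro!: holomorphic_intros\<close>)
  have "eventually (\<lambda>w. norm (f (inverse w)) \<le> B) (at 0)"
    unfolding eventually_at
    by (rule exI[of _ 1]) (use assms(2) inverse_punctured_disc in \<open>auto simp: dist_norm\<close>)
  then obtain g where g: "g holomorphic_on ball 0 1" "\<And>w. w \<in> ball 0 1 - {0} \<Longrightarrow> g w = f (inverse w)"
    using holomorphic_on_extend_bounded[OF hol] by auto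
  have "isCont g 0"
    using holomorphic_on_imp_continuous_on[OF g(1)] by (simp add: continuous_on_eq_continuous_at)
  then have "(\<lambda>w. norm (g w)) \<midarrow>0\<rightarrow> norm (g 0)" by (simp add: isCont_def tendsto_norm)
  moreover have "eventually (\<lambda>w. norm (g w) \<le> B) (at 0)"
    unfolding eventually_at
    by (rule exI[of _ 1]) (use assms(2) inverse_punctured_disc g(2) in \<open>auto simp: dist_norm\<close>)
  ultimately have g0: "norm (g 0) \<le> B"
    by (rule tendsto_upperbound) simp
  show thesis
  proof (rule that[OF g(1)])
    fix w :: complex assume "w \<in> ball 0 1"
    then show "norm (g w) \<le> B"
      using g0 g(2) assms(2) inverse_punctured_disc by (cases "w = 0") auto
  next
    fix q :: complex assume q: "1 < norm q"
    then show "f q = g (inverse q)"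
      using g(2)[of "inverse q"] inverse_ext_disc(2)[OF q] by (cases "q = 0") auto
  qed
qed

text \<open>The identity is asked for only off the roots of \<open>d\<close>, because at a singular
  pencil the value of \<open>matrix_inv\<close> is unspecified. Continuity of the extension closes
  these gaps.\<close>

lemma bounded_rational_cont_ext:
  assumes "f holomorphic_on ext_disc" "\<And>q. 1 < norm q \<Longrightarrow> norm (f q) \<le> B" "d \<noteq> 0"
    and eq: "\<And>q. 1 < norm q \<Longrightarrow> poly d q \<noteq> 0 \<Longrightarrow> f q * poly d q = poly p q"
  shows "cont_ext f"
proof -
  obtain g where g: "g holomorphic_on ball 0 1" "\<And>w. w \<in> ball 0 1 \<Longrightarrow> norm (g w) \<le> B"
    "\<And>q. 1 < norm q \<Longrightarrow> f q = g (inverse q)"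
    using bounded_ext_disc_function[OF assms(1,2)] by blast
  note cg = holomorphic_on_imp_continuous_on[OF g(1)]
  \<comment> \<open>Substituting q = 1/w and multiplying by w to the power degree p + degree d
    clears all negative powers. The extra monomials bring the two reflected polynomials to this
    common power.\<close>
  define e where "e = reflect_poly d * monom 1 (degree p)"
  define p' where "p' = reflect_poly p * monom 1 (degree d)"
  define T where "T = insert 0 {w. poly (reflect_poly d) w = 0}"
  have finT: "finite T" unfolding T_def using assms(3) by (simp add: poly_roots_finite)
  have "e \<noteq> 0" unfolding e_def using assms(3) by (simp add: monom_eq_0_iff)
  moreover have "g w * poly e w = poly p' w" if "w \<in> ball 0 1" for w
  proof (rule continuous_eq_punctured_disc[where T = T and f = "\<lambda>w. g w * poly e w" and g = "poly p'"])
    show "continuous_on (ball 0 1) (\<lambda>w. g w * poly e w)" "continuous_on (ball 0 1) (poly p')"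
      by (intro continuous_intros cg)+
    fix w :: complex assume w: "w \<in> ball 0 1" "w \<notin> T"
    then have w0: "w \<noteq> 0" and dw: "poly (reflect_poly d) w \<noteq> 0" by (auto simp: T_def)
    have "poly d (inverse w) \<noteq> 0" using dw w0 by (simp add: poly_reflect_poly_nz)
    then have "g w * poly d (inverse w) = poly p (inverse w)"
      using eq[OF inverse_punctured_disc[OF w(1) w0]] g(3)[OF inverse_punctured_disc[OF w(1) w0]]
      by simp
    then show "g w * poly e w = poly p' w"
      using w0 unfolding e_def p'_def by (simp add: poly_reflect_poly_nz poly_monom)
  qed (use that finT in auto)
  ultimately obtain h where "continuous_on (cball 0 1) h" "\<forall>w\<in>ball 0 1. h w = g w"
    using bounded_quotient_continuous_extension[OF cg g(2)] by blast
  then show ?thesis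
    unfolding cont_ext_def using g(3) inverse_ext_disc(2) by metis
qed


section \<open>Transfer functions under the bilinear transformation\<close>

text \<open>Stated for functions rather than for \<open>poly\<close>, so that polynomiality of
  determinants follows by closure rules alone.\<close>

definition poly_fun :: "(complex \<Rightarrow> complex) \<Rightarrow> bool"
  where "poly_fun f \<longleftrightarrow> (\<exists>p. \<forall>q. f q = poly p q)"

lemma poly_fun_const: "poly_fun (\<lambda>_. c)"
  unfolding poly_fun_def by (rule exI[of _ "[:c:]"]) simp

lemma poly_fun_ident: "poly_fun (\<lambda>q. q)"
  unfolding poly_fun_def by (rule exI[of _ "[:0, 1:]"]) simp

lemma poly_fun_add: "poly_fun f \<Longrightarrow> poly_fun g \<Longrightarrow> poly_fun (\<lambda>q. f q + g q)"
  unfolding poly_fun_def by (metis poly_add)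

lemma poly_fun_diff: "poly_fun f \<Longrightarrow> poly_fun g \<Longrightarrow> poly_fun (\<lambda>q. f q - g q)"
  unfolding poly_fun_def by (metis poly_diff)

lemma poly_fun_mult: "poly_fun f \<Longrightarrow> poly_fun g \<Longrightarrow> poly_fun (\<lambda>q. f q * g q)"
  unfolding poly_fun_def by (metis poly_mult)

lemma poly_fun_minus: "poly_fun f \<Longrightarrow> poly_fun (\<lambda>q. - f q)"
  unfolding poly_fun_def by (metis poly_minus)

lemma poly_fun_sum: "(\<And>i. i \<in> I \<Longrightarrow> poly_fun (f i)) \<Longrightarrow> poly_fun (\<lambda>q. \<Sum>i\<in>I. f i q)"
  by (induction I rule: infinite_finite_induct) (auto intro: poly_fun_const poly_fun_add)

lemma poly_fun_prod: "(\<And>i. i \<in> I \<Longrightarrow> poly_fun (f i)) \<Longrightarrow> poly_fun (\<lambda>q. \<Prod>i\<in>I. f i q)"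
  by (induction I rule: infinite_finite_induct) (auto intro: poly_fun_const poly_fun_mult)

lemmas poly_fun_intros = poly_fun_const poly_fun_ident poly_fun_minus poly_fun_add poly_fun_diff poly_fun_mult
  poly_fun_sum poly_fun_prod

lemma poly_fun_det:
  fixes f :: "complex \<Rightarrow> complex^'n^'n"
  assumes "\<And>i j. poly_fun (\<lambda>x. f x $ i $ j)"
  shows "poly_fun (\<lambda>x. det (f x))"
  unfolding det_def by (intro poly_fun_intros assms)

lemma poly_fun_cofac:
  fixes f :: "complex \<Rightarrow> complex^'n^'n"
  assumes "\<And>i j. poly_fun (\<lambda>x. f x $ i $ j)"
  shows "poly_fun (\<lambda>x. cofac (f x) i j)"
  unfolding cofac_def
proof (intro poly_fun_det)
  fix k l
  show "poly_fun (\<lambda>x. (\<chi> k l. if l = i then axis j 1 $ k else f x $ k $ l) $ k $ l)"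
    by (cases "l = i") (simp_all add: assms poly_fun_const)
qed

lemma poly_fun_continuous: "poly_fun f \<Longrightarrow> continuous_on S f"
proof -
  assume "poly_fun f"
  then obtain p where "f = poly p" unfolding poly_fun_def by auto
  then show ?thesis by (simp add: continuous_intros)
qed

text \<open>This is 2 \<tau> (q + 1) (s I - A), the resolvent matrix with the denominators of the
  bilinear map cleared. It is polynomial in q, and at q = -1, the image of s = infinity, it equals
  -2 I and is regular.\<close>

definition tilde_pencil :: "real \<Rightarrow> complex^'x^'x \<Rightarrow> complex \<Rightarrow> complex^'x^'x"
  where "tilde_pencil \<tau> A q = mat (q - 1) - mat (2 * of_real \<tau> * (q + 1)) ** A"

text \<open>The numerator of C (s I - A)^(-1) B over the determinant of the pencil, with a factor q
  + 1 left out. That factor makes the strictly proper part vanish at q = -1 and cancels against the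
  filter 1/(1 + q).\<close>

definition tilde_num ::
  "real \<Rightarrow> complex^'x^'x \<Rightarrow> complex^'i^'x \<Rightarrow> complex^'x^'o \<Rightarrow> 'o \<Rightarrow> 'i \<Rightarrow> complex \<Rightarrow> complex"
  where "tilde_num \<tau> A B C i j q =
    2 * of_real \<tau> * (\<Sum>k\<in>UNIV. \<Sum>l\<in>UNIV. C $ i $ l * cofac (tilde_pencil \<tau> A q) l k * B $ k $ j)"

lemma poly_fun_tilde_pencil: "poly_fun (\<lambda>q. tilde_pencil \<tau> A q $ i $ j)"
proof (cases "i = j")
  case True
  then show ?thesis
    by (simp add: tilde_pencil_def mat_mult_nth) (simp add: mat_def poly_fun_intros)
next
  case False
  then show ?thesis
    by (simp add: tilde_pencil_def mat_mult_nth) (simp add: mat_def poly_fun_intros)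
qed

lemma poly_fun_tilde_num: "poly_fun (tilde_num \<tau> A B C i j)"
  unfolding tilde_num_def by (intro poly_fun_intros poly_fun_cofac poly_fun_tilde_pencil)

lemma det_tilde_pencil_minus_one: "det (tilde_pencil \<tau> A (- 1)) \<noteq> 0"
proof -
  have "tilde_pencil \<tau> A (- 1) = mat (- 2)"
    by (auto simp: vec_eq_iff tilde_pencil_def mat_mult_nth)
  moreover have "invertible (mat (- 2) :: complex^'a^'a)"
    unfolding invertible_kernel by (simp add: vec_eq_iff)
  ultimately show ?thesis by (metis invertible_det_nz)
qed

lemma tilde_transfer_nth:
  assumes "0 < \<tau>" "q \<noteq> - 1" "det (tilde_pencil \<tau> A q) \<noteq> 0"
  shows "tilde \<tau> (transfer A B C D) q $ i $ j
    = (q + 1) * tilde_num \<tau> A B C i j q / det (tilde_pencil \<tau> A q) + D $ i $ j"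
proof -
  let ?T = "tilde_pencil \<tau> A q" and ?a = "2 * of_real \<tau> * (q + 1)"
  have a: "?a \<noteq> 0" using assms by (simp add: add_eq_0_iff2)
  have inv: "invertible ?T" using assms(3) by (simp add: invertible_det_nz)
  have "mat (1 / (2 * of_real \<tau>) * ((q - 1) / (q + 1))) - A = mat (1 / ?a) ** ?T"
  proof -
    have s: "1 / (2 * of_real \<tau>) * ((q - 1) / (q + 1)) = (q - 1) / ?a" by simp
    have "(mat ((q - 1) / ?a) - A) $ i $ j = (mat (1 / ?a) ** ?T) $ i $ j" for i j
      unfolding tilde_pencil_def mat_mult_nth vector_minus_component right_diff_distrib
      using a by (auto simp: mat_def)
    then show ?thesis unfolding s vec_eq_iff by blast
  qed
  moreover have "(mat (1 / ?a) ** ?T) ** (mat ?a ** matrix_inv ?T) = mat 1"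
  proof -
    have "(mat (1 / ?a) ** ?T) ** (mat ?a ** matrix_inv ?T)
        = (mat (1 / ?a) ** (mat ?a ** ?T)) ** matrix_inv ?T"
      by (metis matrix_mul_assoc mat_mult_commute)
    also have "mat (1 / ?a) ** (mat ?a ** ?T) = ?T"
      using a by (simp add: matrix_mul_assoc mat_mult_mat)
    finally show ?thesis by (simp add: matrix_inv_inverse[OF inv])
  qed
  ultimately have "matrix_inv (mat (1 / (2 * of_real \<tau>) * ((q - 1) / (q + 1))) - A)
      = mat ?a ** matrix_inv ?T"
    by (metis matrix_inv_unique)
  then have "tilde \<tau> (transfer A B C D) q = C ** (mat ?a ** matrix_inv ?T) ** B + D"
    by (simp add: tilde_def transfer_def)
  also have "C ** (mat ?a ** matrix_inv ?T) ** B = mat ?a ** (C ** matrix_inv ?T ** B)"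
    by (metis matrix_mul_assoc mat_mult_commute)
  finally have "tilde \<tau> (transfer A B C D) q $ i $ j
      = ?a * (C ** matrix_inv ?T ** B) $ i $ j + D $ i $ j"
    by (simp add: mat_mult_nth)
  moreover have "(C ** matrix_inv ?T ** B) $ i $ j
      = (\<Sum>k\<in>UNIV. \<Sum>l\<in>UNIV. C $ i $ l * cofac ?T l k * B $ k $ j) / det ?T"
    by (simp add: matrix_matrix_mult_def matrix_inv_cramer[OF inv] sum_distrib_right
        sum_divide_distrib)
  ultimately show ?thesis
    by (simp add: tilde_num_def field_simps)
qed

lemma Re_complex_mult_of_real_left: "Re (of_real a * z) = a * Re z"
  by simp

text \<open>The real part of (q - 1) times the conjugate of q + 1 equals |q|^2 - 1.\<close>

lemma bilinear_rhp:
  assumes "0 < \<tau>" "1 < norm q"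
  shows "0 < Re (1 / (2 * of_real \<tau>) * ((q - 1) / (q + 1)))"
proof -
  have "q + 1 \<noteq> 0" using ext_disc_ne_minus_one[OF assms(2)] by (simp add: add_eq_0_iff2)
  then have n: "0 < (cmod (q + 1))\<^sup>2" by simp
  have "1 < (Re q)\<^sup>2 + (Im q)\<^sup>2"
    using assms(2) by (simp add: one_less_power flip: cmod_power2)
  then have "0 < Re ((q - 1) * cnj (q + 1))"
    by (simp add: algebra_simps power2_eq_square)
  then have "0 < Re ((q - 1) / (q + 1))"
    using n by (simp add: complex_div_cnj[of "q - 1" "q + 1"] del: complex_cnj_add)
  moreover have "1 / (2 * of_real \<tau>) * ((q - 1) / (q + 1))
      = of_real (1 / (2 * \<tau>)) * ((q - 1) / (q + 1))"
    by simp
  ultimately show ?thesis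
    using assms(1) by (simp only: Re_complex_mult_of_real_left) simp
qed

lemma tilde_Hinf:
  assumes "G \<in> Hinf_rhp" "0 < \<tau>"
  shows "tilde \<tau> G \<in> Hinf_ext"
proof -
  have G: "mat_holomorphic_on G rhp" "bounded (G ` rhp)"
    using assms(1) by (auto simp: Hinf_rhp_def)
  have nz: "q + 1 \<noteq> 0" if "1 < norm q" for q :: complex
    using ext_disc_ne_minus_one[OF that] by (simp add: add_eq_0_iff2)
  have "mat_holomorphic_on (\<lambda>q. G (1 / (2 * of_real \<tau>) * ((q - 1) / (q + 1)))) ext_disc"
    by (rule mat_holomorphic_compose[OF G(1)])
       (use nz bilinear_rhp assms(2) in \<open>auto intro!: holomorphic_intros\<close>)
  moreover have "(\<lambda>q. G (1 / (2 * of_real \<tau>) * ((q - 1) / (q + 1)))) ` ext_disc \<subseteq> G ` rhp"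
    using bilinear_rhp assms(2) by blast
  ultimately show ?thesis
    using bounded_subset[OF G(2)] by (simp add: Hinf_ext_def tilde_def[abs_def])
qed

lemma Hinf_ext_entry:
  assumes "G \<in> Hinf_ext"
  obtains B where "\<And>i j. (\<lambda>q. G q $ i $ j) holomorphic_on ext_disc"
    "\<And>i j q. 1 < norm q \<Longrightarrow> norm (G q $ i $ j) \<le> B"
proof -
  obtain B where "\<And>q. 1 < norm q \<Longrightarrow> norm (G q) \<le> B"
    using Hinf_ext_bound[OF assms] by blast
  then show thesis
    using assms
    by (intro that[of B])
       (auto simp: Hinf_ext_iff mat_holomorphic_on_def intro: norm_entry_le[THEN order_trans])
qed

lemma cont_ext_rational_matrix:
  assumes "G \<in> Hinf_ext"
    and "\<And>i j. \<exists>p d. d \<noteq> 0 \<and> (\<forall>q. 1 < norm q \<longrightarrow> poly d q \<noteq> 0 \<longrightarrow> G q $ i $ j * poly d q = poly p q)"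
  shows "cont_ext G"
proof (rule cont_ext_matrixI)
  fix i j
  obtain B where B: "\<And>i j. (\<lambda>q. G q $ i $ j) holomorphic_on ext_disc"
    "\<And>i j q. 1 < norm q \<Longrightarrow> norm (G q $ i $ j) \<le> B"
    using Hinf_ext_entry[OF assms(1)] by blast
  obtain p d where "d \<noteq> 0" "\<forall>q. 1 < norm q \<longrightarrow> poly d q \<noteq> 0 \<longrightarrow> G q $ i $ j * poly d q = poly p q"
    using assms(2) by blast
  then show "cont_ext (\<lambda>q. G q $ i $ j)"
    using bounded_rational_cont_ext[OF B] by blast
qed

lemma cont_ext_rational_ext:
  assumes "G \<in> Hinf_ext" "rational_ext G"
  shows "cont_ext G"
proof (rule cont_ext_rational_matrix[OF assms(1)])
  fix i j
  obtain p d where pd: "\<forall>q\<in>ext_disc. poly d q \<noteq> 0 \<and> G q $ i $ j = poly p q / poly d q"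
    using assms(2) unfolding rational_ext_def by blast
  have "d \<noteq> 0" using pd[rule_format, of 2] by auto
  then show "\<exists>p d. d \<noteq> 0 \<and> (\<forall>q. 1 < norm q \<longrightarrow> poly d q \<noteq> 0 \<longrightarrow> G q $ i $ j * poly d q = poly p q)"
    using pd by (intro exI[of _ p] exI[of _ d]) auto
qed

lemma det_tilde_pencil_poly:
  obtains d where "d \<noteq> 0" "\<And>q. det (tilde_pencil \<tau> A q) = poly d q"
proof -
  obtain d where "\<And>q. det (tilde_pencil \<tau> A q) = poly d q"
    using poly_fun_det[OF poly_fun_tilde_pencil[of \<tau> A]] unfolding poly_fun_def by blast
  then show thesis
    using det_tilde_pencil_minus_one[of \<tau> A] by (intro that[of d]) auto
qed

lemma cont_ext_tilde:
  assumes "transfer A B C D \<in> Hinf_rhp" "0 < \<tau>"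
  shows "cont_ext (tilde \<tau> (transfer A B C D))"
proof (rule cont_ext_rational_matrix[OF tilde_Hinf[OF assms]])
  fix i j
  obtain d where d: "d \<noteq> 0" "\<And>q. det (tilde_pencil \<tau> A q) = poly d q"
    using det_tilde_pencil_poly by blast
  have "poly_fun (\<lambda>q. (q + 1) * tilde_num \<tau> A B C i j q + D $ i $ j * det (tilde_pencil \<tau> A q))"
    by (intro poly_fun_intros poly_fun_tilde_num poly_fun_det poly_fun_tilde_pencil)
  then obtain p where p:
    "\<And>q. (q + 1) * tilde_num \<tau> A B C i j q + D $ i $ j * det (tilde_pencil \<tau> A q) = poly p q"
    unfolding poly_fun_def by blast
  have "tilde \<tau> (transfer A B C D) q $ i $ j * poly d q = poly p q"
    if "1 < norm q" "poly d q \<noteq> 0" for q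
  proof -
    have "tilde \<tau> (transfer A B C D) q $ i $ j = (q + 1) * tilde_num \<tau> A B C i j q / poly d q + D $ i $ j"
      using tilde_transfer_nth[OF assms(2) ext_disc_ne_minus_one[OF that(1)], of A B C D i j]
        that(2) d(2) by simp
    then show ?thesis
      using that(2) by (simp add: p[symmetric] d(2) field_simps)
  qed
  then show "\<exists>p d. d \<noteq> 0 \<and> (\<forall>q. 1 < norm q \<longrightarrow> poly d q \<noteq> 0 \<longrightarrow>
      tilde \<tau> (transfer A B C D) q $ i $ j * poly d q = poly p q)"
    using d(1) by blast
qed

lemma tilde_num_det_continuous:
  "isCont (\<lambda>q. tilde_num \<tau> A B C i j q / det (tilde_pencil \<tau> A q)) (- 1)"
  "isCont (\<lambda>q. det (tilde_pencil \<tau> A q)) (- 1)"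
proof -
  have 1: "isCont (tilde_num \<tau> A B C i j) (- 1)"
    using poly_fun_continuous[OF poly_fun_tilde_num[of \<tau> A B C i j], of UNIV]
    by (simp add: continuous_on_eq_continuous_at)
  show 2: "isCont (\<lambda>q. det (tilde_pencil \<tau> A q)) (- 1)"
    using poly_fun_continuous[OF poly_fun_det[OF poly_fun_tilde_pencil[of \<tau> A]], of UNIV]
    by (simp add: continuous_on_eq_continuous_at)
  show "isCont (\<lambda>q. tilde_num \<tau> A B C i j q / det (tilde_pencil \<tau> A q)) (- 1)"
    using det_tilde_pencil_minus_one by (intro isCont_divide 1 2)
qed

lemma det_tilde_pencil_near: "eventually (\<lambda>q. det (tilde_pencil \<tau> A q) \<noteq> 0) (at (- 1))"
  using tilde_num_det_continuous(2) det_tilde_pencil_minus_one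
  by (metis isCont_def tendsto_imp_eventually_ne)

text \<open>The point q = -1 is s = infinity, where only the feedthrough term remains.\<close>

lemma tilde_transfer_limit:
  assumes "0 < \<tau>"
  shows "(tilde \<tau> (transfer A B C D) \<longlongrightarrow> D) (at (- 1))"
proof (intro vec_tendstoI)
  fix i j
  let ?f = "\<lambda>q. (q + 1) * (tilde_num \<tau> A B C i j q / det (tilde_pencil \<tau> A q)) + D $ i $ j"
  have "isCont ?f (- 1)"
    by (intro continuous_intros tilde_num_det_continuous)
  then have "(?f \<longlongrightarrow> D $ i $ j) (at (- 1))" by (simp add: isCont_def)
  moreover have "eventually (\<lambda>q. q \<noteq> - (1::complex)) (at (- 1))"
    by (simp add: eventually_at_filter)
  then have "eventually (\<lambda>q. ?f q = tilde \<tau> (transfer A B C D) q $ i $ j) (at (- 1))"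
    using det_tilde_pencil_near[of \<tau> A]
    by eventually_elim (simp add: tilde_transfer_nth[OF assms])
  ultimately show "((\<lambda>q. tilde \<tau> (transfer A B C D) q $ i $ j) \<longlongrightarrow> D $ i $ j) (at (- 1))"
    by (rule Lim_transform_eventually)
qed

text \<open>The filter has a pole at q = -1, on the boundary of the domain. A strictly proper
  transfer function carries the factor q + 1, which cancels this pole.\<close>

lemma filtered_tilde:
  assumes G: "transfer A B C 0 \<in> Hinf_rhp" and \<tau>: "0 < \<tau>"
  defines "H \<equiv> \<lambda>q. mat (1 / (1 + q)) ** tilde \<tau> (transfer A B C 0) q"
  shows "H \<in> Hinf_ext" "cont_ext H"
proof -
  let ?t = "tilde \<tau> (transfer A B C 0)"
  obtain K where K: "0 < K" "\<And>q. 1 < norm q \<Longrightarrow> norm (?t q) \<le> K"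
    using Hinf_ext_bound[OF tilde_Hinf[OF G \<tau>]] by blast
  have nz: "1 + q \<noteq> 0" if "1 < norm q" for q :: complex
    using ext_disc_ne_minus_one[OF that] by (simp add: add_eq_0_iff)
  have hol: "mat_holomorphic_on H ext_disc"
    unfolding H_def
    by (intro mat_holomorphic_mult mat_holomorphic_mat holomorphic_intros)
       (use nz tilde_Hinf[OF G \<tau>] in \<open>auto simp: Hinf_ext_iff\<close>)
  have entry: "H q $ i $ j = tilde_num \<tau> A B C i j q / det (tilde_pencil \<tau> A q)"
    if "1 < norm q" "det (tilde_pencil \<tau> A q) \<noteq> 0" for q i j
    using nz[OF that(1)] that
    by (simp add: H_def mat_mult_nth tilde_transfer_nth[OF \<tau> ext_disc_ne_minus_one] add.commute)
  have bnd: "\<exists>M. \<forall>q. 1 < norm q \<longrightarrow> cmod (H q $ i $ j) \<le> M" for i j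
  proof -
    let ?f = "\<lambda>q. tilde_num \<tau> A B C i j q / det (tilde_pencil \<tau> A q)"
    have "eventually (\<lambda>q. dist (?f q) (?f (- 1)) < 1) (at (- 1))"
      using tilde_num_det_continuous(1) unfolding isCont_def
      by (rule tendstoD) simp
    then have "eventually (\<lambda>q. dist (?f q) (?f (- 1)) < 1 \<and> det (tilde_pencil \<tau> A q) \<noteq> 0) (at (- 1))"
      by (rule eventually_conj[OF _ det_tilde_pencil_near])
    then obtain r where r: "0 < r" "\<And>q. q \<noteq> - 1 \<Longrightarrow> dist q (- 1) < r \<Longrightarrow>
        dist (?f q) (?f (- 1)) < 1 \<and> det (tilde_pencil \<tau> A q) \<noteq> 0"
      unfolding eventually_at by blast
    show ?thesis
    \<comment> \<open>Within distance \<open>r\<close> of -1 the cancelled quotient is within 1 of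
      its value at -1. Farther away, |1 + q| is at least \<open>r\<close> and the unfiltered bound
      \<open>K\<close> applies.\<close>
    proof (intro exI[of _ "max (cmod (?f (- 1)) + 1) (K / r)"] allI impI)
      fix q :: complex assume q: "1 < norm q"
      show "cmod (H q $ i $ j) \<le> max (cmod (?f (- 1)) + 1) (K / r)"
      proof (cases "dist q (- 1) < r")
        case True
        with r(2)[OF ext_disc_ne_minus_one[OF q]]
        have "cmod (?f q - ?f (- 1)) < 1" "H q $ i $ j = ?f q"
          using entry[OF q] by (auto simp: dist_norm)
        then have "cmod (H q $ i $ j) \<le> cmod (?f (- 1)) + 1"
          using norm_triangle_ineq2[of "?f q" "?f (- 1)"] by simp
        then show ?thesis by simp
      next
        case False
        then have "r \<le> cmod (1 + q)" by (simp add: dist_norm add.commute)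
        moreover have "cmod (?t q $ i $ j) \<le> K"
          using K(2)[OF q] norm_entry_le[of "?t q" i j] by simp
        ultimately have "cmod (?t q $ i $ j) / cmod (1 + q) \<le> K / r"
          using r(1) K(1) by (intro frac_le) auto
        then show ?thesis
          by (simp add: H_def mat_mult_nth norm_mult norm_divide)
      qed
    qed
  qed
  then obtain M where M: "\<And>i j q. 1 < norm q \<Longrightarrow> cmod (H q $ i $ j) \<le> M i j" by metis
  have "norm (H q) \<le> (\<Sum>i\<in>UNIV. \<Sum>j\<in>UNIV. M i j)" if "1 < norm q" for q
    using norm_matrix_le_sum[of "H q"] sum_mono[OF sum_mono[OF M[OF that]]] by (rule order_trans)
  then show H: "H \<in> Hinf_ext" using hol by (auto simp: Hinf_ext_iff)
  show "cont_ext H"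
  proof (rule cont_ext_rational_matrix[OF H])
    fix i j
    obtain d where d: "d \<noteq> 0" "\<And>q. det (tilde_pencil \<tau> A q) = poly d q"
      using det_tilde_pencil_poly by blast
    obtain p where p: "\<And>q. tilde_num \<tau> A B C i j q = poly p q"
      using poly_fun_tilde_num unfolding poly_fun_def by blast
    show "\<exists>p d. d \<noteq> 0 \<and> (\<forall>q. 1 < norm q \<longrightarrow> poly d q \<noteq> 0 \<longrightarrow> H q $ i $ j * poly d q = poly p q)"
      by (intro exI[of _ p] exI[of _ d]) (simp add: d entry p)
  qed
qed

section \<open>Parseval's identity on circles\<close>

lemma has_integral_cis:
  assumes "0 < m"
  shows "((\<lambda>\<Omega>. cis (real m * \<Omega>)) has_integral 0) {-pi..pi}"
proof -
  have "((\<lambda>\<Omega>. cis (real m * \<Omega>)) has_integral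
      cis (real m * pi) / (\<i> * of_nat m) - cis (real m * (- pi)) / (\<i> * of_nat m)) {-pi..pi}"
  proof (rule fundamental_theorem_of_calculus)
    fix x :: real
    have "((\<lambda>z. exp (\<i> * (of_nat m * z)) / (\<i> * of_nat m)) has_field_derivative
        exp (\<i> * (of_nat m * of_real x))) (at (of_real x))"
      using assms by (auto intro!: derivative_eq_intros simp: mult.commute[of _ \<i>])
    from has_vector_derivative_real_field[OF this]
    show "((\<lambda>\<Omega>. cis (real m * \<Omega>) / (\<i> * of_nat m)) has_vector_derivative cis (real m * x))
        (at x within {-pi..pi})"
      by (simp add: cis_conv_exp o_def)
  qed simp
  moreover have "cis (real m * pi) = cis (real m * (- pi))"
    by (simp add: complex_eq_iff)
  ultimately show ?thesis by simp
qed

text \<open>Induction on n: the product of the new term with the conjugates of the earlier ones has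
  only nonzero frequencies and integrates to zero.\<close>

lemma parseval_finite:
  fixes c :: "nat \<Rightarrow> complex"
  shows "((\<lambda>\<Omega>. (cmod (\<Sum>k<n. c k * cis (- \<Omega>) ^ k))\<^sup>2) has_integral
    2 * pi * (\<Sum>k<n. (cmod (c k))\<^sup>2)) {-pi..pi}"
proof (induction n)
  case 0
  show ?case by simp
next
  case (Suc n)
  let ?S = "\<lambda>\<Omega>. \<Sum>k<n. c k * cis (- \<Omega>) ^ k"
  have "((\<lambda>\<Omega>. \<Sum>k<n. (c k * cnj (c n)) * cis (real (n - k) * \<Omega>)) has_integral
      (\<Sum>k<n. (c k * cnj (c n)) * 0)) {-pi..pi}"
    by (intro has_integral_sum has_integral_mult_right has_integral_cis) auto
  moreover have "?S \<Omega> * cnj (c n * cis (- \<Omega>) ^ n)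
      = (\<Sum>k<n. (c k * cnj (c n)) * cis (real (n - k) * \<Omega>))" for \<Omega>
  proof -
    have "cis (- \<Omega>) ^ k * cnj (cis (- \<Omega>) ^ n) = cis (real (n - k) * \<Omega>)" if "k < n" for k
      using that by (simp add: Complex.DeMoivre cis_cnj cis_mult of_nat_diff algebra_simps)
    then have t: "(c k * cis (- \<Omega>) ^ k) * cnj (c n * cis (- \<Omega>) ^ n)
        = (c k * cnj (c n)) * cis (real (n - k) * \<Omega>)" if "k < n" for k
      using that by (simp only: complex_cnj_mult mult_ac)
    show ?thesis unfolding sum_distrib_right by (intro sum.cong refl t) simp
  qed
  ultimately have "((\<lambda>\<Omega>. ?S \<Omega> * cnj (c n * cis (- \<Omega>) ^ n)) has_integral 0) {-pi..pi}"
    by simp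
  from has_integral_linear[OF this bounded_linear_Re]
  have "((\<lambda>\<Omega>. 2 * Re (?S \<Omega> * cnj (c n * cis (- \<Omega>) ^ n))) has_integral 2 * 0) {-pi..pi}"
    by (intro has_integral_mult_right) (simp add: o_def)
  moreover have "((\<lambda>\<Omega>. (cmod (c n))\<^sup>2) has_integral (pi - (- pi)) * (cmod (c n))\<^sup>2) {-pi..pi}"
    using has_integral_const_real[of "(cmod (c n))\<^sup>2" "- pi" pi] by simp
  ultimately have E: "((\<lambda>\<Omega>. (cmod (?S \<Omega>))\<^sup>2 + (2 * Re (?S \<Omega> * cnj (c n * cis (- \<Omega>) ^ n)) + (cmod (c n))\<^sup>2))
      has_integral (2 * pi * (\<Sum>k<n. (cmod (c k))\<^sup>2) + (2 * 0 + (pi - (- pi)) * (cmod (c n))\<^sup>2))) {-pi..pi}"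
    by (intro has_integral_add Suc.IH)
  have P: "(cmod (\<Sum>k<Suc n. c k * cis (- \<Omega>) ^ k))\<^sup>2
      = (cmod (?S \<Omega>))\<^sup>2 + (2 * Re (?S \<Omega> * cnj (c n * cis (- \<Omega>) ^ n)) + (cmod (c n))\<^sup>2)" for \<Omega>
  proof -
    have *: "(cmod (x + y))\<^sup>2 = (cmod x)\<^sup>2 + (2 * Re (x * cnj y) + (cmod y)\<^sup>2)" for x y
      unfolding cmod_power2 by (simp add: power2_eq_square algebra_simps)
    show ?thesis
      by (simp only: sum.lessThan_Suc *) (simp add: norm_mult norm_power)
  qed
  have V: "2 * pi * (\<Sum>k<Suc n. (cmod (c k))\<^sup>2)
      = 2 * pi * (\<Sum>k<n. (cmod (c k))\<^sup>2) + (2 * 0 + (pi - (- pi)) * (cmod (c n))\<^sup>2)"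
    by (simp add: algebra_simps)
  show ?case unfolding P V by (rule E)
qed

lemma parseval_disc:
  fixes a :: "nat \<Rightarrow> complex"
  assumes g: "\<And>w. w \<in> ball 0 1 \<Longrightarrow> (\<lambda>k. a k * w ^ k) sums g w" and \<rho>: "0 \<le> \<rho>" "\<rho> < 1"
  shows "(\<lambda>k. (cmod (a k))\<^sup>2 * \<rho> ^ (2 * k)) sums
    (1 / (2 * pi) * integral {-pi..pi} (\<lambda>\<Omega>. (cmod (g (of_real \<rho> * cis (- \<Omega>))))\<^sup>2))"
proof -
  define c where "c k = a k * of_real \<rho> ^ k" for k
  have sumc: "summable (\<lambda>k. cmod (c k))"
  proof -
    have "summable (\<lambda>k. norm (a k * of_real \<rho> ^ k))"
    proof (rule powser_insidea)
      \<comment> \<open>Convergence at the intermediate radius (1 + \<rho>) / 2 < 1 gives absolute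
        convergence at \<rho>, hence the constant \<open>M\<close> that dominates all partial
        sums.\<close>
      show "summable (\<lambda>k. a k * (of_real ((1 + \<rho>) / 2)) ^ k)"
        using g[of "of_real ((1 + \<rho>) / 2)"] \<rho> by (intro sums_summable) (auto simp: dist_norm norm_divide simp flip: of_real_add)
      show "norm (complex_of_real \<rho>) < norm (complex_of_real ((1 + \<rho>) / 2))"
        using \<rho> by (simp only: norm_of_real) auto
    qed
    then show ?thesis by (simp add: c_def)
  qed
  let ?S = "\<lambda>n \<Omega>. \<Sum>k<n. c k * cis (- \<Omega>) ^ k"
  define M where "M = suminf (\<lambda>k. cmod (c k))"
  have bound: "cmod (?S n \<Omega>) \<le> M" for n \<Omega>
  proof -
    have "cmod (?S n \<Omega>) \<le> (\<Sum>k<n. cmod (c k))"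
      by (intro norm_sum[THEN order_trans]) (simp add: norm_mult norm_power)
    also have "\<dots> \<le> M" unfolding M_def by (intro sum_le_suminf sumc) auto
    finally show ?thesis .
  qed
  have conv: "(\<lambda>n. (cmod (?S n \<Omega>))\<^sup>2) \<longlonglongrightarrow> (cmod (g (of_real \<rho> * cis (- \<Omega>))))\<^sup>2" for \<Omega>
  proof -
    have "(\<lambda>k. a k * (of_real \<rho> * cis (- \<Omega>)) ^ k) sums g (of_real \<rho> * cis (- \<Omega>))"
      using \<rho> by (intro g) (simp add: norm_mult)
    then have "(\<lambda>k. c k * cis (- \<Omega>) ^ k) sums g (of_real \<rho> * cis (- \<Omega>))"
      by (simp add: c_def power_mult_distrib mult.assoc)
    then show ?thesis unfolding sums_def by (intro tendsto_intros)
  qed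
  have "(\<lambda>n. integral {-pi..pi} (\<lambda>\<Omega>. (cmod (?S n \<Omega>))\<^sup>2)) \<longlonglongrightarrow>
      integral {-pi..pi} (\<lambda>\<Omega>. (cmod (g (of_real \<rho> * cis (- \<Omega>))))\<^sup>2)"
  proof (rule dominated_convergence(2)[where h = "\<lambda>_. M\<^sup>2"])
    show "(\<lambda>\<Omega>. (cmod (?S n \<Omega>))\<^sup>2) integrable_on {-pi..pi}" for n
      using parseval_finite by blast
    show "norm ((cmod (?S n \<Omega>))\<^sup>2) \<le> M\<^sup>2" for n \<Omega>
      using power_mono[OF bound[of \<Omega> n] norm_ge_zero, of 2] by simp
  qed (use conv in auto)
  moreover have "integral {-pi..pi} (\<lambda>\<Omega>. (cmod (?S n \<Omega>))\<^sup>2) = 2 * pi * (\<Sum>k<n. (cmod (c k))\<^sup>2)" for n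
    using parseval_finite by (rule integral_unique)
  ultimately have "(\<lambda>n. 2 * pi * (\<Sum>k<n. (cmod (c k))\<^sup>2)) \<longlonglongrightarrow>
      integral {-pi..pi} (\<lambda>\<Omega>. (cmod (g (of_real \<rho> * cis (- \<Omega>))))\<^sup>2)"
    by simp
  from tendsto_mult[OF tendsto_const[of "1 / (2 * pi)"] this]
  have "(\<lambda>k. (cmod (c k))\<^sup>2) sums
      (1 / (2 * pi) * integral {-pi..pi} (\<lambda>\<Omega>. (cmod (g (of_real \<rho> * cis (- \<Omega>))))\<^sup>2))"
    unfolding sums_def by simp
  moreover have "(cmod (c k))\<^sup>2 = (cmod (a k))\<^sup>2 * \<rho> ^ (2 * k)" for k
    using \<rho> by (simp add: c_def norm_mult norm_power power_mult_distrib power_mult power_even_eq[symmetric] mult.commute flip: power_mult)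
  ultimately show ?thesis by simp
qed

section \<open>Circle means and Markov coefficients\<close>

definition circ :: "real \<Rightarrow> real \<Rightarrow> complex"
  where "circ b \<Omega> = exp (of_real b + \<i> * of_real \<Omega>)"

lemma circ_eq: "circ b \<Omega> = of_real (exp b) * cis \<Omega>"
  by (simp add: circ_def exp_add cis_conv_exp exp_of_real)

lemma norm_circ [simp]: "norm (circ b \<Omega>) = exp b"
  by (simp add: circ_eq norm_mult)

lemma inverse_circ: "inverse (circ b \<Omega>) = of_real (exp (- b)) * cis (- \<Omega>)"
  by (simp add: circ_eq exp_minus cis_inverse)

lemma continuous_on_circ [continuous_intros]: "continuous_on S (circ b)"
  unfolding circ_def by (intro continuous_intros)

lemma Re_trace_ctransp_mult: "Re (trace (A\<^sup>H ** A)) = (norm (A :: complex^'n^'m))\<^sup>2"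
proof -
  have "Re (trace (A\<^sup>H ** A)) = (\<Sum>j\<in>UNIV. \<Sum>i\<in>UNIV. (cmod (A $ i $ j))\<^sup>2)"
    by (simp add: trace_def matrix_matrix_mult_def ctransp_def cmod_power2 flip: power2_eq_square)
  then show ?thesis by (subst (asm) sum.swap) (simp add: norm_matrix_sq)
qed

lemma h2_mean_eq: "h2_mean G b = 1 / (2 * pi) * integral {-pi..pi} (\<lambda>\<Omega>. (norm (G (circ b \<Omega>)))\<^sup>2)"
  by (simp add: h2_mean_def Let_def Re_trace_ctransp_mult circ_def)

lemma Hinf_ext_continuous:
  assumes "G \<in> Hinf_ext" "0 < b"
  shows "continuous_on S (\<lambda>\<Omega>. G (circ b \<Omega>))"
proof -
  have "continuous_on S (\<lambda>\<Omega>. G (circ b \<Omega>) $ i $ j)" for i j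
  proof (rule continuous_on_compose2[where t = ext_disc and g = "\<lambda>q. G q $ i $ j"])
    show "continuous_on ext_disc (\<lambda>q. G q $ i $ j)"
      using assms(1) by (auto simp: Hinf_ext_iff mat_holomorphic_on_def intro: holomorphic_on_imp_continuous_on)
  qed (use assms in \<open>auto intro: continuous_on_circ\<close>)
  then have "continuous_on S (\<lambda>\<Omega>. \<chi> i j. G (circ b \<Omega>) $ i $ j)"
    by (intro continuous_on_vec_lambda)
  then show ?thesis by simp
qed

lemma h2_integrable:
  assumes "G \<in> Hinf_ext" "0 < b"
  shows "(\<lambda>\<Omega>. (norm (G (circ b \<Omega>)))\<^sup>2) integrable_on {-pi..pi}"
  by (intro integrable_continuous_real continuous_intros Hinf_ext_continuous assms)

lemma h2_mean_nonneg: "G \<in> Hinf_ext \<Longrightarrow> 0 < b \<Longrightarrow> 0 \<le> h2_mean G b"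
  unfolding h2_mean_eq by (intro mult_nonneg_nonneg integral_nonneg h2_integrable) auto

lemma h2_mean_mono:
  assumes "G \<in> Hinf_ext" "0 < b" "f integrable_on {-pi..pi}"
    and "\<And>\<Omega>. \<Omega> \<in> {-pi..pi} \<Longrightarrow> (norm (G (circ b \<Omega>)))\<^sup>2 \<le> f \<Omega>"
  shows "h2_mean G b \<le> 1 / (2 * pi) * integral {-pi..pi} f"
  unfolding h2_mean_eq by (intro mult_left_mono integral_le h2_integrable assms) auto

lemma h2_mean_bound:
  assumes "G \<in> Hinf_ext" "0 < b" "\<And>q. 1 < norm q \<Longrightarrow> norm (G q) \<le> B"
  shows "h2_mean G b \<le> B\<^sup>2"
proof -
  have "h2_mean G b \<le> 1 / (2 * pi) * integral {-pi..pi} (\<lambda>_. B\<^sup>2)"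
    using assms by (intro h2_mean_mono power_mono) (auto intro!: integrable_continuous_real)
  also have "\<dots> = B\<^sup>2" by simp
  finally show ?thesis .
qed

lemma h2_mean_dominated:
  assumes "G \<in> Hinf_ext" "H \<in> Hinf_ext" "0 < b" "\<And>q. 1 < norm q \<Longrightarrow> norm (G q) \<le> c * norm (H q)"
  shows "h2_mean G b \<le> c\<^sup>2 * h2_mean H b"
proof -
  have "h2_mean G b \<le> 1 / (2 * pi) * integral {-pi..pi} (\<lambda>\<Omega>. c\<^sup>2 * (norm (H (circ b \<Omega>)))\<^sup>2)"
  proof (rule h2_mean_mono[OF assms(1,3)])
    show "(\<lambda>\<Omega>. c\<^sup>2 * (norm (H (circ b \<Omega>)))\<^sup>2) integrable_on {-pi..pi}"
      using h2_integrable[OF assms(2,3)] by (rule integrable_on_mult_right)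
    show "(norm (G (circ b \<Omega>)))\<^sup>2 \<le> c\<^sup>2 * (norm (H (circ b \<Omega>)))\<^sup>2" for \<Omega>
      using power_mono[OF assms(4)[of "circ b \<Omega>"] norm_ge_zero, of 2] assms(3)
      by (simp add: power_mult_distrib)
  qed
  also have "\<dots> = c\<^sup>2 * h2_mean H b"
    unfolding h2_mean_eq by (subst integral_mult_right) (simp add: field_simps)
  finally show ?thesis .
qed

text \<open>\<open>a\<close> is the sequence of Markov coefficients of \<open>G\<close>, with
  convergence stated entrywise.\<close>

definition laurent_ext :: "(complex \<Rightarrow> complex^'n^'m) \<Rightarrow> (nat \<Rightarrow> complex^'n^'m) \<Rightarrow> bool"
  where "laurent_ext G a \<longleftrightarrow>
    (\<forall>i j q. 1 < norm q \<longrightarrow> (\<lambda>k. a k $ i $ j * inverse q ^ k) sums (G q $ i $ j))"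

lemma scalar_laurent:
  assumes "f holomorphic_on ext_disc" "\<And>q. 1 < norm q \<Longrightarrow> norm (f q) \<le> B"
  shows "\<exists>a g. (\<forall>w\<in>ball 0 1. (\<lambda>k. a k * w ^ k) sums g w) \<and>
    (\<forall>q. 1 < norm q \<longrightarrow> f q = g (inverse q))"
proof -
  obtain g where g: "g holomorphic_on ball 0 1" "\<And>w. w \<in> ball 0 1 \<Longrightarrow> norm (g w) \<le> B"
    "\<And>q. 1 < norm q \<Longrightarrow> f q = g (inverse q)"
    using bounded_ext_disc_function[OF assms] by blast
  have "(\<lambda>k. (deriv ^^ k) g 0 / fact k * w ^ k) sums g w" if "w \<in> ball 0 1" for w
    using holomorphic_power_series[OF g(1) that] by simp
  then show ?thesis using g(3)
    by (intro exI[of _ "\<lambda>k. (deriv ^^ k) g 0 / fact k"] exI[of _ g]) simp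
qed

lemma laurent_ext_exists:
  assumes "G \<in> Hinf_ext"
  shows "\<exists>a. laurent_ext G a"
proof -
  obtain B where B: "\<And>i j. (\<lambda>q. G q $ i $ j) holomorphic_on ext_disc"
    "\<And>i j q. 1 < norm q \<Longrightarrow> norm (G q $ i $ j) \<le> B"
    using Hinf_ext_entry[OF assms] by blast
  have "\<exists>a. \<forall>q. 1 < norm q \<longrightarrow> (\<lambda>k. a k * inverse q ^ k) sums (G q $ i $ j)" for i j
  proof -
    obtain a g where "\<And>w. w \<in> ball 0 1 \<Longrightarrow> (\<lambda>k. a k * w ^ k) sums g w"
      "\<And>q. 1 < norm q \<Longrightarrow> G q $ i $ j = g (inverse q)"
      using scalar_laurent[OF B(1)[of i j] B(2)[of _ i j]] by blast
    then show ?thesis using inverse_ext_disc(2) by (intro exI[of _ a]) simp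
  qed
  then have "\<forall>i j. \<exists>a. \<forall>q. 1 < norm q \<longrightarrow> (\<lambda>k. a k * inverse q ^ k) sums (G q $ i $ j)"
    by blast
  then obtain a where a: "\<forall>i j q. 1 < norm q \<longrightarrow> (\<lambda>k. a i j k * inverse q ^ k) sums (G q $ i $ j)"
    unfolding choice_iff by blast
  then show ?thesis
    unfolding laurent_ext_def by (intro exI[of _ "\<lambda>k. \<chi> i j. a i j k"]) (simp only: vec_lambda_beta)
qed

text \<open>The mean over the circle of radius exp b becomes a power series in exp (-2 b) with
  nonnegative coefficients. Monotonicity in b and the limit at b = 0 can be read off from
  it.\<close>

lemma parseval_ext:
  assumes G: "G \<in> Hinf_ext" and a: "laurent_ext G a" and b: "0 < b"
  shows "(\<lambda>k. (norm (a k))\<^sup>2 * exp (- b) ^ (2 * k)) sums h2_mean G b"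
proof -
  have 1: "(\<lambda>k. (cmod (a k $ i $ j))\<^sup>2 * exp (- b) ^ (2 * k)) sums
      (1 / (2 * pi) * integral {-pi..pi} (\<lambda>\<Omega>. (cmod (G (circ b \<Omega>) $ i $ j))\<^sup>2))" for i j
  proof -
    define g where "g w = (\<Sum>k. a k $ i $ j * w ^ k)" for w
    have conv: "(\<lambda>k. a k $ i $ j * w ^ k) sums g w" if w: "w \<in> ball 0 1" for w
    proof (cases "w = 0")
      \<comment> \<open>w = 0 corresponds to q = infinity, about which \<open>laurent_ext\<close>
        says nothing; the series has only its constant term there.\<close>
      case True
      have "summable (\<lambda>k. a k $ i $ j * w ^ k)"
        unfolding True by (intro summable_finite[of "{0}"]) auto
      then show ?thesis unfolding g_def by (rule summable_sums)
    next
      case False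
      then have "(\<lambda>k. a k $ i $ j * inverse (inverse w) ^ k) sums (G (inverse w) $ i $ j)"
        using a inverse_punctured_disc[OF w] unfolding laurent_ext_def by blast
      then show ?thesis
        unfolding g_def by (intro summable_sums) (simp add: sums_iff)
    qed
    have "g (of_real (exp (- b)) * cis (- \<Omega>)) = G (circ b \<Omega>) $ i $ j" for \<Omega>
    proof -
      have "(\<lambda>k. a k $ i $ j * inverse (circ b \<Omega>) ^ k) sums (G (circ b \<Omega>) $ i $ j)"
        using a b unfolding laurent_ext_def by simp
      then show ?thesis unfolding g_def inverse_circ by (rule sums_unique[symmetric])
    qed
    then show ?thesis
      using parseval_disc[OF conv, of "exp (- b)"] b by simp
  qed
  have "(\<lambda>k. \<Sum>i\<in>UNIV. \<Sum>j\<in>UNIV. (cmod (a k $ i $ j))\<^sup>2 * exp (- b) ^ (2 * k)) sums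
      (\<Sum>i\<in>UNIV. \<Sum>j\<in>UNIV. 1 / (2 * pi) * integral {-pi..pi} (\<lambda>\<Omega>. (cmod (G (circ b \<Omega>) $ i $ j))\<^sup>2))"
    by (intro sums_sum 1)
  moreover have "(\<Sum>i\<in>UNIV. \<Sum>j\<in>UNIV. 1 / (2 * pi) * integral {-pi..pi} (\<lambda>\<Omega>. (cmod (G (circ b \<Omega>) $ i $ j))\<^sup>2))
      = h2_mean G b"
  proof -
    have int: "(\<lambda>\<Omega>. (cmod (G (circ b \<Omega>) $ i $ j))\<^sup>2) integrable_on {-pi..pi}" for i j
      by (intro integrable_continuous_real continuous_intros Hinf_ext_continuous G b)
    show ?thesis
      unfolding h2_mean_eq norm_matrix_sq
      by (simp add: integral_sum int integrable_sum sum_distrib_left)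
  qed
  ultimately show ?thesis by (simp add: norm_matrix_sq sum_distrib_right)
qed

section \<open>The Hardy norm of bounded functions\<close>

lemma h2_mean_antimono:
  assumes "G \<in> Hinf_ext" "0 < b" "b \<le> b'"
  shows "h2_mean G b' \<le> h2_mean G b"
proof -
  obtain a where a: "laurent_ext G a" using laurent_ext_exists[OF assms(1)] by blast
  show ?thesis
    by (rule sums_le[OF _ parseval_ext[OF assms(1) a] parseval_ext[OF assms(1) a]])
       (use assms in \<open>auto intro!: mult_left_mono power_mono\<close>)
qed

lemma h2_mean_bdd:
  assumes "G \<in> Hinf_ext"
  shows "bdd_above (h2_mean G ` {0<..})"
proof -
  obtain B where "0 < B" "\<And>q. 1 < norm q \<Longrightarrow> norm (G q) \<le> B"
    using Hinf_ext_bound[OF assms] by blast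
  then show ?thesis
    using h2_mean_bound[OF assms] by (intro bdd_aboveI2[of _ _ "B\<^sup>2"]) auto
qed

lemma h2_norm_sq:
  assumes "G \<in> Hinf_ext"
  shows "(h2_norm G)\<^sup>2 = (SUP b\<in>{0<..}. h2_mean G b)"
proof -
  have "0 \<le> h2_mean G 1" by (rule h2_mean_nonneg[OF assms]) simp
  also have "\<dots> \<le> (SUP b\<in>{0<..}. h2_mean G b)"
    by (intro cSUP_upper h2_mean_bdd assms) simp
  finally show ?thesis by (simp add: h2_norm_def)
qed

lemma h2_mean_le_norm: "G \<in> Hinf_ext \<Longrightarrow> 0 < b \<Longrightarrow> h2_mean G b \<le> (h2_norm G)\<^sup>2"
  unfolding h2_norm_sq by (intro cSUP_upper h2_mean_bdd) auto

lemma h2_norm_sq_le: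
  assumes "G \<in> Hinf_ext" "\<And>b. 0 < b \<Longrightarrow> h2_mean G b \<le> C"
  shows "(h2_norm G)\<^sup>2 \<le> C"
  unfolding h2_norm_sq[OF assms(1)] by (rule cSUP_least) (use assms(2) in auto)

text \<open>The means decrease in b, so the supremum is the limit as b tends to 0 from the right. A
  limit, unlike a supremum, preserves sums and identities.\<close>

lemma h2_mean_tendsto:
  assumes "G \<in> Hinf_ext"
  shows "(h2_mean G \<longlongrightarrow> (h2_norm G)\<^sup>2) (at_right 0)"
proof (rule order_tendstoI)
  fix y assume "y < (h2_norm G)\<^sup>2"
  then obtain b where b: "0 < b" "y < h2_mean G b"
    unfolding h2_norm_sq[OF assms] by (auto simp: less_cSUP_iff[OF _ h2_mean_bdd[OF assms]])
  have "\<forall>c>0. c < b \<longrightarrow> y < h2_mean G c"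
    using h2_mean_antimono[OF assms] b(2) by (metis less_le_trans less_imp_le)
  then show "eventually (\<lambda>c. y < h2_mean G c) (at_right 0)"
    unfolding eventually_at_right_field using b(1) by blast
next
  fix y assume "(h2_norm G)\<^sup>2 < y"
  then show "eventually (\<lambda>c. h2_mean G c < y) (at_right 0)"
    unfolding eventually_at_right_field
    using h2_mean_le_norm[OF assms] by (meson le_less_trans zero_less_one)
qed

lemma h2_norm_sq_bound:
  assumes "G \<in> Hinf_ext" "\<And>q. 1 < norm q \<Longrightarrow> norm (G q) \<le> B"
  shows "(h2_norm G)\<^sup>2 \<le> B\<^sup>2"
  using h2_mean_bound[OF assms(1) _ assms(2)] by (intro h2_norm_sq_le assms(1))

lemma h2_norm_sq_dominated:
  assumes "G \<in> Hinf_ext" "H \<in> Hinf_ext" "\<And>q. 1 < norm q \<Longrightarrow> norm (G q) \<le> c * norm (H q)"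
  shows "(h2_norm G)\<^sup>2 \<le> c\<^sup>2 * (h2_norm H)\<^sup>2"
proof (rule h2_norm_sq_le[OF assms(1)])
  fix b :: real assume "0 < b"
  then show "h2_mean G b \<le> c\<^sup>2 * (h2_norm H)\<^sup>2"
    using h2_mean_dominated[OF assms(1,2) _ assms(3)]
      mult_left_mono[OF h2_mean_le_norm[OF assms(2)], of b "c\<^sup>2"] by fastforce
qed

text \<open>The identity holds pointwise for the Frobenius norm, hence for the circle means, and
  passes to the limit b to 0.\<close>

lemma h2_norm_parallelogram:
  fixes G H :: "complex \<Rightarrow> complex^'n^'m"
  assumes G: "G \<in> Hinf_ext" and H: "H \<in> Hinf_ext"
  shows "(h2_norm (\<lambda>q. G q + H q))\<^sup>2 + (h2_norm (\<lambda>q. G q - H q))\<^sup>2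
    = 2 * (h2_norm G)\<^sup>2 + 2 * (h2_norm H)\<^sup>2"
proof -
  note add = Hinf_ext_add[OF G H] and diff = Hinf_ext_diff[OF G H]
  have "((\<lambda>b. h2_mean (\<lambda>q. G q + H q) b + h2_mean (\<lambda>q. G q - H q) b) \<longlongrightarrow>
      (h2_norm (\<lambda>q. G q + H q))\<^sup>2 + (h2_norm (\<lambda>q. G q - H q))\<^sup>2) (at_right 0)"
    by (intro tendsto_intros h2_mean_tendsto add diff)
  moreover have "((\<lambda>b. 2 * h2_mean G b + 2 * h2_mean H b) \<longlongrightarrow>
      2 * (h2_norm G)\<^sup>2 + 2 * (h2_norm H)\<^sup>2) (at_right 0)"
    by (intro tendsto_intros h2_mean_tendsto G H)
  moreover have "h2_mean (\<lambda>q. G q + H q) b + h2_mean (\<lambda>q. G q - H q) b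
      = 2 * h2_mean G b + 2 * h2_mean H b" if "0 < b" for b
  proof -
    note int = h2_integrable[OF add that] h2_integrable[OF diff that]
      h2_integrable[OF G that] h2_integrable[OF H that]
    let ?I = "\<lambda>G :: complex \<Rightarrow> complex^'n^'m. integral {-pi..pi} (\<lambda>\<Omega>. (norm (G (circ b \<Omega>)))\<^sup>2)"
    have par: "(norm (x + y))\<^sup>2 + (norm (x - y))\<^sup>2 = 2 * (norm x)\<^sup>2 + 2 * (norm y)\<^sup>2"
      for x y :: "complex^'n^'m"
      by (simp add: power2_norm_eq_inner inner_add inner_diff)
    have "?I (\<lambda>q. G q + H q)
        + ?I (\<lambda>q. G q - H q)
        = integral {-pi..pi} (\<lambda>\<Omega>. 2 * (norm (G (circ b \<Omega>)))\<^sup>2 + 2 * (norm (H (circ b \<Omega>)))\<^sup>2)"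
      by (simp only: integral_add[OF int(1,2), symmetric] par)
    also have "\<dots> = 2 * ?I G
        + 2 * ?I H"
      by (subst integral_add) (auto intro: int integrable_on_mult_right)
    finally have "?I (\<lambda>q. G q + H q)
        + ?I (\<lambda>q. G q - H q)
        = 2 * ?I G
        + 2 * ?I H" .
    from arg_cong[OF this, of "\<lambda>x. 1 / (2 * pi) * x"] show ?thesis
      unfolding h2_mean_eq by (simp only: distrib_left mult.left_commute[of "1 / (2 * pi)" 2])
  qed
  then have "eventually (\<lambda>b. 2 * h2_mean G b + 2 * h2_mean H b
      = h2_mean (\<lambda>q. G q + H q) b + h2_mean (\<lambda>q. G q - H q) b) (at_right 0)"
    unfolding eventually_at_right_field by (intro exI[of _ 1]) auto
  ultimately show ?thesis
    by (intro tendsto_unique[OF trivial_limit_at_right_real])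
       (blast intro: Lim_transform_eventually)+
qed

text \<open>Young's inequality stands in for the triangle inequality of the Hardy norm.\<close>
lemma h2_norm_sq_add:
  fixes G H :: "complex \<Rightarrow> complex^'n^'m"
  assumes G: "G \<in> Hinf_ext" and H: "H \<in> Hinf_ext" and t: "0 < t"
  shows "(h2_norm (\<lambda>q. G q + H q))\<^sup>2 \<le> (1 + t) * (h2_norm G)\<^sup>2 + (1 + 1 / t) * (h2_norm H)\<^sup>2"
proof (rule h2_norm_sq_le[OF Hinf_ext_add[OF G H]])
  fix b :: real assume b: "0 < b"
  note int = h2_integrable[OF G b] h2_integrable[OF H b]
  let ?I = "\<lambda>G :: complex \<Rightarrow> complex^'n^'m. integral {-pi..pi} (\<lambda>\<Omega>. (norm (G (circ b \<Omega>)))\<^sup>2)"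
  have young: "(norm (x + y))\<^sup>2 \<le> (1 + t) * (norm x)\<^sup>2 + (1 + 1 / t) * (norm y)\<^sup>2"
    for x y :: "complex^'n^'m"
  proof -
    have "0 \<le> (t * norm x - norm y)\<^sup>2 / t" using t by simp
    also have "\<dots> = t * (norm x)\<^sup>2 + (norm y)\<^sup>2 / t - 2 * norm x * norm y"
      using t by (simp add: power2_eq_square field_simps)
    finally have "2 * norm x * norm y \<le> t * (norm x)\<^sup>2 + (norm y)\<^sup>2 / t" by simp
    moreover have "(norm (x + y))\<^sup>2 \<le> (norm x + norm y)\<^sup>2"
      by (intro power_mono norm_triangle_ineq) simp
    ultimately show ?thesis by (simp add: power2_sum algebra_simps)
  qed
  have "h2_mean (\<lambda>q. G q + H q) b \<le> 1 / (2 * pi) * integral {-pi..pi}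
      (\<lambda>\<Omega>. (1 + t) * (norm (G (circ b \<Omega>)))\<^sup>2 + (1 + 1 / t) * (norm (H (circ b \<Omega>)))\<^sup>2)"
    by (intro h2_mean_mono Hinf_ext_add G H b young integrable_add integrable_on_mult_right int)
  also have "integral {-pi..pi}
      (\<lambda>\<Omega>. (1 + t) * (norm (G (circ b \<Omega>)))\<^sup>2 + (1 + 1 / t) * (norm (H (circ b \<Omega>)))\<^sup>2)
    = (1 + t) * ?I G
      + (1 + 1 / t) * ?I H"
    by (subst integral_add) (simp_all only: integral_mult_right integrable_on_mult_right int)
  also have "1 / (2 * pi) * \<dots> = (1 + t) * h2_mean G b + (1 + 1 / t) * h2_mean H b"
    unfolding h2_mean_eq by (simp only: distrib_left[of "1 / (2 * pi)"] mult.left_commute[of "1 / (2 * pi)"])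
  also have "\<dots> \<le> (1 + t) * (h2_norm G)\<^sup>2 + (1 + 1 / t) * (h2_norm H)\<^sup>2"
    using t by (intro add_mono mult_left_mono h2_mean_le_norm G H b) auto
  finally show "h2_mean (\<lambda>q. G q + H q) b \<le> (1 + t) * (h2_norm G)\<^sup>2 + (1 + 1 / t) * (h2_norm H)\<^sup>2" .
qed

lemma h2_norm_sq_perturbation:
  assumes "G \<in> Hinf_ext" "0 < e"
  shows "\<exists>d>0. \<forall>H\<in>Hinf_ext. (h2_norm H)\<^sup>2 \<le> d \<longrightarrow> (h2_norm (\<lambda>q. G q + H q))\<^sup>2 \<le> (h2_norm G)\<^sup>2 + e"
proof -
  \<comment> \<open>With this weight the factor 1 + t costs at most e / 2; adding 1 in the
    denominator covers the case of norm zero. The other half of e is left for (1 + 1/t) times the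
    squared norm of \<open>H\<close>.\<close>
  define t where "t = e / (2 * ((h2_norm G)\<^sup>2 + 1))"
  have N: "0 < (h2_norm G)\<^sup>2 + 1" by (metis add_nonneg_pos zero_le_power2 zero_less_one)
  then have t: "0 < t" using assms(2) by (simp add: t_def)
  have tN: "t * (h2_norm G)\<^sup>2 \<le> e / 2"
  proof -
    have "t * (h2_norm G)\<^sup>2 \<le> t * ((h2_norm G)\<^sup>2 + 1)" using t by simp
    also have "\<dots> = e / 2" using N unfolding t_def by (metis less_irrefl mult.commute nonzero_eq_divide_eq times_divide_eq_right divide_divide_eq_left)
    finally show ?thesis .
  qed
  define c where "c = 1 + 1 / t"
  have c: "0 < c" using t by (simp add: c_def add_pos_pos)
  show ?thesis
  proof (intro exI[of _ "e / 2 / c"] conjI ballI impI)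
    show "0 < e / 2 / c" using c assms(2) by simp
    fix H :: "complex \<Rightarrow> complex^'a^'b" assume H: "H \<in> Hinf_ext" "(h2_norm H)\<^sup>2 \<le> e / 2 / c"
    have "c * (h2_norm H)\<^sup>2 \<le> e / 2"
      using H(2) c by (simp add: pos_le_divide_eq mult.commute)
    then show "(h2_norm (\<lambda>q. G q + H q))\<^sup>2 \<le> (h2_norm G)\<^sup>2 + e"
      using h2_norm_sq_add[OF assms(1) H(1) t, folded c_def] tN
      unfolding distrib_right[of 1 t] mult_1 by linarith
  qed
qed

lemma laurent_coeff_bound:
  assumes G: "G \<in> Hinf_ext" "laurent_ext G a" and B: "\<And>q. 1 < norm q \<Longrightarrow> norm (G q) \<le> B"
  shows "(\<Sum>k<n. (norm (a k))\<^sup>2) \<le> B\<^sup>2"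
proof -
  have "((\<lambda>b. \<Sum>k<n. (norm (a k))\<^sup>2 * exp (- b) ^ (2 * k)) \<longlongrightarrow>
      (\<Sum>k<n. (norm (a k))\<^sup>2 * exp (- 0) ^ (2 * k))) (at_right (0::real))"
    by (intro tendsto_intros)
  moreover have "eventually (\<lambda>b. (\<Sum>k<n. (norm (a k))\<^sup>2 * exp (- b) ^ (2 * k)) \<le> B\<^sup>2) (at_right (0::real))"
    unfolding eventually_at_right_field
  proof (intro exI[of _ 1] conjI allI impI)
    fix b :: real assume b: "0 < b"
    note P = parseval_ext[OF G b]
    have "(\<Sum>k<n. (norm (a k))\<^sup>2 * exp (- b) ^ (2 * k)) \<le> (\<Sum>k. (norm (a k))\<^sup>2 * exp (- b) ^ (2 * k))"
      by (intro sum_le_suminf sums_summable[OF P]) auto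
    also have "\<dots> = h2_mean G b" using P by (rule sums_unique[symmetric])
    also have "\<dots> \<le> B\<^sup>2" by (rule h2_mean_bound[OF G(1) b B])
    finally show "(\<Sum>k<n. (norm (a k))\<^sup>2 * exp (- b) ^ (2 * k)) \<le> B\<^sup>2" .
  qed simp
  ultimately show ?thesis
    by (intro tendsto_upperbound[of "\<lambda>b. \<Sum>k<n. (norm (a k))\<^sup>2 * exp (- b) ^ (2 * k)" _ "at_right 0"]) auto
qed

lemma laurent_coeff_summable:
  assumes G: "G \<in> Hinf_ext" "laurent_ext G a"
  shows "summable (\<lambda>k. (norm (a k))\<^sup>2)"
proof -
  obtain B where B: "\<And>q. 1 < norm q \<Longrightarrow> norm (G q) \<le> B"
    using Hinf_ext_bound[OF G(1)] by blast
  show ?thesis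
    by (rule summableI_nonneg_bounded[where x = "B\<^sup>2"]) (use laurent_coeff_bound[OF G B] in auto)
qed

lemma norm_scaled_ext_disc: "1 \<le> r \<Longrightarrow> 1 < norm q \<Longrightarrow> 1 < norm (of_real r * q :: complex)"
  using mult_mono[of 1 r "norm q" "norm q"] by (simp add: norm_mult)

text \<open>Dilation multiplies the k-th coefficient by r^(-k), so the difference has coefficients
  of norm at most that of a_k. The tail beyond some N is therefore small uniformly in r, while the
  finitely many leading terms vanish as r tends to 1.\<close>

lemma dilation_h2_tendsto:
  assumes G: "G \<in> Hinf_ext" and e: "0 < e"
  shows "\<exists>\<rho>>1. \<forall>r. 1 < r \<longrightarrow> r < \<rho> \<longrightarrow> (h2_norm (\<lambda>q. G (of_real r * q) - G q))\<^sup>2 \<le> e"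
proof -
  obtain a where a: "laurent_ext G a" using laurent_ext_exists[OF G] by blast
  note sm = laurent_coeff_summable[OF G a]
  obtain N where N: "(\<Sum>k. (norm (a (k + N)))\<^sup>2) < e / 2"
  proof -
    obtain M where M: "\<forall>n\<ge>M. norm (\<Sum>k. (norm (a (k + n)))\<^sup>2) < e / 2"
      using suminf_exist_split[OF half_gt_zero[OF e] sm] by blast
    show thesis
      by (rule that[of M]) (use M[rule_format, OF order_refl] in \<open>simp add: abs_less_iff\<close>)
  qed
  let ?s = "\<lambda>r. \<Sum>k<N. (norm (a k))\<^sup>2 * (1 - inverse r ^ k)\<^sup>2"
  have "((\<lambda>r. ?s r) \<longlongrightarrow> ?s 1) (at_right (1::real))"
    by (intro tendsto_intros) auto
  then have "eventually (\<lambda>r. ?s r < e / 2) (at_right 1)"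
    using e by (intro order_tendstoD(2)[where y = 0]) auto
  then obtain \<rho> where \<rho>: "1 < \<rho>" "\<And>r. 1 < r \<Longrightarrow> r < \<rho> \<Longrightarrow> ?s r < e / 2"
    unfolding eventually_at_right_field by blast
  show ?thesis
  proof (intro exI[of _ \<rho>] conjI allI impI \<rho>(1))
    fix r :: real assume r: "1 < r" "r < \<rho>"
    let ?D = "\<lambda>q. G (of_real r * q) - G q"
    have D: "?D \<in> Hinf_ext"
      using r by (intro Hinf_ext_diff Hinf_ext_dilation G) auto
    let ?c = "\<lambda>k. (inverse r ^ k - 1) *\<^sub>R a k"
    have c: "laurent_ext ?D ?c"
      unfolding laurent_ext_def
    proof (intro allI impI)
      fix i j q assume q: "1 < norm (q::complex)"
      have "1 < norm (of_real r * q)" using norm_scaled_ext_disc[OF _ q] r by simp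
      then have "(\<lambda>k. a k $ i $ j * inverse (of_real r * q) ^ k - a k $ i $ j * inverse q ^ k)
          sums (G (of_real r * q) $ i $ j - G q $ i $ j)"
        using a q unfolding laurent_ext_def by (intro sums_diff) blast+
      moreover have "a k $ i $ j * inverse (of_real r * q) ^ k - a k $ i $ j * inverse q ^ k
          = ?c k $ i $ j * inverse q ^ k" for k
        unfolding vector_scaleR_component by (simp add: scaleR_conv_of_real power_mult_distrib algebra_simps)
      ultimately show "(\<lambda>k. ?c k $ i $ j * inverse q ^ k) sums (?D q $ i $ j)" by simp
    qed
    have ir: "0 \<le> inverse r ^ k" "inverse r ^ k \<le> 1" for k
      using r by (auto intro: power_le_one simp: inverse_le_1_iff)
    have sq: "(1 - inverse r ^ k)\<^sup>2 \<le> 1" for k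
      using ir[of k] by (intro power_le_one) auto
    have nc: "(norm (?c k))\<^sup>2 = (norm (a k))\<^sup>2 * (1 - inverse r ^ k)\<^sup>2" for k
      by (simp add: power_mult_distrib power2_commute)
    have le: "(norm (?c k))\<^sup>2 \<le> (norm (a k))\<^sup>2" for k
      unfolding nc using mult_left_mono[OF sq[of k] zero_le_power2[of "norm (a k)"]] by simp
    have smc: "summable (\<lambda>k. (norm (?c k))\<^sup>2)"
      by (rule summable_comparison_test'[OF sm, of 0]) (use le in simp)
    have "(\<Sum>k. (norm (?c k))\<^sup>2) = (\<Sum>k. (norm (?c (k + N)))\<^sup>2) + (\<Sum>k<N. (norm (?c k))\<^sup>2)"
      by (rule suminf_split_initial_segment[OF smc])
    also have "(\<Sum>k. (norm (?c (k + N)))\<^sup>2) \<le> (\<Sum>k. (norm (a (k + N)))\<^sup>2)"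
      by (intro suminf_le le summable_ignore_initial_segment[OF smc] summable_ignore_initial_segment[OF sm])
    also have "(\<Sum>k<N. (norm (?c k))\<^sup>2) = ?s r" by (simp only: nc)
    finally have tot: "(\<Sum>k. (norm (?c k))\<^sup>2) \<le> e"
      using N \<rho>(2)[OF r] by linarith
    show "(h2_norm ?D)\<^sup>2 \<le> e"
    proof (rule h2_norm_sq_le[OF D])
      fix b :: real assume b: "0 < b"
      have "h2_mean ?D b \<le> (\<Sum>k. (norm (?c k))\<^sup>2)"
      proof (rule sums_le[OF _ parseval_ext[OF D c b] summable_sums[OF smc]])
        fix k
        have "exp (- b) ^ (2 * k) \<le> 1" using b by (intro power_le_one) auto
        then show "(norm (?c k))\<^sup>2 * exp (- b) ^ (2 * k) \<le> (norm (?c k))\<^sup>2"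
          using mult_left_mono[OF _ zero_le_power2[of "norm (?c k)"]] by fastforce
      qed
      then show "h2_mean ?D b \<le> e" using tot by simp
    qed
  qed
qed

text \<open>The coefficients of \<open>G\<close> are bounded by a bound B of \<open>G\<close>, so
  those of the dilated function are dominated by B r^(-k). The geometric tail bounds the truncation
  error uniformly in q.\<close>

lemma fir_dilation_uniform:
  fixes G :: "complex \<Rightarrow> complex^'u^'u"
  assumes G: "G \<in> Hinf_ext" and r: "1 < r" and e: "0 < e"
  shows "\<exists>N Qc. \<forall>q. 1 < norm q \<longrightarrow> norm (fir N Qc q - G (of_real r * q)) \<le> e"
proof -
  obtain a where a: "laurent_ext G a" using laurent_ext_exists[OF G] by blast
  obtain B where B: "0 < B" "\<And>q. 1 < norm q \<Longrightarrow> norm (G q) \<le> B"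
    using Hinf_ext_bound[OF G] by blast
  have aB: "norm (a k) \<le> B" for k
  proof -
    have "(norm (a k))\<^sup>2 \<le> (\<Sum>k<Suc k. (norm (a k))\<^sup>2)" by (simp add: sum_nonneg)
    also have "\<dots> \<le> B\<^sup>2" by (rule laurent_coeff_bound[OF G a B(2)])
    finally show ?thesis using B(1) by (simp add: power2_le_iff_abs_le)
  qed
  let ?g = "\<lambda>k. B * inverse r ^ k"
  have sg: "summable ?g"
    using r by (intro summable_mult summable_geometric) (simp add: inverse_less_1_iff)
  \<comment> \<open>\<open>fir N\<close> keeps the coefficients 0 to N inclusive, so the remainder
    starts at \<open>Suc N\<close>.\<close>
  obtain N where N: "(\<Sum>k. ?g (k + Suc N)) \<le> e"
  proof -
    obtain M where M: "\<forall>n\<ge>M. norm (\<Sum>i. ?g (i + n)) < e"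
      using suminf_exist_split[OF e sg] by blast
    have "norm (\<Sum>i. ?g (i + Suc M)) < e" by (rule M[rule_format]) simp
    then show thesis by (intro that[of M]) (simp add: abs_less_iff)
  qed
  define Qc where "Qc k = (inverse r ^ k) *\<^sub>R a k" for k
  have "norm (fir N Qc q - G (of_real r * q)) \<le> e" if q: "1 < norm q" for q
  proof -
    let ?t = "\<lambda>k. mat (inverse q ^ k) ** Qc k"
    have rq: "1 < norm (of_real r * q)" using norm_scaled_ext_disc[OF _ q] r by simp
    have tnth: "?t k $ i $ j = a k $ i $ j * inverse (of_real r * q) ^ k" for k i j
      unfolding mat_mult_nth Qc_def vector_scaleR_component
      by (simp add: scaleR_conv_of_real power_mult_distrib algebra_simps)
    have "(\<lambda>n. \<Sum>k<n. ?t k) \<longlonglongrightarrow> G (of_real r * q)"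
    proof (intro vec_tendstoI)
      fix i j
      have "(\<lambda>k. ?t k $ i $ j) sums (G (of_real r * q) $ i $ j)"
        using a rq unfolding tnth laurent_ext_def by blast
      then show "(\<lambda>n. (\<Sum>k<n. ?t k) $ i $ j) \<longlonglongrightarrow> G (of_real r * q) $ i $ j"
        by (simp only: sum_component sums_def)
    qed
    then have st: "?t sums G (of_real r * q)" by (simp add: sums_def)
    have nt: "norm (?t k) \<le> ?g k" for k
    proof -
      have "?t k = mat (inverse (of_real r * q) ^ k) ** a k"
        by (simp only: vec_eq_iff tnth) (simp add: mat_mult_nth mult.commute)
      then have "norm (?t k) = cmod (inverse (of_real r * q) ^ k) * norm (a k)"
        by (simp only: norm_mat_mult)
      also have "cmod (inverse (of_real r * q) ^ k) = inverse r ^ k * cmod (inverse q) ^ k"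
        using r by (simp add: norm_mult norm_power norm_inverse power_mult_distrib)
      also have "inverse r ^ k * cmod (inverse q) ^ k \<le> inverse r ^ k * 1"
        using r inverse_ext_disc(1)[OF q] by (intro mult_left_mono power_le_one) auto
      then have "inverse r ^ k * cmod (inverse q) ^ k * norm (a k) \<le> inverse r ^ k * 1 * B"
        using r aB by (intro mult_mono) auto
      finally show ?thesis by (simp add: mult.commute)
    qed
    have smn: "summable (\<lambda>k. norm (?t k))"
      by (rule summable_comparison_test'[OF sg, of 0]) (use nt in simp)
    have "G (of_real r * q) = (\<Sum>k. ?t k)" using st by (rule sums_unique)
    also have "\<dots> = (\<Sum>k. ?t (k + Suc N)) + (\<Sum>k<Suc N. ?t k)"
      by (rule suminf_split_initial_segment[OF sums_summable[OF st]])
    also have "(\<Sum>k<Suc N. ?t k) = fir N Qc q"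
      by (simp add: fir_def lessThan_Suc_atMost)
    finally have "norm (fir N Qc q - G (of_real r * q)) = norm (\<Sum>k. ?t (k + Suc N))"
      by (simp add: norm_minus_commute)
    also have "\<dots> \<le> (\<Sum>k. norm (?t (k + Suc N)))"
      by (rule summable_norm[OF summable_ignore_initial_segment[OF smn]])
    also have "\<dots> \<le> (\<Sum>k. ?g (k + Suc N))"
      by (intro suminf_le nt summable_ignore_initial_segment[OF smn] summable_ignore_initial_segment[OF sg])
    finally show ?thesis using N by simp
  qed
  then show ?thesis by blast
qed

section \<open>Nonnegativity from radial limits\<close>

lemma AE_lebesgue_on_negligible:
  assumes "AE x in lebesgue_on S. P x" "S \<in> sets lebesgue"
  obtains N where "negligible (N :: real set)" "\<And>x. x \<in> S \<Longrightarrow> x \<notin> N \<Longrightarrow> P x"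
proof -
  have "AE x in lebesgue. x \<in> S \<longrightarrow> P x"
    using assms by (subst (asm) AE_restrict_space_iff) auto
  then obtain N where N: "N \<in> null_sets lebesgue" "{x \<in> space lebesgue. \<not> (x \<in> S \<longrightarrow> P x)} \<subseteq> N"
    unfolding eventually_ae_filter by blast
  show thesis
    by (rule that[of N]) (use N in \<open>auto simp: negligible_iff_null_sets\<close>)
qed

text \<open>A bounded analytic function with boundary modulus at most one has all its power series
  coefficients at infinity of modulus at most one. Applied to every power of the function, this
  bounds the powers at a point by one constant, so the function itself is bounded by one.\<close>
lemma coeff_bound_from_boundary:
  assumes hol: "h holomorphic_on ext_disc" and B: "\<And>q. 1 < norm q \<Longrightarrow> cmod (h q) \<le> B"
    and N: "negligible N"
    and lim: "\<And>\<Omega>. \<Omega> \<in> {-pi..pi} \<Longrightarrow> \<Omega> \<notin> N \<Longrightarrow>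
      ((\<lambda>r. h (of_real r * cis \<Omega>)) \<longlongrightarrow> L \<Omega>) (at_right 1) \<and> cmod (L \<Omega>) \<le> 1"
    and q: "1 < norm q"
  shows "cmod (h q) \<le> 1 / (1 - cmod (inverse q))"
proof -
  obtain a g where ag: "\<And>w. w \<in> ball 0 1 \<Longrightarrow> (\<lambda>k. a k * w ^ k) sums g w"
    "\<And>q. 1 < norm q \<Longrightarrow> h q = g (inverse q)"
    using scalar_laurent[OF hol B] by blast
  define r where "r n = 1 + 1 / real (Suc n)" for n
  have r1: "1 < r n" for n by (simp add: r_def)
  have rlim: "filterlim r (at_right 1) sequentially"
  proof -
    have "r \<longlonglongrightarrow> 1 + 0"
      unfolding r_def by (intro tendsto_intros LIMSEQ_inverse_real_of_nat[unfolded inverse_eq_divide])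
    then show ?thesis
      using r1 by (intro filterlim_at_withinI) auto
  qed
  \<comment> \<open>Setting the integrands to 0 on \<open>N\<close> makes the convergence hold at
    every point without changing any integral.\<close>
  define f where "f n \<Omega> = (if \<Omega> \<in> N then 0 else (cmod (h (of_real (r n) * cis \<Omega>)))\<^sup>2)" for n \<Omega>
  define F where "F \<Omega> = (if \<Omega> \<in> N then 0 else (cmod (L \<Omega>))\<^sup>2)" for \<Omega>
  have conth: "continuous_on {-pi..pi} (\<lambda>\<Omega>. (cmod (h (of_real (r n) * cis \<Omega>)))\<^sup>2)" for n
  proof -
    have "continuous_on {-pi..pi} (\<lambda>\<Omega>. h (of_real (r n) * cis \<Omega>))"
      by (rule continuous_on_compose2[OF holomorphic_on_imp_continuous_on[OF hol]])
         (use r1[of n] in \<open>auto intro!: continuous_intros simp: norm_mult\<close>)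
    then show ?thesis by (intro continuous_intros)
  qed
  have int: "f n integrable_on {-pi..pi}" for n
    by (rule integrable_spike[OF integrable_continuous_real[OF conth] N]) (simp add: f_def)
  have F: "F integrable_on {-pi..pi}" "(\<lambda>n. integral {-pi..pi} (f n)) \<longlonglongrightarrow> integral {-pi..pi} F"
  proof -
    have bd: "norm (f n \<Omega>) \<le> B\<^sup>2" for n \<Omega>
      using B[of "of_real (r n) * cis \<Omega>"] r1[of n] by (auto simp: f_def norm_mult intro!: power_mono)
    have cv: "(\<lambda>n. f n \<Omega>) \<longlonglongrightarrow> F \<Omega>" if "\<Omega> \<in> {-pi..pi}" for \<Omega>
    proof (cases "\<Omega> \<in> N")
      case False
      have "(\<lambda>n. h (of_real (r n) * cis \<Omega>)) \<longlonglongrightarrow> L \<Omega>"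
        using filterlim_compose[OF _ rlim] lim[OF that False] by blast
      then show ?thesis using False unfolding f_def F_def by (auto intro!: tendsto_intros)
    qed (simp add: f_def F_def)
    show "F integrable_on {-pi..pi}" "(\<lambda>n. integral {-pi..pi} (f n)) \<longlonglongrightarrow> integral {-pi..pi} F"
      using dominated_convergence[of f "{-pi..pi}" "\<lambda>_. B\<^sup>2" F] int bd cv by auto
  qed
  have "integral {-pi..pi} F \<le> integral {-pi..pi} (\<lambda>_. 1)"
    by (intro integral_le F) (auto simp: F_def lim power_le_one)
  then have F2: "integral {-pi..pi} F \<le> 2 * pi" by simp
  have ak: "cmod (a k) \<le> 1" for k
  proof -
    have le: "(cmod (a k))\<^sup>2 * inverse (r n) ^ (2 * k) \<le> 1 / (2 * pi) * integral {-pi..pi} (f n)" for n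
    proof -
      have \<rho>: "0 \<le> inverse (r n)" "inverse (r n) < 1"
        using r1[of n] by (auto simp: inverse_less_1_iff)
      note P = parseval_disc[OF ag(1) \<rho>]
      have "integral {-pi..pi} (\<lambda>\<Omega>. (cmod (g (of_real (inverse (r n)) * cis (- \<Omega>))))\<^sup>2)
          = integral {-pi..pi} (f n)"
      proof (rule integral_spike[OF N])
        fix \<Omega> assume "\<Omega> \<in> {-pi..pi} - N"
        moreover have "g (of_real (inverse (r n)) * cis (- \<Omega>)) = h (of_real (r n) * cis \<Omega>)"
          using ag(2)[of "of_real (r n) * cis \<Omega>"] r1[of n] by (simp add: norm_mult)
        ultimately show "f n \<Omega> = (cmod (g (of_real (inverse (r n)) * cis (- \<Omega>))))\<^sup>2"
          by (simp add: f_def)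
      qed
      moreover have "(\<Sum>k\<in>{k}. (cmod (a k))\<^sup>2 * inverse (r n) ^ (2 * k))
          \<le> (\<Sum>k. (cmod (a k))\<^sup>2 * inverse (r n) ^ (2 * k))"
        using \<rho> by (intro sum_le_suminf sums_summable[OF P]) auto
      ultimately show ?thesis using sums_unique[OF P] by simp
    qed
    have "(\<lambda>n. (cmod (a k))\<^sup>2 * inverse (r n) ^ (2 * k)) \<longlonglongrightarrow> (cmod (a k))\<^sup>2 * inverse 1 ^ (2 * k)"
      using rlim by (intro tendsto_intros) (auto simp: filterlim_at)
    moreover have "(\<lambda>n. 1 / (2 * pi) * integral {-pi..pi} (f n)) \<longlonglongrightarrow> 1 / (2 * pi) * integral {-pi..pi} F"
      by (intro tendsto_intros F)
    ultimately have "(cmod (a k))\<^sup>2 * inverse 1 ^ (2 * k) \<le> 1 / (2 * pi) * integral {-pi..pi} F"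
      by (rule LIMSEQ_le) (use le in blast)
    also have "\<dots> \<le> 1" using F2 by (simp add: divide_le_eq)
    finally show ?thesis by (simp add: power_le_one_iff)
  qed
  let ?x = "cmod (inverse q)"
  have x: "0 \<le> ?x" "?x < 1" using inverse_ext_disc(2)[OF q] by auto
  have s: "(\<lambda>k. a k * inverse q ^ k) sums h q"
    using ag(1)[OF inverse_ext_disc(2)[OF q]] ag(2)[OF q] by simp
  have sg: "(\<lambda>k. ?x ^ k) sums (1 / (1 - ?x))" using x by (intro geometric_sums) simp
  have le: "norm (a k * inverse q ^ k) \<le> ?x ^ k" for k
    using mult_right_mono[OF ak[of k], of "?x ^ k"] by (simp add: norm_mult norm_power)
  have sn: "summable (\<lambda>k. norm (a k * inverse q ^ k))"
    by (rule summable_comparison_test'[OF sums_summable[OF sg], of 0]) (use le in simp)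
  have "cmod (h q) = norm (\<Sum>k. a k * inverse q ^ k)" using sums_unique[OF s] by simp
  also have "\<dots> \<le> (\<Sum>k. norm (a k * inverse q ^ k))" by (rule summable_norm[OF sn])
  also have "\<dots> \<le> (\<Sum>k. ?x ^ k)" by (intro suminf_le le sn sums_summable[OF sg])
  also have "\<dots> = 1 / (1 - ?x)" using sums_unique[OF sg] by simp
  finally show ?thesis .
qed

text \<open>The function exp (- f) has boundary modulus at most one almost everywhere. The
  coefficient bound applied to its n-th power gives a constant that depends on q but not on n; if Re
  (f q) were negative, exp (- n Re (f q)) would exceed it for large n.\<close>

lemma Re_nonneg_from_boundary:
  assumes hol: "f holomorphic_on ext_disc" and B: "\<And>q. 1 < norm q \<Longrightarrow> cmod (f q) \<le> B"
    and ae: "AE \<Omega> in lebesgue_on {-pi..pi}. \<exists>L.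
      ((\<lambda>r. f (of_real r * cis \<Omega>)) \<longlongrightarrow> L) (at_right 1) \<and> 0 \<le> Re L"
    and q: "1 < norm q"
  shows "0 \<le> Re (f q)"
proof -
  obtain N where N: "negligible N" "\<And>\<Omega>. \<Omega> \<in> {-pi..pi} \<Longrightarrow> \<Omega> \<notin> N \<Longrightarrow>
      \<exists>L. ((\<lambda>r. f (of_real r * cis \<Omega>)) \<longlongrightarrow> L) (at_right 1) \<and> 0 \<le> Re L"
    using AE_lebesgue_on_negligible[OF ae] by auto
  then obtain L where L: "\<And>\<Omega>. \<Omega> \<in> {-pi..pi} \<Longrightarrow> \<Omega> \<notin> N \<Longrightarrow>
      ((\<lambda>r. f (of_real r * cis \<Omega>)) \<longlongrightarrow> L \<Omega>) (at_right 1) \<and> 0 \<le> Re (L \<Omega>)"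
    by metis
  have bound: "exp (- Re (f q)) ^ n \<le> 1 / (1 - cmod (inverse q))" for n
  proof -
    have "cmod (exp (- f q) ^ n) \<le> 1 / (1 - cmod (inverse q))"
    proof (rule coeff_bound_from_boundary[where h = "\<lambda>q. exp (- f q) ^ n" and B = "exp B ^ n"
          and N = N and L = "\<lambda>\<Omega>. exp (- L \<Omega>) ^ n"])
      show "(\<lambda>q. exp (- f q) ^ n) holomorphic_on ext_disc"
        by (intro holomorphic_intros hol)
      show "cmod (exp (- f q) ^ n) \<le> exp B ^ n" if "1 < cmod q" for q
        using B[OF that] abs_Re_le_cmod[of "f q"] by (auto simp: norm_power intro!: power_mono)
      fix \<Omega> assume \<Omega>: "\<Omega> \<in> {-pi..pi}" "\<Omega> \<notin> N"
      have "cmod (exp (- L \<Omega>) ^ n) \<le> 1"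
        using L[OF \<Omega>] by (auto simp: norm_power intro!: power_le_one)
      then show "((\<lambda>r. exp (- f (of_real r * cis \<Omega>)) ^ n) \<longlongrightarrow> exp (- L \<Omega>) ^ n) (at_right 1)
          \<and> cmod (exp (- L \<Omega>) ^ n) \<le> 1"
        using L[OF \<Omega>] by (auto intro!: tendsto_intros)
    qed (use N q in auto)
    then show ?thesis by (simp add: norm_power)
  qed
  show ?thesis
  proof (rule ccontr)
    assume "\<not> 0 \<le> Re (f q)"
    then have "1 < exp (- Re (f q))" by simp
    then obtain n where "1 / (1 - cmod (inverse q)) < exp (- Re (f q)) ^ n"
      using real_arch_pow by blast
    then show False using bound[of n] by simp
  qed
qed

section \<open>The passivity constraint inside the domain\<close>

text \<open>The right side is the real quadratic form of the block matrix U of (PC) at the vector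
  (x, y), and \<open>d\<close> is a margin: d > 0 means strictly feasible. It is stated for |q| > 1,
  so no boundary values are involved.\<close>

definition interior_pc ::
  "(complex \<Rightarrow> complex^'u^'u) \<Rightarrow> (complex \<Rightarrow> complex^'u^'u) \<Rightarrow> real \<Rightarrow> bool"
  where "interior_pc F Q d \<longleftrightarrow> (\<forall>q. 1 < norm q \<longrightarrow> (\<forall>x y.
    d * ((norm x)\<^sup>2 + (norm y)\<^sup>2) \<le> x \<bullet> (Q q *v x) + x \<bullet> (Q q *v y) + y \<bullet> (F q *v y)))"

lemma hform_tendsto:
  assumes "(U \<longlongrightarrow> L) A"
  shows "((\<lambda>r. hform (U r) v) \<longlongrightarrow> hform L v) A"
  unfolding hform_def matrix_vector_mult_def vec_lambda_beta
  by (intro tendsto_intros assms)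

lemma hform_holomorphic:
  assumes "mat_holomorphic_on U S"
  shows "(\<lambda>q. hform (U q) v) holomorphic_on S"
  unfolding hform_def matrix_vector_mult_def vec_lambda_beta
  using assms by (intro holomorphic_intros) (simp add: mat_holomorphic_on_def)

lemma hform_bound: "cmod (hform M v) \<le> norm M * (norm v)\<^sup>2"
proof -
  have "(cmod (hform M v))\<^sup>2 \<le> (\<Sum>i\<in>UNIV. (cmod (cnj (v $ i)))\<^sup>2) * (\<Sum>i\<in>UNIV. (cmod ((M *v v) $ i))\<^sup>2)"
    unfolding hform_def by (rule cmod_sum_mult_le)
  also have "\<dots> = (norm v * norm (M *v v))\<^sup>2"
    by (simp add: norm_vec_def L2_set_def sum_nonneg power_mult_distrib)
  finally have "cmod (hform M v) \<le> norm v * norm (M *v v)"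
    by (rule power2_le_imp_le) simp
  also have "\<dots> \<le> norm v * (norm M * norm v)"
    by (intro mult_left_mono norm_matrix_vector_le) simp
  finally show ?thesis by (simp add: power2_eq_square mult_ac)
qed

text \<open>\<open>hform\<close> is linear in the matrix, hence analytic along \<open>U\<close>, and
  its real part is the form in question. After subtracting c this is a scalar statement.\<close>

lemma form_nonneg_from_boundary:
  assumes U: "U \<in> Hinf_ext"
    and ae: "AE \<Omega> in lebesgue_on {-pi..pi}. \<exists>L. boundary_limit U \<Omega> L \<and> c \<le> v \<bullet> (L *v v)"
    and q: "1 < norm q"
  shows "c \<le> v \<bullet> (U q *v v)"
proof -
  obtain B where B: "0 < B" "\<And>q. 1 < norm q \<Longrightarrow> norm (U q) \<le> B"
    using Hinf_ext_bound[OF U] by blast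
  let ?f = "\<lambda>q. hform (U q) v - of_real c"
  have "0 \<le> Re (?f q)"
  proof (rule Re_nonneg_from_boundary[where f = ?f and B = "B * (norm v)\<^sup>2 + \<bar>c\<bar>"])
    show "?f holomorphic_on ext_disc"
      using U by (intro holomorphic_intros hform_holomorphic) (simp add: Hinf_ext_iff)
    fix q :: complex assume q: "1 < norm q"
    have "cmod (?f q) \<le> cmod (hform (U q) v) + cmod (of_real c)" by (rule norm_triangle_ineq4)
    also have "\<dots> \<le> B * (norm v)\<^sup>2 + \<bar>c\<bar>"
      using order_trans[OF hform_bound[of "U q" v] mult_right_mono[OF B(2)[OF q], of "(norm v)\<^sup>2"]]
      by simp
    finally show "cmod (?f q) \<le> B * (norm v)\<^sup>2 + \<bar>c\<bar>" .
  next
    show "AE \<Omega> in lebesgue_on {-pi..pi}. \<exists>L. ((\<lambda>r. ?f (of_real r * cis \<Omega>)) \<longlongrightarrow> L) (at_right 1) \<and> 0 \<le> Re L"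
      using ae
    proof eventually_elim
      case (elim \<Omega>)
      then obtain L where L: "boundary_limit U \<Omega> L" "c \<le> v \<bullet> (L *v v)" by blast
      then show ?case
        by (intro exI[of _ "hform L v - of_real c"])
           (auto simp: boundary_limit_def Re_hform intro!: tendsto_intros hform_tendsto)
    qed
  qed (rule q)
  then show ?thesis by (simp add: Re_hform)
qed

lemma AE_on_interval: "AE \<Omega> in lebesgue_on {-pi..pi}. \<Omega> \<in> {-pi..pi}"
  using AE_space[of "lebesgue_on {-pi..pi}"] by (simp add: space_restrict_space)

lemma block2_Hinf:
  fixes Q F :: "complex \<Rightarrow> complex^'u^'u"
  assumes "Q \<in> Hinf_ext" "F \<in> Hinf_ext"
  shows "(\<lambda>q. block2 (Q q) (Q q) 0 (F q)) \<in> Hinf_ext"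
proof -
  obtain B where B: "\<And>i j. (\<lambda>q. Q q $ i $ j) holomorphic_on ext_disc" "\<And>i j q. 1 < norm q \<Longrightarrow> norm (Q q $ i $ j) \<le> B"
    using Hinf_ext_entry[OF assms(1)] by blast
  obtain C where C: "\<And>i j. (\<lambda>q. F q $ i $ j) holomorphic_on ext_disc" "\<And>i j q. 1 < norm q \<Longrightarrow> norm (F q $ i $ j) \<le> C"
    using Hinf_ext_entry[OF assms(2)] by blast
  let ?U = "\<lambda>q. block2 (Q q) (Q q) 0 (F q)"
  have hol: "(\<lambda>q. ?U q $ i $ j) holomorphic_on ext_disc" for i j
    using B(1) C(1) by (cases i; cases j) (simp_all add: block2_def vcat_def hcat_def)
  have bd: "cmod (?U q $ i $ j) \<le> max 0 (max B C)" if "1 < norm q" for i j q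
    using B(2)[OF that] C(2)[OF that]
    by (cases i; cases j) (simp_all add: block2_def vcat_def hcat_def le_max_iff_disj)
  have "norm (?U q) \<le> (\<Sum>(i::'u+'u)\<in>UNIV. \<Sum>(j::'u+'u)\<in>UNIV. max 0 (max B C))" if "1 < norm q" for q
    by (rule order_trans[OF norm_matrix_le_sum]) (intro sum_mono bd that)
  then show ?thesis
    using hol unfolding Hinf_ext_iff mat_holomorphic_on_def by blast
qed

lemma passivity_imp_interior:
  fixes Q F :: "complex \<Rightarrow> complex^'u^'u"
  assumes Q: "Q \<in> Hinf_ext" and F: "F \<in> Hinf_ext" and pc: "passivity_constraint F Q"
  shows "interior_pc F Q 0"
  unfolding interior_pc_def
proof (intro allI impI)
  fix q :: complex and x y :: "complex^'u" assume q: "1 < norm (q::complex)"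
  let ?U = "\<lambda>q. block2 (Q q) (Q q) 0 (F q)"
  have ae: "AE \<Omega> in lebesgue_on {-pi..pi}. \<exists>L. boundary_limit ?U \<Omega> L"
    and pos: "\<And>\<Omega> L. \<Omega> \<in> {-pi..pi} \<Longrightarrow> boundary_limit ?U \<Omega> L \<Longrightarrow> hpsd (L + L\<^sup>H)"
    using pc by (auto simp: passivity_constraint_def Let_def)
  have "0 \<le> pair_vec x y \<bullet> (?U q *v pair_vec x y)"
  proof (rule form_nonneg_from_boundary[OF block2_Hinf[OF Q F] _ q])
    show "AE \<Omega> in lebesgue_on {-pi..pi}. \<exists>L. boundary_limit ?U \<Omega> L \<and> 0 \<le> pair_vec x y \<bullet> (L *v pair_vec x y)"
      using ae AE_on_interval by eventually_elim (use pos hpsd_herm_part in blast)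
  qed
  then show "0 * ((norm x)\<^sup>2 + (norm y)\<^sup>2) \<le> x \<bullet> (Q q *v x) + x \<bullet> (Q q *v y) + y \<bullet> (F q *v y)"
    by (simp add: block_pair)
qed

lemma boundary_limit_block2D:
  assumes "boundary_limit (\<lambda>q. block2 (Q q) (Q q) 0 (F q)) \<Omega> L"
  shows "\<exists>L. boundary_limit Q \<Omega> L"
proof -
  have "((\<lambda>r. Q (of_real r * cis \<Omega>)) \<longlongrightarrow> (\<chi> i j. L $ Inl i $ Inl j)) (at_right 1)"
  proof (intro vec_tendstoI)
    fix i j
    have "((\<lambda>r. block2 (Q (of_real r * cis \<Omega>)) (Q (of_real r * cis \<Omega>)) 0 (F (of_real r * cis \<Omega>)) $ Inl i $ Inl j)
        \<longlongrightarrow> L $ Inl i $ Inl j) (at_right 1)"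
      using assms unfolding boundary_limit_def by (intro tendsto_vec_nth)
    then show "((\<lambda>r. Q (of_real r * cis \<Omega>) $ i $ j) \<longlongrightarrow> (\<chi> i j. L $ Inl i $ Inl j) $ i $ j) (at_right 1)"
      by (simp add: block2_def vcat_def hcat_def)
  qed
  then show ?thesis unfolding boundary_limit_def by blast
qed

lemma boundary_limit_block2:
  assumes "boundary_limit Q \<Omega> M" "boundary_limit F \<Omega> N"
  shows "boundary_limit (\<lambda>q. block2 (Q q) (Q q) 0 (F q)) \<Omega> (block2 M M 0 N)"
  unfolding boundary_limit_def
proof (intro vec_tendstoI)
  fix i j
  note l = assms[unfolded boundary_limit_def]
  show "((\<lambda>r. block2 (Q (of_real r * cis \<Omega>)) (Q (of_real r * cis \<Omega>)) 0 (F (of_real r * cis \<Omega>)) $ i $ j)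
        \<longlongrightarrow> block2 M M 0 N $ i $ j) (at_right 1)"
    by (cases i; cases j) (auto simp: block2_def vcat_def hcat_def intro!: tendsto_vec_nth l)
qed

lemma boundary_limit_form_ge:
  assumes "boundary_limit U \<Omega> L" "\<And>q. 1 < norm q \<Longrightarrow> 0 \<le> v \<bullet> (U q *v v)"
  shows "0 \<le> v \<bullet> (L *v v)"
proof -
  have "((\<lambda>r. Re (hform (U (of_real r * cis \<Omega>)) v)) \<longlongrightarrow> Re (hform L v)) (at_right 1)"
    using assms(1) unfolding boundary_limit_def by (intro tendsto_Re hform_tendsto)
  moreover have "eventually (\<lambda>r. 0 \<le> Re (hform (U (of_real r * cis \<Omega>)) v)) (at_right (1::real))"
    by (rule eventually_radial) (simp add: Re_hform assms(2))
  ultimately show ?thesis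
    unfolding Re_hform[symmetric] by (intro tendsto_lowerbound) auto
qed

text \<open>Radial limits preserve non-strict inequalities. Since \<open>F\<close> has a limit at
  every frequency, the limit of the block matrix exists wherever that of \<open>Q\<close>
  does.\<close>

lemma interior_imp_passivity:
  assumes int: "interior_pc F Q 0" and F: "cont_ext F"
    and ae: "AE \<Omega> in lebesgue_on {-pi..pi}. \<exists>L. boundary_limit Q \<Omega> L"
  shows "passivity_constraint F Q"
proof -
  let ?U = "\<lambda>q. block2 (Q q) (Q q) 0 (F q)"
  have pos: "0 \<le> v \<bullet> (?U q *v v)" if "1 < norm q" for v q
    using int[unfolded interior_pc_def, rule_format, OF that]
    by (subst block_quadratic) simp
  have "AE \<Omega> in lebesgue_on {-pi..pi}. \<exists>L. boundary_limit ?U \<Omega> L"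
    using ae
  proof eventually_elim
    case (elim \<Omega>)
    obtain N where "boundary_limit F \<Omega> N"
      using cont_ext_radial[OF F] unfolding boundary_limit_def by blast
    then show ?case using elim boundary_limit_block2 by blast
  qed
  moreover have "hpsd (L + L\<^sup>H)" if "boundary_limit ?U \<Omega> L" for \<Omega> L
    unfolding hpsd_herm_part using boundary_limit_form_ge[OF that] pos by blast
  ultimately show ?thesis by (simp add: passivity_constraint_def Let_def)
qed

text \<open>The lower left block of U is zero, so the term in x and y is not balanced by a partner:
  its size is limited only by the terms in \<open>Q\<close> and \<open>F\<close>. Choosing y against
  the adjoint of \<open>Q\<close> applied to x bounds that adjoint, with a constant that is the same
  for all feasible \<open>Q\<close>.\<close>

lemma interior_pc_bound:
  fixes Q F :: "complex \<Rightarrow> complex^'u^'u" and C :: real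
  assumes int: "interior_pc F Q 0" and C: "0 < C" "\<And>q. 1 < norm q \<Longrightarrow> norm (F q) \<le> C"
    and q: "1 < norm q"
  shows "norm (Q q) \<le> CARD('u) * CARD('u) * (4 * C)"
proof -
  have adj: "norm ((Q q)\<^sup>H *v x) \<le> 4 * C * norm x" for x
  proof -
    define z where "z = (Q q)\<^sup>H *v x"
    \<comment> \<open>This value minimises C c^2 - c, with minimum - 1 / (4 C); that is the origin
      of the constant 4 C.\<close>
    let ?c = "1 / (2 * C)"
    let ?y = "- (?c *\<^sub>R z)"
    have 0: "0 \<le> x \<bullet> (Q q *v x) + x \<bullet> (Q q *v ?y) + ?y \<bullet> (F q *v ?y)"
      using int[unfolded interior_pc_def, rule_format, OF q, of x ?y] by simp
    have 1: "x \<bullet> (Q q *v x) \<le> norm z * norm x"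
      unfolding inner_ctransp z_def[symmetric] by (rule norm_cauchy_schwarz)
    have 2: "x \<bullet> (Q q *v ?y) = - (?c * (norm z)\<^sup>2)"
      unfolding inner_ctransp z_def[symmetric] by (simp add: power2_norm_eq_inner)
    have "?y \<bullet> (F q *v ?y) \<le> norm ?y * norm (F q *v ?y)" by (rule norm_cauchy_schwarz)
    also have "\<dots> \<le> norm ?y * (C * norm ?y)"
      by (intro mult_left_mono norm_matrix_vector_le' C(2) q) simp
    also have "\<dots> = ?c / 2 * (norm z)\<^sup>2"
      using C(1) by (simp add: power2_eq_square field_simps)
    finally have "?c / 2 * (norm z)\<^sup>2 \<le> norm z * norm x" using 0 1 2 by linarith
    then have le: "norm z * norm z \<le> norm z * (4 * C * norm x)"
      using C(1) by (simp add: power2_eq_square field_simps)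
    show ?thesis
      unfolding z_def[symmetric] by (rule norm_le_of_mult_le[OF le]) (use C(1) in simp)
  qed
  have "norm (Q q *v x) \<le> 4 * C * norm x" for x
  proof -
    have "(norm (Q q *v x))\<^sup>2 = ((Q q)\<^sup>H *v (Q q *v x)) \<bullet> x"
      by (metis inner_ctransp power2_norm_eq_inner)
    also have "\<dots> \<le> norm ((Q q)\<^sup>H *v (Q q *v x)) * norm x" by (rule norm_cauchy_schwarz)
    also have "\<dots> \<le> 4 * C * norm (Q q *v x) * norm x" by (intro mult_right_mono adj) simp
    finally have "norm (Q q *v x) * norm (Q q *v x) \<le> norm (Q q *v x) * (4 * C * norm x)"
      by (simp add: power2_eq_square mult_ac)
    then show ?thesis by (rule norm_le_of_mult_le) (use C(1) in simp)
  qed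
  then show ?thesis by (rule norm_matrix_le_onorm)
qed

text \<open>The three perturbed terms cost e |x|^2, e |x| |y| and e |y|^2, together at most 3/2 e
  (|x|^2 + |y|^2); the factor 2 is a rounded value.\<close>

lemma interior_pc_perturb:
  fixes Q Q' F F' :: "complex \<Rightarrow> complex^'u^'u"
  assumes int: "interior_pc F Q d"
    and close: "\<And>q. 1 < norm q \<Longrightarrow> norm (Q' q - Q q) \<le> e" "\<And>q. 1 < norm q \<Longrightarrow> norm (F' q - F q) \<le> e"
  shows "interior_pc F' Q' (d - 2 * e)"
  unfolding interior_pc_def
proof (intro allI impI)
  fix q :: complex and x y :: "complex^'u" assume q: "1 < norm (q::complex)"
  have low: "u \<bullet> (A *v w) \<ge> - (e * (norm u * norm w))" if "norm A \<le> e" for A :: "complex^'u^'u" and u w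
  proof -
    have "\<bar>u \<bullet> (A *v w)\<bar> \<le> norm u * norm (A *v w)" by (rule Cauchy_Schwarz_ineq2)
    also have "\<dots> \<le> norm u * (e * norm w)"
      by (intro mult_left_mono norm_matrix_vector_le' that) simp
    finally show ?thesis by (simp add: mult_ac)
  qed
  have e0: "0 \<le> e" using close(1)[OF q] norm_ge_zero order_trans by blast
  have split: "u \<bullet> (A' *v w) = u \<bullet> (A *v w) + u \<bullet> ((A' - A) *v w)" for u w and A A' :: "complex^'u^'u"
    by (simp add: matrix_vector_mult_diff_rdistrib inner_diff_right)
  have "e * (norm x * norm y) \<le> e * (((norm x)\<^sup>2 + (norm y)\<^sup>2) / 2)"
    using sum_squares_bound[of "norm x" "norm y"] e0 by (intro mult_left_mono) auto
  then show "(d - 2 * e) * ((norm x)\<^sup>2 + (norm y)\<^sup>2)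
      \<le> x \<bullet> (Q' q *v x) + x \<bullet> (Q' q *v y) + y \<bullet> (F' q *v y)"
    using int[unfolded interior_pc_def, rule_format, OF q, of x y]
      low[OF close(1)[OF q], of x x] low[OF close(1)[OF q], of x y] low[OF close(2)[OF q], of y y]
    unfolding split[of x "Q' q" x "Q q"] split[of x "Q' q" y "Q q"] split[of y "F' q" y "F q"]
    using mult_nonneg_nonneg[OF e0 zero_le_power2[of "norm x"]] mult_nonneg_nonneg[OF e0 zero_le_power2[of "norm y"]]
    by (simp add: algebra_simps power2_eq_square)
qed

lemma interior_pc_convex:
  fixes Q Q' F :: "complex \<Rightarrow> complex^'u^'u"
  assumes "interior_pc F Q d" "interior_pc F Q' d'" "0 \<le> t" "t \<le> 1"
  shows "interior_pc F (\<lambda>q. (1 - t) *\<^sub>R Q q + t *\<^sub>R Q' q) ((1 - t) * d + t * d')"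
  unfolding interior_pc_def
proof (intro allI impI)
  fix q :: complex and x y :: "complex^'u" assume q: "1 < norm (q::complex)"
  have sc: "(c *\<^sub>R A) *v w = c *\<^sub>R (A *v w)" for c and A :: "complex^'u^'u" and w
    by (simp add: vec_eq_iff matrix_vector_mult_def scaleR_sum_right)
  have "(1 - t) * (d * ((norm x)\<^sup>2 + (norm y)\<^sup>2)) + t * (d' * ((norm x)\<^sup>2 + (norm y)\<^sup>2))
    \<le> (1 - t) * (x \<bullet> (Q q *v x) + x \<bullet> (Q q *v y) + y \<bullet> (F q *v y))
      + t * (x \<bullet> (Q' q *v x) + x \<bullet> (Q' q *v y) + y \<bullet> (F q *v y))"
    using assms q unfolding interior_pc_def by (intro add_mono mult_left_mono) auto
  then show "((1 - t) * d + t * d') * ((norm x)\<^sup>2 + (norm y)\<^sup>2)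
      \<le> x \<bullet> (((1 - t) *\<^sub>R Q q + t *\<^sub>R Q' q) *v x) + x \<bullet> (((1 - t) *\<^sub>R Q q + t *\<^sub>R Q' q) *v y)
        + y \<bullet> (F q *v y)"
    by (simp add: matrix_vector_mult_add_rdistrib sc inner_add_right algebra_simps)
qed

text \<open>For Q = m I the form is at least m (|x|^2 + x . y + |y|^2), and the mixed term takes
  away at most half of the squares. The scalar equals the lower bound of \<open>F\<close>, which
  balances the two squares.\<close>

lemma interior_pc_scalar:
  fixes F :: "complex \<Rightarrow> complex^'u^'u"
  assumes F: "\<And>q y. 1 < norm q \<Longrightarrow> m * (norm y)\<^sup>2 \<le> y \<bullet> (F q *v y)" and m: "0 < m"
  shows "interior_pc F (\<lambda>_. m *\<^sub>R mat 1) (m / 2)"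
  unfolding interior_pc_def
proof (intro allI impI)
  fix q :: complex and x y :: "complex^'u" assume q: "1 < norm (q::complex)"
  have sc: "(m *\<^sub>R mat 1) *v w = m *\<^sub>R w" for w :: "complex^'u"
    by (simp add: vec_eq_iff matrix_vector_mult_def mat_def if_distrib if_distribR cong: if_cong)
  have "- (norm x * norm y) \<le> x \<bullet> y"
    using Cauchy_Schwarz_ineq2[of x y] by (simp add: abs_le_iff)
  moreover have "norm x * norm y \<le> ((norm x)\<^sup>2 + (norm y)\<^sup>2) / 2"
    using sum_squares_bound[of "norm x" "norm y"] by simp
  ultimately have "- (((norm x)\<^sup>2 + (norm y)\<^sup>2) / 2) \<le> x \<bullet> y" by linarith
  then have "0 \<le> x \<bullet> y + ((norm x)\<^sup>2 + (norm y)\<^sup>2) / 2" by linarith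
  then have "0 \<le> m * (x \<bullet> y + ((norm x)\<^sup>2 + (norm y)\<^sup>2) / 2)"
    using m by (intro mult_nonneg_nonneg) auto
  also have "\<dots> = x \<bullet> ((m *\<^sub>R mat 1) *v x) + x \<bullet> ((m *\<^sub>R mat 1) *v y) + m * (norm y)\<^sup>2
      - m / 2 * ((norm x)\<^sup>2 + (norm y)\<^sup>2)"
    by (simp add: sc power2_norm_eq_inner field_simps)
  finally show "m / 2 * ((norm x)\<^sup>2 + (norm y)\<^sup>2)
      \<le> x \<bullet> ((m *\<^sub>R mat 1) *v x) + x \<bullet> ((m *\<^sub>R mat 1) *v y) + y \<bullet> (F q *v y)"
    using F[OF q, of y] by linarith
qed


section \<open>The spectral factor\<close>

lemma Pt_uy_passive:
  assumes "plant_class P" "0 < \<tau>" "1 < norm q"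
  shows "0 \<le> v \<bullet> (Pt_uy P \<tau> q *v v)"
proof -
  have "Pt_uy P \<tau> q = Phat_uy P (1 / (2 * of_real \<tau>) * ((q - 1) / (q + 1)))"
    by (simp add: Pt_uy_def tilde_def)
  moreover have "hpsd (Phat_uy P s + (Phat_uy P s)\<^sup>H)" if "0 < Re s" for s
    using assms(1) that by (simp add: plant_class_def)
  ultimately show ?thesis
    using bilinear_rhp[OF assms(2,3)] hpsd_herm_part by metis
qed

text \<open>On the circle F + F^H is the inverse of Z = V + V^H + \<epsilon> I, which is at least
  \<epsilon> I by passivity and at most D = 2 M + \<epsilon> in operator norm. With w = Z^(-1) y the
  form of the inverse at y is w . Z w >= \<epsilon> |w|^2 >= \<epsilon> |y|^2 / D^2, and
  \<open>m\<close> is half of this factor. The bound then extends from the circle to the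
  domain.\<close>

lemma factor_accretive:
  assumes P: "plant_class P" and \<epsilon>: "0 < \<epsilon>" and \<tau>: "0 < \<tau>" and F: "is_factor P \<epsilon> \<tau> F"
  shows "\<exists>m>0. \<forall>q y. 1 < norm q \<longrightarrow> m * (norm y)\<^sup>2 \<le> y \<bullet> (F q *v y)"
proof -
  have "Pt_uy P \<tau> \<in> Hinf_ext"
    unfolding Pt_uy_def using P by (intro tilde_Hinf \<tau>) (simp add: plant_class_def)
  then obtain M where M: "0 < M" "\<And>q. 1 < norm q \<Longrightarrow> norm (Pt_uy P \<tau> q) \<le> M"
    by (rule Hinf_ext_bound) blast
  define D where "D = 2 * M + \<epsilon>"
  have D: "0 < D" using M \<epsilon> by (simp add: D_def)
  define m where "m = \<epsilon> / (2 * D\<^sup>2)"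
  have m: "0 < m" using D \<epsilon> by (simp add: m_def)
  have bdry: "\<exists>L. boundary_limit F \<Omega> L \<and> m * (norm y)\<^sup>2 \<le> y \<bullet> (L *v y)" if \<Omega>: "\<Omega> \<in> {-pi..pi}" for \<Omega> y
  proof -
    obtain V W where V: "boundary_limit (Pt_uy P \<tau>) \<Omega> V" and W: "boundary_limit F \<Omega> W"
      and eq: "matrix_inv (V + V\<^sup>H + mat (of_real \<epsilon>)) = W + W\<^sup>H"
      using F \<Omega> unfolding is_factor_def by blast
    let ?Z = "V + V\<^sup>H + mat (of_real \<epsilon>)"
    have Vpos: "0 \<le> v \<bullet> (V *v v)" for v
      by (rule boundary_limit_form_ge[OF V]) (rule Pt_uy_passive[OF P \<tau>])
    have Vn: "norm V \<le> M"
    proof (rule tendsto_upperbound)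
      show "((\<lambda>r. norm (Pt_uy P \<tau> (of_real r * cis \<Omega>))) \<longlongrightarrow> norm V) (at_right 1)"
        using V unfolding boundary_limit_def by (rule tendsto_norm)
      show "eventually (\<lambda>r. norm (Pt_uy P \<tau> (of_real r * cis \<Omega>)) \<le> M) (at_right (1::real))"
        by (rule eventually_radial) (rule M(2))
    qed simp
    have Zpos: "\<epsilon> * (norm w)\<^sup>2 \<le> w \<bullet> (?Z *v w)" for w
      using Vpos[of w] inner_herm_part[of w V]
      by (simp add: matrix_vector_mult_add_rdistrib inner_add_right of_real_vec_scale power2_norm_eq_inner)
    have Zinv: "invertible ?Z"
      unfolding invertible_kernel
    proof (intro allI impI)
      fix w assume "?Z *v w = 0"
      then show "w = 0" using Zpos[of w] \<epsilon> by (simp add: mult_le_0_iff)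
    qed
    define w where "w = matrix_inv ?Z *v y"
    have y: "?Z *v w = y" unfolding w_def by (rule matrix_inv_vec[OF Zinv])
    have "norm y \<le> D * norm w"
    proof -
      have "norm y \<le> norm (V *v w) + norm (V\<^sup>H *v w) + norm (\<epsilon> *\<^sub>R w)"
        unfolding y[symmetric] matrix_vector_mult_add_rdistrib mat_mult_vec of_real_vec_scale
        by (intro order_trans[OF norm_triangle_ineq] add_mono norm_triangle_ineq) simp
      also have "\<dots> \<le> M * norm w + M * norm w + \<epsilon> * norm w"
        using Vn \<epsilon> by (intro add_mono norm_matrix_vector_le') auto
      finally show ?thesis by (simp add: D_def algebra_simps)
    qed
    then have "(norm y)\<^sup>2 \<le> D\<^sup>2 * (norm w)\<^sup>2"
      using power_mono[of "norm y" "D * norm w" 2] by (simp add: power_mult_distrib)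
    then have "m * (norm y)\<^sup>2 \<le> m * (D\<^sup>2 * (norm w)\<^sup>2)"
      using m by (intro mult_left_mono) auto
    also have "\<dots> = \<epsilon> * (norm w)\<^sup>2 / 2" using D by (simp add: m_def)
    also have "\<dots> \<le> w \<bullet> (?Z *v w) / 2" using Zpos[of w] by simp
    also have "w \<bullet> (?Z *v w) = y \<bullet> ((W + W\<^sup>H) *v y)"
      unfolding y eq[symmetric] w_def[symmetric] by (rule inner_commute)
    also have "\<dots> / 2 = y \<bullet> (W *v y)" by (simp add: inner_herm_part)
    finally show ?thesis using W by blast
  qed
  have FH: "F \<in> Hinf_ext" using F by (simp add: is_factor_def)
  have "m * (norm y)\<^sup>2 \<le> y \<bullet> (F q *v y)" if q: "1 < norm q" for q y
  proof (rule form_nonneg_from_boundary[OF FH _ q])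
    show "AE \<Omega> in lebesgue_on {-pi..pi}. \<exists>L. boundary_limit F \<Omega> L \<and> m * (norm y)\<^sup>2 \<le> y \<bullet> (L *v y)"
      using AE_on_interval by eventually_elim (rule bdry)
  qed
  then show ?thesis using m by blast
qed

section \<open>The reference controller\<close>

text \<open>The feedthrough matrix is the value at s = infinity, a radial limit at q = -1, so it
  inherits passivity of the transfer function.\<close>

lemma Duy_passive:
  assumes P: "plant_class P"
  shows "0 \<le> v \<bullet> (pDuy P *v v)"
proof -
  \<comment> \<open>The time constant is arbitrary here; 1 serves.\<close>
  let ?T = "tilde 1 (Phat_uy P)"
  have "(?T \<longlongrightarrow> pDuy P) (at (- 1))"
    unfolding Phat_uy_def by (rule tilde_transfer_limit) simp
  moreover have "filterlim (\<lambda>r. of_real r * cis pi) (at (- 1)) (at_right 1)"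
  proof (rule filterlim_atI)
    have "(\<lambda>r. of_real r * cis pi) \<midarrow>1\<rightarrow> of_real 1 * cis pi" by (intro tendsto_intros)
    then show "((\<lambda>r. of_real r * cis pi) \<longlongrightarrow> - 1) (at_right 1)"
      by (simp add: filterlim_at_split)
    show "eventually (\<lambda>r. of_real r * cis pi \<noteq> - 1) (at_right (1::real))"
      unfolding eventually_at_right_field by (rule exI[of _ 2]) auto
  qed
  ultimately have "boundary_limit ?T pi (pDuy P)"
    unfolding boundary_limit_def by (rule filterlim_compose)
  then show ?thesis
    by (rule boundary_limit_form_ge) (use Pt_uy_passive[OF P, of 1] in \<open>simp add: Pt_uy_def\<close>)
qed

definition A_K where
  "A_K P J Y = pA P + pBu P ** C_K P J + (Y ** (C_K P J)\<^sup>H) ** (pCy P + pDuy P ** C_K P J)"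

text \<open>With x = Y y this is a Lyapunov inequality for the controller state matrix with storage
  matrix Y^(-1) and dissipation \<epsilon> |C_K x|^2. It is the second matrix inequality of OP2
  after a Schur complement and completion of a square.\<close>

lemma controller_lyapunov:
  assumes P: "plant_class P" and \<epsilon>: "0 < \<epsilon>" and D: "reference_design P \<epsilon> J S Z0 X0 \<Psi> X Y"
  shows "2 * (y \<bullet> (A_K P J Y *v (Y *v y))) \<le> - \<epsilon> * (norm (C_K P J *v (Y *v y)))\<^sup>2"
proof -
  have Y: "Y\<^sup>H = Y" and Z0: "hpd Z0" and S: "hpsd S" "S ** S = Emat P \<epsilon>"
    using D by (auto simp: reference_design_def OP2_solution_def OP2_feasible_def hpd_def is_hsqrt_def)
  define CK where "CK = C_K P J"
  define Gp where "Gp = G_p P J S"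
  define Gn where "Gn = G_n P S"
  define Z where "Z = matrix_inv Z0"
  define AZ where "AZ = A_Z P J"
  define N where "N = Gn\<^sup>H ** Gn"
  define BB where "BB = AZ ** Y + Y ** AZ\<^sup>H + Z ** N ** Z - Y ** N ** Z - Z ** N ** Y"
  have lmi: "hnsd (block2 BB ((Gp ** Y)\<^sup>H) (Gp ** Y) (- mat 1))"
    using D by (simp add: reference_design_def OP2_solution_def OP2_feasible_def Let_def
        BB_def N_def AZ_def Z_def Gn_def Gp_def)
  have Zh: "Z\<^sup>H = Z"
    unfolding Z_def using Z0 by (intro ctransp_matrix_inv hpd_invertible) (auto simp: hpd_def)
  have Sh: "S\<^sup>H = S" using S(1) by (simp add: hpsd_def)
  have E: "u \<bullet> (Emat P \<epsilon> *v u) = \<epsilon> * (norm u)\<^sup>2 + 2 * (u \<bullet> (pDuy P *v u))" for u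
  proof -
    have "u \<bullet> (Emat P \<epsilon> *v u) = u \<bullet> (\<epsilon> *\<^sub>R u) + u \<bullet> ((pDuy P + (pDuy P)\<^sup>H) *v u)"
      by (simp add: Emat_def matrix_vec_distrib inner_add_right of_real_vec_scale)
    then show ?thesis by (simp add: inner_herm_part power2_norm_eq_inner)
  qed
  have Sinv: "invertible S"
    unfolding invertible_kernel
  proof (intro allI impI)
    fix u assume "S *v u = 0"
    then have "Emat P \<epsilon> *v u = 0" unfolding S(2)[symmetric] by (simp add: matrix_vec_distrib(3))
    then have "\<epsilon> * (norm u)\<^sup>2 \<le> 0" using E[of u] Duy_passive[OF P, of u] by simp
    then show "u = 0" using \<epsilon> by (simp add: mult_le_0_iff)
  qed
  define x where "x = Y *v y"
  define c where "c = CK *v x"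
  define g where "g = Gp *v x"
  define p where "p = Z *v y"
  have gY: "(Gp ** Y) *v y = g" by (simp add: g_def x_def matrix_vec_distrib(3))
  \<comment> \<open>The lower test vector is \<open>g\<close> itself: it maximises the form over the
    second component, so that the test yields the Schur complement.\<close>
  have "y \<bullet> ((Gp ** Y)\<^sup>H *v g) = g \<bullet> g"
    unfolding inner_ctransp[of y] ctransp_ctransp gY ..
  moreover have "g \<bullet> ((- mat 1) *v g) = - (g \<bullet> g)" by (simp add: matrix_neg_vec)
  ultimately have "y \<bullet> (BB *v y) + (g \<bullet> g + g \<bullet> g - g \<bullet> g) \<le> 0"
    using hnsd_block2[OF lmi, of y g] by (simp only: gY)
  moreover have "y \<bullet> (BB *v y) = 2 * (y \<bullet> (AZ *v x)) + (Gn *v p) \<bullet> (Gn *v p) - 2 * ((Gn *v x) \<bullet> (Gn *v p))"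
  proof -
    have "y \<bullet> (BB *v y) = y \<bullet> (AZ *v (Y *v y)) + y \<bullet> (Y *v (AZ\<^sup>H *v y)) + y \<bullet> (Z *v (Gn\<^sup>H *v (Gn *v (Z *v y))))
        - y \<bullet> (Y *v (Gn\<^sup>H *v (Gn *v (Z *v y)))) - y \<bullet> (Z *v (Gn\<^sup>H *v (Gn *v (Y *v y))))"
      by (simp add: BB_def N_def matrix_vec_distrib inner_add_right inner_diff_right)
    also have "y \<bullet> (Y *v (AZ\<^sup>H *v y)) = y \<bullet> (AZ *v x)"
      unfolding inner_ctransp[of y Y] Y x_def[symmetric] inner_ctransp[of x "AZ\<^sup>H"] ctransp_ctransp
      by (rule inner_commute)
    also have "y \<bullet> (Z *v (Gn\<^sup>H *v (Gn *v (Z *v y)))) = (Gn *v p) \<bullet> (Gn *v p)"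
      unfolding inner_ctransp[of y Z] Zh p_def[symmetric] inner_ctransp[of p "Gn\<^sup>H"] ctransp_ctransp ..
    also have "y \<bullet> (Y *v (Gn\<^sup>H *v (Gn *v (Z *v y)))) = (Gn *v x) \<bullet> (Gn *v p)"
      unfolding inner_ctransp[of y Y] Y x_def[symmetric] p_def[symmetric]
        inner_ctransp[of x "Gn\<^sup>H"] ctransp_ctransp ..
    also have "y \<bullet> (Z *v (Gn\<^sup>H *v (Gn *v (Y *v y)))) = (Gn *v x) \<bullet> (Gn *v p)"
      unfolding inner_ctransp[of y Z] Zh p_def[symmetric] x_def[symmetric]
        inner_ctransp[of p "Gn\<^sup>H"] ctransp_ctransp by (rule inner_commute)
    finally show ?thesis by (simp add: x_def)
  qed
  \<comment> \<open>Completing the square removes \<open>p\<close>, and with it Z_0: |G_n p|^2 - 2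
    (G_n x) . (G_n p) is at least - |G_n x|^2.\<close>
  moreover have "0 \<le> (Gn *v p - Gn *v x) \<bullet> (Gn *v p - Gn *v x)" by simp
  ultimately have 1: "2 * (y \<bullet> (AZ *v x)) + g \<bullet> g - (Gn *v x) \<bullet> (Gn *v x) \<le> 0"
    by (simp add: inner_diff inner_commute)
  define d where "d = matrix_inv S *v (pCy P *v x)"
  have Gn: "Gn *v x = d" by (simp add: Gn_def G_n_def d_def matrix_vec_distrib)
  have g: "g = S *v c + d" by (simp add: g_def Gp_def G_p_def d_def c_def CK_def matrix_vec_distrib)
  have "(S *v c) \<bullet> (S *v c) = c \<bullet> (Emat P \<epsilon> *v c)"
    unfolding S(2)[symmetric] matrix_vec_distrib(3) inner_ctransp[of c S] Sh ..
  moreover have "(S *v c) \<bullet> d = c \<bullet> (pCy P *v x)"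
  proof -
    have "(S *v c) \<bullet> d = c \<bullet> (S *v d)" unfolding inner_ctransp[of c S] Sh ..
    then show ?thesis by (simp add: d_def matrix_inv_vec[OF Sinv])
  qed
  \<comment> \<open>In the difference of squares the inverse root of E cancels: S S = E gives the
    terms in \<epsilon> and \<open>pDuy\<close>, and S times its inverse leaves the plain product
    with \<open>pCy\<close>. These are the terms that turn A_Z into the controller matrix.\<close>
  ultimately have 2: "g \<bullet> g - (Gn *v x) \<bullet> (Gn *v x)
      = \<epsilon> * (norm c)\<^sup>2 + 2 * (c \<bullet> (pDuy P *v c)) + 2 * (c \<bullet> (pCy P *v x))"
    by (simp add: g Gn E inner_add inner_commute)
  have "y \<bullet> (A_K P J Y *v x) = y \<bullet> (AZ *v x) + y \<bullet> (Y *v (CK\<^sup>H *v (pCy P *v x + pDuy P *v c)))"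
    by (simp add: A_K_def AZ_def A_Z_def CK_def c_def matrix_vec_distrib inner_add_right)
  also have "y \<bullet> (Y *v (CK\<^sup>H *v (pCy P *v x + pDuy P *v c))) = c \<bullet> (pCy P *v x) + c \<bullet> (pDuy P *v c)"
    unfolding inner_ctransp[of y Y] Y x_def[symmetric] inner_ctransp[of x "CK\<^sup>H"] ctransp_ctransp
      c_def[symmetric] inner_add_right ..
  finally have "2 * (y \<bullet> (A_K P J Y *v x)) \<le> - \<epsilon> * (norm c)\<^sup>2"
    using 1 2 by simp
  then show ?thesis by (simp add: x_def c_def CK_def)
qed

text \<open>Pairing (s I - A_K) x with y = Y^(-1) x gives at least \<epsilon>/2 |C_K x|^2 + Re s (y
  . Y y). A kernel vector would make the second term vanish. When (s I - A_K) x is the controller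
  input Y C_K^H v, the pairing equals v . C_K x, that is, input times output, so the controller is
  output strictly passive.\<close>

lemma controller_resolvent:
  assumes P: "plant_class P" and \<epsilon>: "0 < \<epsilon>" and D: "reference_design P \<epsilon> J S Z0 X0 \<Psi> X Y"
    and s: "0 < Re s"
  shows "invertible (mat s - A_K P J Y)"
    and "\<epsilon> / 2 * (norm (Khat0 P J Y s *v v))\<^sup>2 \<le> v \<bullet> (Khat0 P J Y s *v v)"
proof -
  have Yd: "hpd Y" using D by (auto simp: reference_design_def OP2_solution_def OP2_feasible_def)
  then have Yh: "Y\<^sup>H = Y" by (simp add: hpd_def)
  note Yinv = hpd_invertible[OF Yd]
  have key: "\<epsilon> / 2 * (norm (C_K P J *v x))\<^sup>2 + Re s * (y \<bullet> (Y *v y)) \<le> y \<bullet> ((mat s - A_K P J Y) *v x)"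
    if "x = Y *v y" for x y
    using controller_lyapunov[OF P \<epsilon> D, of y] inner_herm_scale[OF Yh, of y s]
    by (simp add: that matrix_vec_distrib inner_diff_right)
  have Ypos: "0 \<le> y \<bullet> (Y *v y)" for y using hpd_inner[OF Yd, of y] by (cases "y = 0") auto
  show inv: "invertible (mat s - A_K P J Y)"
    unfolding invertible_kernel
  proof (intro allI impI)
    fix x assume 0: "(mat s - A_K P J Y) *v x = 0"
    define y where "y = matrix_inv Y *v x"
    have x: "x = Y *v y" by (simp add: y_def matrix_inv_vec[OF Yinv])
    have "0 \<le> \<epsilon> / 2 * (norm (C_K P J *v x))\<^sup>2" using \<epsilon> by simp
    then have "Re s * (y \<bullet> (Y *v y)) \<le> 0"
      using key[OF x] unfolding 0 inner_zero_right by linarith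
    then have "\<not> 0 < y \<bullet> (Y *v y)" using s by (simp add: mult_le_0_iff)
    then have "y = 0" using hpd_inner[OF Yd] by blast
    then show "x = 0" using x by simp
  qed
  define x where "x = matrix_inv (mat s - A_K P J Y) *v (Y *v ((C_K P J)\<^sup>H *v v))"
  define y where "y = matrix_inv Y *v x"
  have x: "x = Y *v y" by (simp add: y_def matrix_inv_vec[OF Yinv])
  have sx: "(mat s - A_K P J Y) *v x = Y *v ((C_K P J)\<^sup>H *v v)"
    unfolding x_def by (rule matrix_inv_vec(1)[OF inv])
  have K: "Khat0 P J Y s *v v = C_K P J *v x"
    by (simp add: Khat0_def Let_def transfer_def A_K_def[symmetric] matrix_vec_distrib(3) matrix_neg_vec
        matrix_vec_neg x_def)
  have "y \<bullet> ((mat s - A_K P J Y) *v x) = (C_K P J *v x) \<bullet> v"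
    unfolding sx inner_ctransp[of y Y] Yh x[symmetric] inner_ctransp[of x "(C_K P J)\<^sup>H"] ctransp_ctransp ..
  moreover have "0 \<le> Re s * (y \<bullet> (Y *v y))" using s Ypos by simp
  ultimately show "\<epsilon> / 2 * (norm (Khat0 P J Y s *v v))\<^sup>2 \<le> v \<bullet> (Khat0 P J Y s *v v)"
    using key[OF x] unfolding K by (simp add: inner_commute)
qed

section \<open>The Youla parametrization\<close>

lemma cont_ext_HinfI:
  "mat_holomorphic_on G ext_disc \<Longrightarrow> cont_ext G \<Longrightarrow> G \<in> Hinf_ext"
  using cont_ext_bounded unfolding Hinf_ext_iff by blast

lemma fir_cont_ext: "cont_ext (fir n Qc)"
  unfolding cont_ext_def
proof (intro exI[of _ "\<lambda>w. \<Sum>k\<le>n. mat (w ^ k) ** Qc k"] conjI allI impI)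
  have "continuous_on (cball 0 1) (\<lambda>w. mat (w ^ k) ** Qc k)" for k
  proof (rule continuous_on_matrix_mult)
    have "continuous_on (cball 0 1) (\<lambda>w::complex. (mat (w ^ k) :: complex^'a^'a) $ i $ j)" for i j
      by (cases "i = j") (auto simp: mat_def intro!: continuous_intros)
    then have "continuous_on (cball 0 1) (\<lambda>w::complex. \<chi> i j. (mat (w ^ k) :: complex^'a^'a) $ i $ j)"
      by (intro continuous_on_vec_lambda)
    then show "continuous_on (cball 0 1) (\<lambda>w::complex. mat (w ^ k) :: complex^'a^'a)" by simp
  qed simp
  then show "continuous_on (cball 0 1) (\<lambda>w. \<Sum>k\<le>n. mat (w ^ k) ** Qc k)"
    by (intro continuous_on_sum)
qed (simp add: fir_def)

lemma fir_Hinf: "fir n Qc \<in> Hinf_ext"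
proof (rule cont_ext_HinfI[OF _ fir_cont_ext])
  have "(\<lambda>q. fir n Qc q $ i $ j) holomorphic_on ext_disc" for i j
    unfolding fir_def sum_component mat_mult_nth by (intro holomorphic_intros) auto
  then show "mat_holomorphic_on (fir n Qc) ext_disc" by (simp add: mat_holomorphic_on_def)
qed

text \<open>The margin multiplies a nonnegative quantity, so it may be lowered.\<close>

lemma interior_pc_mono: "interior_pc F Q d \<Longrightarrow> d' \<le> d \<Longrightarrow> interior_pc F Q d'"
  unfolding interior_pc_def
  by (meson add_nonneg_nonneg mult_right_mono order_trans zero_le_power2)

lemma interior_pc_dilation:
  assumes "interior_pc F Q d" "1 \<le> r"
  shows "interior_pc (\<lambda>q. F (of_real r * q)) (\<lambda>q. Q (of_real r * q)) d"
  using assms norm_scaled_ext_disc unfolding interior_pc_def by blast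

lemma norm_sum4_le:
  fixes a b c d :: "'a::real_normed_vector"
  shows "norm (a + b + c + d) \<le> norm a + norm b + norm c + norm d"
  using norm_triangle_ineq[of "a + b + c" d] norm_triangle_ineq[of "a + b" c] norm_triangle_ineq[of a b]
  by linarith

locale youla_design =
  fixes P :: "('x::finite, 'w::finite, 'u::finite, 'z::finite) plant"
    and \<epsilon> \<tau> :: real
    and F :: "complex \<Rightarrow> complex^'u^'u"
    and J Z0 X0 X Y :: "complex^'x^'x"
    and S \<Psi> :: "complex^'u^'u"
  assumes plant: "plant_class P" and eps: "0 < \<epsilon>" and tau: "0 < \<tau>"
    and factor: "is_factor P \<epsilon> \<tau> F"
    and design: "reference_design P \<epsilon> J S Z0 X0 \<Psi> X Y"
begin

abbreviation "Puy \<equiv> Pt_uy P \<tau>"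
abbreviation "Puz \<equiv> Pt_uz P \<tau>"
abbreviation "Pfy \<equiv> Pt_fy P \<tau>"
abbreviation "Pfz \<equiv> Pt_fz P \<tau>"
abbreviation "Kc \<equiv> Kt0 P \<tau> J Y"
abbreviation "Mc \<equiv> Mt0 P \<tau> J Y"
abbreviation "Nc \<equiv> Nt0 P \<tau> J Y"
abbreviation "Qc0 \<equiv> Qt0 P \<tau> J Y"

lemma Puy: "Puy \<in> Hinf_ext" "cont_ext Puy"
  using plant tau unfolding Pt_uy_def plant_class_def Phat_uy_def
  by (auto intro: tilde_Hinf cont_ext_tilde)

lemma Puz: "Puz \<in> Hinf_ext" "cont_ext Puz"
  using plant tau unfolding Pt_uz_def plant_class_def Phat_uz_def
  by (auto intro: tilde_Hinf cont_ext_tilde)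

lemma Pfy: "Pfy \<in> Hinf_ext" "cont_ext Pfy"
proof -
  have "transfer (pA P) (pBw P) (pCy P) 0 \<in> Hinf_rhp"
    using plant by (auto simp: plant_class_def Phat_wy_def)
  from filtered_tilde[OF this tau] plant show "Pfy \<in> Hinf_ext" "cont_ext Pfy"
    by (simp_all add: Pt_fy_def[abs_def] plant_class_def Phat_wy_def)
qed

lemma Pfz: "Pfz \<in> Hinf_ext"
proof -
  have "transfer (pA P) (pBw P) (pCz P) 0 \<in> Hinf_rhp"
    using plant by (auto simp: plant_class_def Phat_wz_def)
  from filtered_tilde(1)[OF this tau] plant show "Pfz \<in> Hinf_ext"
    by (simp add: Pt_fz_def[abs_def] plant_class_def Phat_wz_def)
qed

lemma F_Hinf: "F \<in> Hinf_ext" and F_cont: "cont_ext F"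
  using factor cont_ext_rational_ext by (auto simp: is_factor_def)

section \<open>Boundedness of the closed loop\<close>

lemma Khat0_transfer:
  "Khat0 P J Y = transfer (A_K P J Y) (- (Y ** (C_K P J)\<^sup>H)) (- C_K P J) 0"
  by (simp add: Khat0_def Let_def A_K_def)

lemma Khat0_output_strict:
  assumes "0 < Re s"
  shows "norm (Khat0 P J Y s *v v) \<le> 2 / \<epsilon> * norm v"
proof -
  let ?w = "Khat0 P J Y s *v v"
  have "\<epsilon> / 2 * (norm ?w)\<^sup>2 \<le> v \<bullet> ?w"
    by (rule controller_resolvent(2)[OF plant eps design assms])
  also have "\<dots> \<le> norm v * norm ?w" by (rule norm_cauchy_schwarz)
  finally have le: "norm ?w * norm ?w \<le> norm ?w * (2 / \<epsilon> * norm v)"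
    using eps by (simp add: field_simps power2_eq_square)
  show ?thesis by (rule norm_le_of_mult_le[OF le]) (use eps in simp)
qed

lemma Khat0_Hinf: "Khat0 P J Y \<in> Hinf_rhp"
proof -
  have hol: "mat_holomorphic_on (\<lambda>s. matrix_inv (mat s - A_K P J Y)) rhp"
    by (intro mat_holomorphic_matrix_inv mat_holomorphic_diff mat_holomorphic_mat
        mat_holomorphic_const holomorphic_intros)
       (use controller_resolvent(1)[OF plant eps design] in simp)
  have "mat_holomorphic_on (Khat0 P J Y) rhp"
    unfolding Khat0_transfer transfer_def[abs_def]
    by (intro mat_holomorphic_add mat_holomorphic_mult mat_holomorphic_const hol)
  moreover have "norm (Khat0 P J Y s) \<le> CARD('u) * CARD('u) * (2 / \<epsilon>)" if "0 < Re s" for s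
    by (rule norm_matrix_le_onorm) (rule Khat0_output_strict[OF that])
  ultimately show ?thesis
    unfolding Hinf_rhp_def bounded_iff by blast
qed

lemma Kc: "Kc \<in> Hinf_ext" "cont_ext Kc"
proof -
  show "Kc \<in> Hinf_ext" unfolding Kt0_def by (rule tilde_Hinf[OF Khat0_Hinf tau])
  show "cont_ext Kc"
    unfolding Kt0_def Khat0_transfer
    by (rule cont_ext_tilde[OF Khat0_Hinf[unfolded Khat0_transfer] tau])
qed

lemma Kc_passive:
  assumes "1 < norm q"
  shows "\<epsilon> / 2 * (norm (Kc q *v v))\<^sup>2 \<le> v \<bullet> (Kc q *v v)"
  unfolding Kt0_def tilde_def
  by (rule controller_resolvent(2)[OF plant eps design bilinear_rhp[OF tau assms]])

text \<open>The passivity theorem for feedback. With w = K x and f = x + P w, output strictness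
  gives \<epsilon>/2 |w|^2 <= x . w = w . f - w . P w, and passivity of the plant drops the last
  term. So |w| <= 2/\<epsilon> |f|, and x = f - P w is bounded as well.\<close>

lemma loop_bound:
  assumes q: "1 < norm q" and M: "0 < M" "norm (Puy q) \<le> M"
  shows "norm x \<le> (1 + M * (2 / \<epsilon>)) * norm ((mat 1 + Puy q ** Kc q) *v x)"
proof -
  define w where "w = Kc q *v x"
  define f where "f = (mat 1 + Puy q ** Kc q) *v x"
  have f: "f = x + Puy q *v w" by (simp add: f_def w_def matrix_vec_distrib)
  have "\<epsilon> / 2 * (norm w)\<^sup>2 \<le> x \<bullet> w" unfolding w_def by (rule Kc_passive[OF q])
  also have "x \<bullet> w = w \<bullet> f - w \<bullet> (Puy q *v w)" by (simp add: f inner_add_right inner_commute)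
  also have "\<dots> \<le> norm w * norm f"
    using Pt_uy_passive[OF plant tau q, of w] norm_cauchy_schwarz[of w f] by linarith
  finally have le: "norm w * norm w \<le> norm w * (2 / \<epsilon> * norm f)"
    using eps by (simp add: field_simps power2_eq_square)
  have w: "norm w \<le> 2 / \<epsilon> * norm f"
    by (rule norm_le_of_mult_le[OF le]) (use eps in simp)
  have "x = f - Puy q *v w" by (simp add: f)
  then have "norm x \<le> norm f + norm (Puy q *v w)" by (metis norm_triangle_ineq4)
  also have "norm (Puy q *v w) \<le> M * norm w" by (rule norm_matrix_vector_le'[OF M(2)])
  also have "\<dots> \<le> M * (2 / \<epsilon> * norm f)" using w M(1) by (intro mult_left_mono) auto
  finally show ?thesis unfolding f_def by (simp add: algebra_simps)
qed

lemma Nc: "Nc \<in> Hinf_ext" "cont_ext Nc"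
  and loop_invertible: "\<And>q. 1 < norm q \<Longrightarrow> invertible (mat 1 + Puy q ** Kc q)"
proof -
  obtain M where M: "0 < M" "\<And>q. 1 < norm q \<Longrightarrow> norm (Puy q) \<le> M"
    using Hinf_ext_bound[OF Puy(1)] by blast
  let ?L = "\<lambda>q. mat 1 + Puy q ** Kc q" and ?c = "1 + M * (2 / \<epsilon>)"
  show inv: "invertible (?L q)" if q: "1 < norm q" for q
    unfolding invertible_kernel
  proof (intro allI impI)
    fix x assume "?L q *v x = 0"
    then show "x = 0" using loop_bound[OF q M(1) M(2)[OF q], of x] by simp
  qed
  have bd: "norm (matrix_inv (?L q)) \<le> CARD('u) * CARD('u) * ?c" if q: "1 < norm q" for q
  proof (rule norm_matrix_le_onorm)
    fix v
    show "norm (matrix_inv (?L q) *v v) \<le> ?c * norm v"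
      using loop_bound[OF q M(1) M(2)[OF q], of "matrix_inv (?L q) *v v"]
      unfolding matrix_inv_vec(1)[OF inv[OF q]] .
  qed
  have L: "?L \<in> Hinf_ext" "cont_ext ?L"
    by (intro Hinf_ext_add Hinf_ext_mult Hinf_ext_const Puy Kc)
       (intro cont_ext_add cont_ext_mult cont_ext_const Puy Kc)
  have eq: "Nc = (\<lambda>q. matrix_inv (?L q))" by (rule ext) (simp add: Nt0_def)
  show c: "cont_ext Nc" unfolding eq by (rule cont_ext_matrix_inv[OF L(2) inv bd])
  show "Nc \<in> Hinf_ext"
    by (rule cont_ext_HinfI[OF _ c])
       (use L(1) inv in \<open>auto simp: eq Hinf_ext_iff intro!: mat_holomorphic_matrix_inv\<close>)
qed

lemma Nc_inverse:
  assumes "1 < norm q"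
  shows "(mat 1 + Puy q ** Kc q) ** Nc q = mat 1" "Nc q ** (mat 1 + Puy q ** Kc q) = mat 1"
  using matrix_inv_inverse[OF loop_invertible[OF assms]] by (simp_all add: Nt0_def)

text \<open>The push-through identity (I + K P)^(-1) = I - K (I + P K)^(-1) P reduces boundedness
  and continuity of \<open>Mc\<close> to those of \<open>Nc\<close>.\<close>

lemma Mc_inverse:
  assumes q: "1 < norm q"
  shows "Mc q = mat 1 - Kc q ** Nc q ** Puy q" "Mc q ** (mat 1 + Kc q ** Puy q) = mat 1"
proof -
  let ?L = "mat 1 + Kc q ** Puy q" and ?R = "mat 1 - Kc q ** Nc q ** Puy q"
  have "Kc q ** ((mat 1 + Puy q ** Kc q) ** Nc q) ** Puy q = Kc q ** Puy q"
    by (simp add: Nc_inverse[OF q])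
  then have "Kc q ** Nc q ** Puy q + Kc q ** Puy q ** Kc q ** Nc q ** Puy q = Kc q ** Puy q"
    by (simp add: matrix_mult_distribs matrix_mul_assoc)
  then have R: "?L ** ?R = mat 1"
    by (simp add: matrix_mult_distribs matrix_mul_assoc algebra_simps)
  show "Mc q = ?R" unfolding Mt0_def by (rule matrix_inv_unique[OF R])
  have "invertible ?L" using R invertible_right_inverse by blast
  then show "Mc q ** ?L = mat 1" by (simp add: Mt0_def matrix_inv_inverse)
qed

lemma Mc: "Mc \<in> Hinf_ext" "cont_ext Mc"
proof -
  let ?R = "\<lambda>q. mat 1 - Kc q ** Nc q ** Puy q"
  have eq: "\<And>q. 1 < norm q \<Longrightarrow> ?R q = Mc q" using Mc_inverse(1) by simp
  \<comment> \<open>Continuity is available for sums and products, so the difference is written with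
    a constant factor -1.\<close>
  have "?R = (\<lambda>q. mat 1 + (mat (- 1) ** Kc q) ** Nc q ** Puy q)"
    by (rule ext) (simp add: vec_eq_iff matrix_mul_assoc[symmetric] mat_mult_nth)
  then have "cont_ext ?R"
    using cont_ext_add[OF cont_ext_const
      cont_ext_mult[OF cont_ext_mult[OF cont_ext_mult[OF cont_ext_const Kc(2)] Nc(2)] Puy(2)]]
    by simp
  then show "cont_ext Mc" by (rule cont_ext_cong[rotated]) (rule eq)
  have "?R \<in> Hinf_ext" by (intro Hinf_ext_diff Hinf_ext_mult Hinf_ext_const Puy Kc Nc)
  then show "Mc \<in> Hinf_ext" by (rule Hinf_ext_cong[rotated]) (rule eq)
qed

lemma Qc0: "Qc0 \<in> Hinf_ext" "cont_ext Qc0"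
proof -
  have "Qc0 = (\<lambda>q. Kc q ** Nc q)" by (rule ext) (simp add: Qt0_def Nt0_def)
  then show "Qc0 \<in> Hinf_ext" "cont_ext Qc0"
    using Hinf_ext_mult[OF Kc(1) Nc(1)] cont_ext_mult[OF Kc(2) Nc(2)] by simp_all
qed

section \<open>Approximation of feasible parameters by finite expansions\<close>

abbreviation "youla \<equiv> OP4_youla P \<tau> J Y"

lemma youla: "youla n Qc \<in> Hinf_ext" "cont_ext (youla n Qc)"
proof -
  have eq: "youla n Qc = (\<lambda>q. Qc0 q + Mc q ** fir n Qc q ** Nc q)"
    by (rule ext) (simp add: OP4_youla_def)
  show "youla n Qc \<in> Hinf_ext" "cont_ext (youla n Qc)"
    unfolding eq
    by (intro Hinf_ext_add Hinf_ext_mult Qc0 Mc Nc fir_Hinf)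
       (intro cont_ext_add cont_ext_mult Qc0 Mc Nc fir_cont_ext)
qed

lemma OP4_feasible_OP3:
  "Qc \<in> OP4_feasible P \<tau> F J Y n \<Longrightarrow> youla n Qc \<in> OP3_feasible F"
  by (simp add: OP4_feasible_def OP3_feasible_def youla)

lemma OP3_feasible_interior:
  "Q \<in> OP3_feasible F \<Longrightarrow> Q \<in> Hinf_ext \<and> interior_pc F Q 0"
  using passivity_imp_interior[OF _ F_Hinf] by (simp add: OP3_feasible_def)

text \<open>Two different comparisons are made. Feasibility compares the approximant uniformly with
  Q(r q), which together with F(r q) still has margin d. The objective compares it with Q(q) in the
  Hardy norm.\<close>

lemma strictly_feasible_approximation:
  assumes Q: "Q \<in> Hinf_ext" and int: "interior_pc F Q d" and d: "0 < d" and e: "0 < e"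
  shows "\<exists>n Qc. Qc \<in> OP4_feasible P \<tau> F J Y n \<and> (h2_norm (\<lambda>q. youla n Qc q - Q q))\<^sup>2 \<le> e"
proof -
  \<comment> \<open>Inverting the affine parametrization: the outer factors are the inverses of
    \<open>Mc\<close> and \<open>Nc\<close>, and all factors are bounded.\<close>
  define Q1 where "Q1 q = (mat 1 + Kc q ** Puy q) ** (Q q - Qc0 q) ** (mat 1 + Puy q ** Kc q)" for q
  have Q1: "Q1 \<in> Hinf_ext"
    unfolding Q1_def[abs_def]
    by (intro Hinf_ext_mult Hinf_ext_add Hinf_ext_diff Hinf_ext_const Kc Puy Q Qc0)
  have Q_eq: "Q q = Qc0 q + Mc q ** Q1 q ** Nc q" if q: "1 < norm q" for q
  proof -
    have "Mc q ** Q1 q ** Nc q = (Mc q ** (mat 1 + Kc q ** Puy q)) ** (Q q - Qc0 q)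
        ** ((mat 1 + Puy q ** Kc q) ** Nc q)"
      unfolding Q1_def by (simp only: matrix_mul_assoc)
    then show ?thesis by (simp add: Nc_inverse[OF q] Mc_inverse(2)[OF q])
  qed
  obtain m where m: "0 < m" "\<And>q. 1 < norm q \<Longrightarrow> norm (Mc q) \<le> m"
    using Hinf_ext_bound[OF Mc(1)] by blast
  obtain c where c: "0 < c" "\<And>q. 1 < norm q \<Longrightarrow> norm (Nc q) \<le> c"
    using Hinf_ext_bound[OF Nc(1)] by blast
  obtain B where B: "0 < B" "\<And>q. 1 < norm q \<Longrightarrow> norm (Q1 q) \<le> B"
    using Hinf_ext_bound[OF Q1] by blast
  \<comment> \<open>The four summands are the factors by which an error \<open>h\<close> enters
    through \<open>Qc0\<close>, the truncation, \<open>Mc\<close> and \<open>Nc\<close>. The summand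
    1 also serves for \<open>F\<close>.\<close>
  define T where "T = 1 + m * c + B * c + m * B"
  have T: "1 \<le> T" using m c B by (simp add: T_def)
  have mc: "0 < (m * c)\<^sup>2" using m c by simp
  \<comment> \<open>The first bound keeps the uniform error below d / 4, the second keeps the Hardy
    error of \<open>Q1\<close> within e / (m c)^2.\<close>
  define h where "h = min (d / (4 * T)) (sqrt (e / (4 * (m * c)\<^sup>2)))"
  have h: "0 < h" using d e T mc by (simp add: h_def)
  have hT: "h * T \<le> d / 4"
  proof -
    have "h * T \<le> d / (4 * T) * T" using T by (intro mult_right_mono) (auto simp: h_def)
    then show ?thesis using T by simp
  qed
  have h2: "h\<^sup>2 \<le> e / (4 * (m * c)\<^sup>2)"
  proof -
    have "h\<^sup>2 \<le> (sqrt (e / (4 * (m * c)\<^sup>2)))\<^sup>2" using h by (intro power_mono) (auto simp: h_def)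
    then show ?thesis using e mc by simp
  qed
  let ?dil = "\<lambda>(G :: complex \<Rightarrow> complex^'u^'u) r1.
    \<forall>r q. 1 \<le> r \<longrightarrow> r < r1 \<longrightarrow> 1 < norm q \<longrightarrow> norm (G (of_real r * q) - G q) < h"
  obtain r1 where r1: "1 < r1" "?dil Qc0 r1"
    using cont_ext_dilation[OF Qc0(2) h] by blast
  obtain r2 where r2: "1 < r2" "?dil Mc r2"
    using cont_ext_dilation[OF Mc(2) h] by blast
  obtain r3 where r3: "1 < r3" "?dil Nc r3"
    using cont_ext_dilation[OF Nc(2) h] by blast
  obtain r4 where r4: "1 < r4" "?dil F r4"
    using cont_ext_dilation[OF F_cont h] by blast
  have e4: "0 < e / (4 * (m * c)\<^sup>2)" using e mc by simp
  obtain r5 where r5: "1 < r5" "\<And>r. 1 < r \<Longrightarrow> r < r5 \<Longrightarrow>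
      (h2_norm (\<lambda>q. Q1 (of_real r * q) - Q1 q))\<^sup>2 \<le> e / (4 * (m * c)\<^sup>2)"
    using dilation_h2_tendsto[OF Q1 e4] by blast
  obtain r where r: "1 < r" "r < min r1 (min r2 (min r3 (min r4 r5)))"
    using dense[of 1 "min r1 (min r2 (min r3 (min r4 r5)))"] r1(1) r2(1) r3(1) r4(1) r5(1) by auto
  obtain n Qc where fir: "\<And>q. 1 < norm q \<Longrightarrow> norm (fir n Qc q - Q1 (of_real r * q)) \<le> h"
    using fir_dilation_uniform[OF Q1 r(1) h] by blast
  have close: "norm (youla n Qc q - Q (of_real r * q)) \<le> d / 4" if q: "1 < norm q" for q
  proof -
    let ?p = "of_real r * q"
    have p: "1 < norm ?p" using norm_scaled_ext_disc[OF _ q] r by simp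
    have dil: "norm (Qc0 q - Qc0 ?p) \<le> h" "norm (Mc q - Mc ?p) \<le> h" "norm (Nc q - Nc ?p) \<le> h"
      using r1(2)[rule_format, of r q] r2(2)[rule_format, of r q] r3(2)[rule_format, of r q] r q
      by (simp_all add: norm_minus_commute less_imp_le)
    \<comment> \<open>Telescoping: one factor at a time is exchanged between q and r q.\<close>
    have eq: "youla n Qc q - Q ?p = (Qc0 q - Qc0 ?p) + Mc q ** (fir n Qc q - Q1 ?p) ** Nc q
        + (Mc q - Mc ?p) ** Q1 ?p ** Nc q + Mc ?p ** Q1 ?p ** (Nc q - Nc ?p)"
      unfolding Q_eq[OF p] OP4_youla_def by (simp add: matrix_mult_distribs)
    have "norm (youla n Qc q - Q ?p) \<le> h + m * h * c + h * B * c + m * B * h"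
      unfolding eq
      by (rule order_trans[OF norm_sum4_le])
         (intro add_mono norm_triple_le m(2)[OF q] m(2)[OF p] c(2)[OF q] B(2)[OF p] fir[OF q] dil)
    also have "\<dots> = h * T" by (simp add: T_def algebra_simps)
    finally show ?thesis using hT by simp
  qed
  have closeF: "norm (F q - F (of_real r * q)) \<le> d / 4" if q: "1 < norm q" for q
  proof -
    have "norm (F q - F (of_real r * q)) \<le> h * 1"
      using r4(2)[rule_format, of r q] r q by (simp add: norm_minus_commute)
    also have "\<dots> \<le> h * T" using h T by (intro mult_left_mono) auto
    finally show ?thesis using hT by simp
  qed
  \<comment> \<open>An error d / 4 in both \<open>Q\<close> and \<open>F\<close> costs 2 (d / 4),
    which leaves half of the margin.\<close>
  have "interior_pc F (youla n Qc) (d - 2 * (d / 4))"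
    by (rule interior_pc_perturb[OF interior_pc_dilation[OF int] close closeF]) (use r in auto)
  then have "interior_pc F (youla n Qc) 0" by (rule interior_pc_mono) (use d in simp)
  then have "passivity_constraint F (youla n Qc)"
    by (rule interior_imp_passivity[OF _ F_cont])
       (simp add: boundary_limit_def cont_ext_radial[OF youla(2)])
  then have feas: "Qc \<in> OP4_feasible P \<tau> F J Y n" by (simp add: OP4_feasible_def)
  have D: "(\<lambda>q. fir n Qc q - Q1 q) \<in> Hinf_ext" by (intro Hinf_ext_diff fir_Hinf Q1)
  have Q1r: "(\<lambda>q. Q1 (of_real r * q)) \<in> Hinf_ext" using Hinf_ext_dilation[OF Q1] r by simp
  have "(h2_norm (\<lambda>q. (fir n Qc q - Q1 (of_real r * q)) + (Q1 (of_real r * q) - Q1 q)))\<^sup>2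
      \<le> (1 + 1) * (h2_norm (\<lambda>q. fir n Qc q - Q1 (of_real r * q)))\<^sup>2
        + (1 + 1 / 1) * (h2_norm (\<lambda>q. Q1 (of_real r * q) - Q1 q))\<^sup>2"
    by (intro h2_norm_sq_add Hinf_ext_diff fir_Hinf Q1 Q1r) simp
  also have "\<dots> \<le> (1 + 1) * h\<^sup>2 + (1 + 1 / 1) * (e / (4 * (m * c)\<^sup>2))"
    using r by (intro add_mono mult_left_mono h2_norm_sq_bound Hinf_ext_diff fir_Hinf Q1r fir r5(2)) auto
  also have "\<dots> \<le> e / (m * c)\<^sup>2" using h2 by simp
  finally have bd: "(h2_norm (\<lambda>q. fir n Qc q - Q1 q))\<^sup>2 \<le> e / (m * c)\<^sup>2" by simp
  have "(h2_norm (\<lambda>q. youla n Qc q - Q q))\<^sup>2 \<le> (m * c)\<^sup>2 * (h2_norm (\<lambda>q. fir n Qc q - Q1 q))\<^sup>2"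
  proof (rule h2_norm_sq_dominated[OF Hinf_ext_diff[OF youla(1) Q] D])
    fix q :: complex assume q: "1 < norm q"
    have "youla n Qc q - Q q = Mc q ** (fir n Qc q - Q1 q) ** Nc q"
      unfolding Q_eq[OF q] OP4_youla_def by (simp add: matrix_mult_distribs)
    also have "norm \<dots> \<le> m * norm (fir n Qc q - Q1 q) * c"
      by (intro norm_triple_le m(2) c(2) q) simp
    finally show "norm (youla n Qc q - Q q) \<le> m * c * norm (fir n Qc q - Q1 q)"
      by (simp add: mult_ac)
  qed
  also have "\<dots> \<le> (m * c)\<^sup>2 * (e / (m * c)\<^sup>2)" using mc bd by (intro mult_left_mono) auto
  also have "\<dots> = e" using mc by simp
  finally show ?thesis using feas by blast
qed

text \<open>The constraint is affine in \<open>Q\<close>, so a convex combination with weight t on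
  the strictly feasible m I has margin t m / 2, while \<open>Q\<close> moves by at most t C.\<close>

lemma feasible_approximation:
  assumes Qf: "Q \<in> OP3_feasible F" and e: "0 < e"
  shows "\<exists>n Qc. Qc \<in> OP4_feasible P \<tau> F J Y n \<and> (h2_norm (\<lambda>q. youla n Qc q - Q q))\<^sup>2 \<le> e"
proof -
  have Q: "Q \<in> Hinf_ext" and int: "interior_pc F Q 0" using OP3_feasible_interior[OF Qf] by auto
  obtain m where m: "0 < m" "\<And>q y. 1 < norm q \<Longrightarrow> m * (norm y)\<^sup>2 \<le> y \<bullet> (F q *v y)"
    using factor_accretive[OF plant eps tau factor] by blast
  obtain B where B: "0 < B" "\<And>q. 1 < norm q \<Longrightarrow> norm (Q q) \<le> B"
    using Hinf_ext_bound[OF Q] by blast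
  define A where "A = (m *\<^sub>R mat 1 :: complex^'u^'u)"
  define C where "C = norm A + B"
  have C: "0 < C" using B by (simp add: C_def add_nonneg_pos)
  define t where "t = min 1 (sqrt (e / 4) / C)"
  have t: "0 < t" "t \<le> 1" using e C by (auto simp: t_def)
  define Qs where "Qs q = (1 - t) *\<^sub>R Q q + t *\<^sub>R A" for q
  have Qs: "Qs \<in> Hinf_ext"
    unfolding Qs_def[abs_def] by (intro Hinf_ext_add Hinf_ext_scaleR Q Hinf_ext_const)
  have "interior_pc F Qs ((1 - t) * 0 + t * (m / 2))"
    unfolding Qs_def[abs_def] A_def
    by (rule interior_pc_convex[OF int interior_pc_scalar[OF m(2) m(1)]]) (use t in auto)
  then have "interior_pc F Qs (t * (m / 2))" by simp
  \<comment> \<open>The squared errors e / 4 of the two stages enter with weight 2 each and add up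
    to e.\<close>
  moreover have "0 < t * (m / 2)" "0 < e / 4" using t m e by auto
  ultimately obtain n Qc where Qc: "Qc \<in> OP4_feasible P \<tau> F J Y n" "(h2_norm (\<lambda>q. youla n Qc q - Qs q))\<^sup>2 \<le> e / 4"
    using strictly_feasible_approximation[OF Qs] by blast
  have "(h2_norm (\<lambda>q. Qs q - Q q))\<^sup>2 \<le> (t * C)\<^sup>2"
  proof (rule h2_norm_sq_bound[OF Hinf_ext_diff[OF Qs Q]])
    fix q :: complex assume q: "1 < norm q"
    have "Qs q - Q q = t *\<^sub>R (A - Q q)" by (simp add: Qs_def algebra_simps)
    also have "norm \<dots> \<le> t * C"
      using t norm_triangle_ineq4[of A "Q q"] B(2)[OF q] by (auto simp: C_def intro!: mult_left_mono)
    finally show "norm (Qs q - Q q) \<le> t * C" .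
  qed
  also have "\<dots> \<le> e / 4"
  proof -
    have "t * C \<le> sqrt (e / 4)" using C by (simp add: t_def min_def field_simps)
    then have "(t * C)\<^sup>2 \<le> (sqrt (e / 4))\<^sup>2" using t C by (intro power_mono) auto
    then show ?thesis using e by simp
  qed
  finally have 2: "(h2_norm (\<lambda>q. Qs q - Q q))\<^sup>2 \<le> e / 4" .
  have "(h2_norm (\<lambda>q. (youla n Qc q - Qs q) + (Qs q - Q q)))\<^sup>2
      \<le> (1 + 1) * (h2_norm (\<lambda>q. youla n Qc q - Qs q))\<^sup>2 + (1 + 1 / 1) * (h2_norm (\<lambda>q. Qs q - Q q))\<^sup>2"
    by (intro h2_norm_sq_add Hinf_ext_diff youla Qs Q) simp
  then show ?thesis using Qc 2 by (intro exI[of _ n] exI[of _ Qc]) simp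
qed

section \<open>Objective and optimal values\<close>

definition resid :: "(complex \<Rightarrow> complex^'u^'u) \<Rightarrow> complex \<Rightarrow> complex^'w^'z"
  where "resid Q q = Pfz q - Puz q ** Q q ** Pfy q"

lemma resid_Hinf: "Q \<in> Hinf_ext \<Longrightarrow> resid Q \<in> Hinf_ext"
  unfolding resid_def[abs_def] by (intro Hinf_ext_diff Hinf_ext_mult Pfz Puz Pfy)

lemma objective_resid: "objective P \<tau> Q = 1 / \<tau> * (h2_norm (resid Q))\<^sup>2"
  by (simp add: objective_def resid_def[abs_def])

lemma objective_nonneg: "0 \<le> objective P \<tau> Q"
  using tau by (simp add: objective_def)

lemma objective_continuous:
  assumes Q: "Q \<in> Hinf_ext" and e: "0 < e"
  shows "\<exists>d>0. \<forall>Q'\<in>Hinf_ext. (h2_norm (\<lambda>q. Q' q - Q q))\<^sup>2 \<le> d \<longrightarrow>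
    objective P \<tau> Q' \<le> objective P \<tau> Q + e"
proof -
  have et: "0 < \<tau> * e" using e tau by simp
  obtain d where d: "0 < d" "\<And>H. H \<in> Hinf_ext \<Longrightarrow> (h2_norm H)\<^sup>2 \<le> d \<Longrightarrow>
      (h2_norm (\<lambda>q. resid Q q + H q))\<^sup>2 \<le> (h2_norm (resid Q))\<^sup>2 + \<tau> * e"
    using h2_norm_sq_perturbation[OF resid_Hinf[OF Q] et] by blast
  obtain a where a: "0 < a" "\<And>q. 1 < norm q \<Longrightarrow> norm (Puz q) \<le> a"
    using Hinf_ext_bound[OF Puz(1)] by blast
  obtain b where b: "0 < b" "\<And>q. 1 < norm q \<Longrightarrow> norm (Pfy q) \<le> b"
    using Hinf_ext_bound[OF Pfy(1)] by blast
  have ab: "0 < (a * b)\<^sup>2" using a b by simp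
  show ?thesis
  proof (intro exI[of _ "d / (a * b)\<^sup>2"] conjI ballI impI)
    show "0 < d / (a * b)\<^sup>2" using d ab by simp
    fix Q' :: "complex \<Rightarrow> complex^'u^'u"
    assume Q': "Q' \<in> Hinf_ext" and close: "(h2_norm (\<lambda>q. Q' q - Q q))\<^sup>2 \<le> d / (a * b)\<^sup>2"
    let ?H = "\<lambda>q. Puz q ** (Q q - Q' q) ** Pfy q"
    have H: "?H \<in> Hinf_ext" by (intro Hinf_ext_mult Hinf_ext_diff Puz Pfy Q Q')
    have "(h2_norm ?H)\<^sup>2 \<le> (a * b)\<^sup>2 * (h2_norm (\<lambda>q. Q' q - Q q))\<^sup>2"
    proof (rule h2_norm_sq_dominated[OF H Hinf_ext_diff[OF Q' Q]])
      fix q :: complex assume q: "1 < norm q"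
      have "norm (?H q) \<le> a * norm (Q q - Q' q) * b"
        by (intro norm_triple_le a(2) b(2) q) simp
      then show "norm (?H q) \<le> a * b * norm (Q' q - Q q)" by (simp add: norm_minus_commute mult_ac)
    qed
    also have "\<dots> \<le> d"
      using close ab by (simp add: pos_le_divide_eq mult.commute)
    finally have "(h2_norm (\<lambda>q. resid Q q + ?H q))\<^sup>2 \<le> (h2_norm (resid Q))\<^sup>2 + \<tau> * e"
      by (rule d(2)[OF H])
    moreover have "(\<lambda>q. resid Q q + ?H q) = resid Q'"
      by (rule ext) (simp add: resid_def matrix_mult_distribs)
    ultimately have "1 / \<tau> * (h2_norm (resid Q'))\<^sup>2 \<le> 1 / \<tau> * ((h2_norm (resid Q))\<^sup>2 + \<tau> * e)"
      using tau by (intro mult_left_mono) auto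
    then show "objective P \<tau> Q' \<le> objective P \<tau> Q + e"
      using tau by (simp add: objective_resid distrib_left)
  qed
qed

text \<open>Padding with zero coefficients embeds the problem of order m into that of order n. Both
  monotonicity and the upper estimate of the limit rest on this.\<close>

lemma OP4_value_le:
  assumes "Qc \<in> OP4_feasible P \<tau> F J Y m" "m \<le> n"
  shows "OP4_value P \<tau> F J Y n \<le> objective P \<tau> (youla m Qc)"
proof -
  \<comment> \<open>Order m leaves the entries beyond m arbitrary; they have to be cut off before
    order n reads them.\<close>
  define Qc' where "Qc' k = (if k \<le> m then Qc k else 0)" for k
  have "fir n Qc' = fir m Qc"
  proof
    fix q
    have "fir n Qc' q = (\<Sum>k\<le>m. mat (inverse q ^ k) ** Qc' k)"
      unfolding fir_def using assms(2)
      by (intro sum.mono_neutral_right) (auto simp: Qc'_def vec_eq_iff mat_mult_nth)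
    then show "fir n Qc' q = fir m Qc q" by (simp add: fir_def Qc'_def)
  qed
  then have eq: "youla n Qc' = youla m Qc" by (intro ext) (simp add: OP4_youla_def)
  have "Qc' \<in> OP4_feasible P \<tau> F J Y n" using assms(1) by (simp add: OP4_feasible_def eq)
  then have "OP4_value P \<tau> F J Y n \<le> objective P \<tau> (youla n Qc')"
    unfolding OP4_value_def
    by (intro cINF_lower bdd_belowI2[where m = 0] objective_nonneg)
  then show ?thesis by (simp add: eq)
qed

lemma OP3_value_le: "Q \<in> OP3_feasible F \<Longrightarrow> OP3_value P \<tau> F \<le> objective P \<tau> Q"
  unfolding OP3_value_def by (intro cINF_lower bdd_belowI2[where m = 0] objective_nonneg)

lemma OP3_value_solution:
  assumes "OP3_solution P \<tau> F Q"
  shows "OP3_value P \<tau> F = objective P \<tau> Q"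
proof (rule antisym)
  show "OP3_value P \<tau> F \<le> objective P \<tau> Q"
    using assms by (intro OP3_value_le) (simp add: OP3_solution_def)
  show "objective P \<tau> Q \<le> OP3_value P \<tau> F"
    unfolding OP3_value_def using assms by (intro cINF_greatest) (auto simp: OP3_solution_def)
qed

lemma OP4_value_solution:
  assumes "OP4_solution P \<tau> F J Y n Qc"
  shows "OP4_value P \<tau> F J Y n = objective P \<tau> (youla n Qc)"
proof (rule antisym)
  show "OP4_value P \<tau> F J Y n \<le> objective P \<tau> (youla n Qc)"
    using assms by (intro OP4_value_le) (auto simp: OP4_solution_def)
  show "objective P \<tau> (youla n Qc) \<le> OP4_value P \<tau> F J Y n"
    unfolding OP4_value_def using assms by (intro cINF_greatest) (auto simp: OP4_solution_def)
qed

lemma OP4_value_antimono: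
  assumes "OP4_solution P \<tau> F J Y m Qc" "m \<le> n"
  shows "OP4_value P \<tau> F J Y n \<le> OP4_value P \<tau> F J Y m"
  unfolding OP4_value_solution[OF assms(1)]
  using assms by (intro OP4_value_le) (auto simp: OP4_solution_def)

text \<open>From below, every feasible point of OP4 is feasible for OP3. From above, one finite
  expansion close to the optimum bounds the values of all larger orders.\<close>

lemma OP4_value_tendsto:
  assumes opt: "OP3_solution P \<tau> F Q"
    and sol: "\<And>n. 0 < n \<Longrightarrow> OP4_solution P \<tau> F J Y n (Qs n)"
  shows "(\<lambda>n. OP4_value P \<tau> F J Y n) \<longlonglongrightarrow> OP3_value P \<tau> F"
proof (rule LIMSEQ_I)
  fix e :: real assume e: "0 < e"
  have Qf: "Q \<in> OP3_feasible F" using opt by (simp add: OP3_solution_def)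
  then have Q: "Q \<in> Hinf_ext" using OP3_feasible_interior by blast
  obtain d where d: "0 < d" "\<And>Q'. Q' \<in> Hinf_ext \<Longrightarrow> (h2_norm (\<lambda>q. Q' q - Q q))\<^sup>2 \<le> d \<Longrightarrow>
      objective P \<tau> Q' \<le> objective P \<tau> Q + e / 2"
    using objective_continuous[OF Q, of "e / 2"] e by auto
  obtain N Qc where Qc: "Qc \<in> OP4_feasible P \<tau> F J Y N" "(h2_norm (\<lambda>q. youla N Qc q - Q q))\<^sup>2 \<le> d"
    using feasible_approximation[OF Qf d(1)] by blast
  show "\<exists>no. \<forall>n\<ge>no. norm (OP4_value P \<tau> F J Y n - OP3_value P \<tau> F) < e"
  \<comment> \<open>The successor makes n positive, as the assumed solutions exist only for such
    n.\<close>
  proof (intro exI[of _ "Suc N"] allI impI)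
    fix n assume n: "Suc N \<le> n"
    have "OP4_value P \<tau> F J Y n \<le> objective P \<tau> (youla N Qc)"
      using n by (intro OP4_value_le[OF Qc(1)]) simp
    also have "\<dots> \<le> OP3_value P \<tau> F + e / 2"
      unfolding OP3_value_solution[OF opt] by (rule d(2)[OF youla(1) Qc(2)])
    finally have "OP4_value P \<tau> F J Y n \<le> OP3_value P \<tau> F + e / 2" .
    moreover have "OP3_value P \<tau> F \<le> OP4_value P \<tau> F J Y n"
      using sol[of n] n OP4_value_solution[of n "Qs n"] OP3_value_le[OF OP4_feasible_OP3[of "Qs n" n]]
      by (simp add: OP4_solution_def)
    ultimately show "norm (OP4_value P \<tau> F J Y n - OP3_value P \<tau> F) < e" using e by simp
  qed
qed

end

section \<open>Convergence of the Youla parameters\<close>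

definition adjugate :: "complex^'n^'n \<Rightarrow> complex^'n^'n"
  where "adjugate A = (\<chi> i j. cofac A i j)"

lemma det_mult_matrix_inv:
  assumes "invertible A"
  shows "mat (det A) ** matrix_inv A = adjugate A"
  using assms
  by (simp add: vec_eq_iff mat_mult_nth matrix_inv_cramer adjugate_def invertible_det_nz)

text \<open>Multiplying Z D W by adj(A) Z^H on the left and by W^H adj(B) on the right gives det A
  det B D. Adjugates in place of inverses keep every factor continuous, and the inequality trivial,
  where a Gram matrix is singular.\<close>

lemma sandwich_lower_bound:
  fixes Z :: "complex^'u^'z" and W :: "complex^'w^'u" and D :: "complex^'u^'u"
  defines "A \<equiv> Z\<^sup>H ** Z" and "B \<equiv> W ** W\<^sup>H"
  shows "cmod (det A * det B) * norm D
    \<le> norm (adjugate A ** Z\<^sup>H) * norm (W\<^sup>H ** adjugate B) * norm (Z ** D ** W)"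
proof (cases "det A * det B = 0")
  case False
  then have A: "invertible A" and B: "invertible B" by (simp_all add: invertible_det_nz)
  have "(adjugate A ** Z\<^sup>H) ** (Z ** D ** W) ** (W\<^sup>H ** adjugate B) = adjugate A ** A ** D ** (B ** adjugate B)"
    by (simp add: A_def B_def matrix_mul_assoc)
  also have "adjugate A ** A = mat (det A)"
    unfolding det_mult_matrix_inv[OF A, symmetric]
    by (simp add: matrix_mul_assoc[symmetric] matrix_inv_inverse[OF A])
  also have "B ** adjugate B = mat (det B)"
    unfolding det_mult_matrix_inv[OF B, symmetric]
    by (metis B mat_mult_commute matrix_inv_inverse(1) matrix_mul_assoc matrix_mul_lid)
  also have "mat (det A) ** D ** mat (det B) = mat (det A * det B) ** D"
    unfolding mat_mult_commute[of _ "det B"] by (simp add: matrix_mul_assoc mat_mult_mat mult.commute)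
  finally have "cmod (det A * det B) * norm D
      = norm ((adjugate A ** Z\<^sup>H) ** (Z ** D ** W) ** (W\<^sup>H ** adjugate B))"
    by (simp only: norm_mat_mult)
  also have "\<dots> \<le> norm (adjugate A ** Z\<^sup>H) * norm (Z ** D ** W) * norm (W\<^sup>H ** adjugate B)"
    by (rule norm_triple_le) simp_all
  finally show ?thesis by (simp only: mult_ac)
next
  case True
  then show ?thesis by (simp only: norm_zero mult_zero_left) (intro mult_nonneg_nonneg norm_ge_zero)
qed

lemma continuous_on_adjugate [continuous_intros]:
  fixes f :: "'a::topological_space \<Rightarrow> complex^'n^'n"
  assumes "continuous_on S f"
  shows "continuous_on S (\<lambda>x. adjugate (f x))"
  unfolding adjugate_def by (intro continuous_on_vec_lambda continuous_intros assms)

lemma boundary_limit_unique: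
  assumes "boundary_limit G \<Omega> L" "continuous_on (cball 0 1) g" "\<And>q. 1 < norm q \<Longrightarrow> G q = g (inverse q)"
  shows "L = g (cis (- \<Omega>))"
proof -
  have "eventually (\<lambda>r. g (inverse (of_real r * cis \<Omega>)) = G (of_real r * cis \<Omega>)) (at_right (1::real))"
    by (rule eventually_radial) (simp add: assms(3))
  from Lim_transform_eventually[OF tendsto_radial[OF assms(2)] this] assms(1) show ?thesis
    unfolding boundary_limit_def by (intro tendsto_unique[OF trivial_limit_at_right_real])
qed

text \<open>The map \<open>D \<mapsto> Z D W\<close> has no uniform lower bound near frequencies where \<open>Z\<close> or \<open>W\<close>
  degenerates. Those frequencies carry little mass when \<open>D\<close> is bounded: with \<open>g\<close> the product
  of the two Gram determinants, split the unit as \<open>t + (1 - t)\<close>, \<open>t = \<bar>g\<bar>\<^sup>2 / \<eta>\<^sup>2\<close>.\<close>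
lemma sandwich_coercive:
  fixes Z :: "complex \<Rightarrow> complex^'u^'z" and W :: "complex \<Rightarrow> complex^'w^'u"
  assumes Z: "Z \<in> Hinf_ext" "cont_ext Z" and W: "W \<in> Hinf_ext" "cont_ext W"
    and N: "negligible N"
    and reg: "\<And>\<Omega>. \<Omega> \<in> {-pi..pi} \<Longrightarrow> \<Omega> \<notin> N \<Longrightarrow> \<exists>V U. boundary_limit Z \<Omega> V \<and> boundary_limit W \<Omega> U
      \<and> hpd (V\<^sup>H ** V) \<and> hpd (U ** U\<^sup>H)"
    and B: "0 < B" and e: "0 < e"
  shows "\<exists>\<delta>>0. \<forall>D\<in>Hinf_ext. (\<forall>q. 1 < norm q \<longrightarrow> norm (D q) \<le> B) \<longrightarrow>
    (h2_norm (\<lambda>q. Z q ** D q ** W q))\<^sup>2 \<le> \<delta> \<longrightarrow> (h2_norm D)\<^sup>2 \<le> e"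
proof -
  obtain z where z: "continuous_on (cball 0 1) z" "\<And>q. 1 < norm q \<Longrightarrow> Z q = z (inverse q)"
    using Z(2) unfolding cont_ext_def by blast
  obtain w where w: "continuous_on (cball 0 1) w" "\<And>q. 1 < norm q \<Longrightarrow> W q = w (inverse q)"
    using W(2) unfolding cont_ext_def by blast
  define g where "g x = cmod (det ((z x)\<^sup>H ** z x) * det (w x ** (w x)\<^sup>H))" for x
  define k where "k x = norm (adjugate ((z x)\<^sup>H ** z x) ** (z x)\<^sup>H)
    * norm ((w x)\<^sup>H ** adjugate (w x ** (w x)\<^sup>H))" for x
  have cg: "continuous_on (cball 0 1) g" and ck: "continuous_on (cball 0 1) k"
    unfolding g_def k_def by (intro continuous_intros z w)+
  have "bounded (k ` cball 0 1)"
    using compact_continuous_image[OF ck] by (simp add: compact_imp_bounded)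
  then obtain C0 where "\<forall>y\<in>k ` cball 0 1. norm y \<le> C0"
    by (auto simp: bounded_iff)
  then have C0: "k x \<le> C0" if "x \<in> cball 0 1" for x
    using that by (force intro: order_trans[OF abs_ge_self])
  define C where "C = max 1 C0"
  have C: "0 < C" "\<And>x. x \<in> cball 0 1 \<Longrightarrow> k x \<le> C"
    using C0 by (auto simp: C_def le_max_iff_disj)
  \<comment> \<open>The weight 1 - t, clipped at 0: for positive \<eta> it is nonzero only where
    \<open>g\<close> is below \<eta>.\<close>
  define \<psi> where "\<psi> \<eta> x = max 0 (1 - (g x)\<^sup>2 / \<eta>\<^sup>2)" for \<eta> x
  let ?f = "\<lambda>\<eta> b \<Omega>. \<psi> \<eta> (of_real (exp (- b)) * cis (- \<Omega>))"
  define I where "I \<eta> b = integral (cbox (-pi) pi) (?f \<eta> b)" for \<eta> b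
  have c\<psi>: "continuous_on ({0..1} \<times> cbox (-pi) pi) (\<lambda>(b, \<Omega>). ?f \<eta> b \<Omega>)" for \<eta>
  proof -
    have "continuous_on (cball 0 1) (\<psi> \<eta>)"
      unfolding \<psi>_def divide_inverse by (intro continuous_intros cg)
    then have "continuous_on ({0..1} \<times> cbox (-pi) pi) (\<lambda>x. \<psi> \<eta> (of_real (exp (- fst x)) * cis (- snd x)))"
      by (rule continuous_on_compose2) (auto intro!: continuous_intros simp: norm_mult)
    then show ?thesis by (simp add: case_prod_unfold)
  qed
  \<comment> \<open>For fixed \<eta> the mass of the degenerate set on circles tends to its mass on
    the unit circle, so \<eta> can be chosen from the boundary alone.\<close>
  have Icont: "(I \<eta> \<longlongrightarrow> I \<eta> 0) (at_right 0)" for \<eta>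
  proof -
    have "continuous_on {0..1} (I \<eta>)"
      unfolding I_def by (rule integral_continuous_on_param[OF c\<psi>])
    then show ?thesis by (rule continuous_on_Icc_at_rightD) simp
  qed
  have int\<psi>: "(?f \<eta> b) integrable_on {-pi..pi}" if "0 \<le> b" "b \<le> 1" for \<eta> b
  proof (rule integrable_continuous_real)
    show "continuous_on {-pi..pi} (?f \<eta> b)"
      by (rule continuous_on_compose2[OF c\<psi>[of \<eta>], of _ "\<lambda>\<Omega>. (b, \<Omega>)", simplified])
         (use that in \<open>auto intro!: continuous_intros\<close>)
  qed
  \<comment> \<open>At a regular frequency \<open>g\<close> is positive, so \<psi> vanishes as soon
    as 1 / (n + 1) falls below \<open>g\<close>; dominated convergence does the rest.\<close>
  have Ilim: "(\<lambda>n. I (1 / real (Suc n)) 0) \<longlonglongrightarrow> 0"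
  proof -
    define f where "f n \<Omega> = (if \<Omega> \<in> N then 0 else \<psi> (1 / real (Suc n)) (cis (- \<Omega>)))" for n \<Omega>
    have int: "(\<lambda>\<Omega>. \<psi> (1 / real (Suc n)) (cis (- \<Omega>))) integrable_on {-pi..pi}" for n
      using int\<psi>[of 0] by simp
    have fi: "f n integrable_on {-pi..pi}" for n
      by (rule integrable_spike[OF int[of n] N]) (simp add: f_def)
    have If: "I (1 / real (Suc n)) 0 = integral {-pi..pi} (f n)" for n
      unfolding I_def cbox_interval by (rule integral_spike[OF N]) (simp add: f_def)
    have "(\<lambda>n. integral {-pi..pi} (f n)) \<longlonglongrightarrow> integral {-pi..pi} (\<lambda>_. 0 :: real)"
    proof (rule dominated_convergence(2)[where h = "\<lambda>_. 1"])
      show "norm (f n \<Omega>) \<le> 1" for n \<Omega> by (simp add: f_def \<psi>_def)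
      fix \<Omega> assume \<Omega>: "\<Omega> \<in> {-pi..pi}"
      show "(\<lambda>n. f n \<Omega>) \<longlonglongrightarrow> 0"
      proof (cases "\<Omega> \<in> N")
        case False
        obtain V U where VU: "boundary_limit Z \<Omega> V" "boundary_limit W \<Omega> U" "hpd (V\<^sup>H ** V)" "hpd (U ** U\<^sup>H)"
          using reg[OF \<Omega> False] by blast
        have "V = z (cis (- \<Omega>))" by (rule boundary_limit_unique[OF VU(1) z])
        moreover have "U = w (cis (- \<Omega>))" by (rule boundary_limit_unique[OF VU(2) w])
        ultimately have gpos: "0 < g (cis (- \<Omega>))"
          using hpd_invertible[OF VU(3)] hpd_invertible[OF VU(4)] by (simp add: g_def invertible_det_nz)
        obtain n0 where n0: "inverse (real (Suc n0)) < g (cis (- \<Omega>))"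
          using reals_Archimedean[OF gpos] by blast
        have "f n \<Omega> = 0" if n: "n0 \<le> n" for n
        proof -
          have "1 / real (Suc n) \<le> 1 / real (Suc n0)" using n by (intro divide_left_mono) auto
          also have "\<dots> < g (cis (- \<Omega>))" using n0 by (simp add: inverse_eq_divide)
          finally have "(1 / real (Suc n))\<^sup>2 \<le> (g (cis (- \<Omega>)))\<^sup>2"
            by (intro power_mono) auto
          then have "1 \<le> (g (cis (- \<Omega>)))\<^sup>2 / (1 / real (Suc n))\<^sup>2"
            by (subst le_divide_eq_1_pos) auto
          then show ?thesis using False unfolding f_def \<psi>_def by simp
        qed
        then have "eventually (\<lambda>n. f n \<Omega> = 0) sequentially"
          unfolding eventually_sequentially by blast
        then show ?thesis by (rule tendsto_eventually)
      qed (simp add: f_def)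
    qed (use fi in auto)
    then show ?thesis by (simp only: If integral_0)
  qed
  have B2: "0 < B\<^sup>2 / (2 * pi)" using B by simp
  have "0 < e / 2 / (B\<^sup>2 / (2 * pi))" using B2 e by (intro divide_pos_pos) auto
  \<comment> \<open>\<eta> is fixed so that the degenerate frequencies contribute at most e / 2; the
    other half is for the image of \<open>D\<close>.\<close>
  then obtain n where n: "I (1 / real (Suc n)) 0 < e / 2 / (B\<^sup>2 / (2 * pi))"
    using order_tendstoD(2)[OF Ilim] unfolding eventually_sequentially by blast
  define \<eta> where "\<eta> = 1 / real (Suc n)"
  have \<eta>: "0 < \<eta>" by (simp add: \<eta>_def)
  have small: "B\<^sup>2 / (2 * pi) * I \<eta> 0 \<le> e / 2"
    using n B2 unfolding \<eta>_def by (simp only: pos_less_divide_eq mult.commute less_imp_le)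
  have C\<eta>: "0 < (C / \<eta>)\<^sup>2" using C \<eta> by simp
  show ?thesis
  proof (intro exI[of _ "e / 2 / (C / \<eta>)\<^sup>2"] conjI ballI impI)
    show "0 < e / 2 / (C / \<eta>)\<^sup>2" using e C\<eta> by (intro divide_pos_pos) auto
    fix D :: "complex \<Rightarrow> complex^'u^'u"
    assume D: "D \<in> Hinf_ext" and DB: "\<forall>q. 1 < norm q \<longrightarrow> norm (D q) \<le> B"
      and close: "(h2_norm (\<lambda>q. Z q ** D q ** W q))\<^sup>2 \<le> e / 2 / (C / \<eta>)\<^sup>2"
    let ?E = "\<lambda>q. Z q ** D q ** W q"
    have E: "?E \<in> Hinf_ext" by (intro Hinf_ext_mult Z W D)
    \<comment> \<open>The share t of |D|^2 is controlled by the sandwich bound and the share 1 - t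
      by the bound \<open>B\<close>.\<close>
    have pw: "(norm (D q))\<^sup>2 \<le> (C / \<eta>)\<^sup>2 * (norm (?E q))\<^sup>2 + B\<^sup>2 * \<psi> \<eta> (inverse q)" if q: "1 < norm q" for q
    proof -
      let ?x = "inverse q" and ?t = "(g (inverse q))\<^sup>2 / \<eta>\<^sup>2"
      have "g ?x * norm (D q) \<le> k ?x * norm (?E q)"
        using sandwich_lower_bound[of "Z q" "W q" "D q"] unfolding g_def k_def z(2)[OF q] w(2)[OF q] .
      also have "\<dots> \<le> C * norm (?E q)"
        by (intro mult_right_mono C(2) inverse_ext_disc(1)[OF q]) simp
      finally have "(g ?x * norm (D q) / \<eta>)\<^sup>2 \<le> (C * norm (?E q) / \<eta>)\<^sup>2"
        using \<eta> by (intro power_mono divide_right_mono) (auto simp: g_def)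
      then have 1: "?t * (norm (D q))\<^sup>2 \<le> (C / \<eta>)\<^sup>2 * (norm (?E q))\<^sup>2"
        by (simp add: power_mult_distrib power_divide)
      have "(1 - ?t) * (norm (D q))\<^sup>2 \<le> \<psi> \<eta> ?x * (norm (D q))\<^sup>2"
        by (intro mult_right_mono) (auto simp: \<psi>_def)
      also have "\<dots> \<le> \<psi> \<eta> ?x * B\<^sup>2"
        using DB q by (intro mult_left_mono power_mono) (auto simp: \<psi>_def)
      also have "\<dots> = B\<^sup>2 * \<psi> \<eta> ?x" by (rule mult.commute)
      finally have 2: "(1 - ?t) * (norm (D q))\<^sup>2 \<le> B\<^sup>2 * \<psi> \<eta> ?x" .
      have "?t * (norm (D q))\<^sup>2 + (1 - ?t) * (norm (D q))\<^sup>2 = (norm (D q))\<^sup>2"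
        by (simp only: distrib_right[symmetric]) simp
      then show ?thesis using 1 2 by linarith
    qed
    have mean: "h2_mean D b \<le> (C / \<eta>)\<^sup>2 * h2_mean ?E b + B\<^sup>2 / (2 * pi) * I \<eta> b" if b: "0 < b" "b < 1" for b
    proof -
      have i1: "(\<lambda>\<Omega>. (C / \<eta>)\<^sup>2 * (norm (?E (circ b \<Omega>)))\<^sup>2) integrable_on {-pi..pi}"
        by (intro integrable_on_mult_right h2_integrable E b)
      have i2: "(\<lambda>\<Omega>. B\<^sup>2 * \<psi> \<eta> (inverse (circ b \<Omega>))) integrable_on {-pi..pi}"
        unfolding inverse_circ using b by (intro integrable_on_mult_right int\<psi>) auto
      have "h2_mean D b \<le> 1 / (2 * pi) * integral {-pi..pi}
          (\<lambda>\<Omega>. (C / \<eta>)\<^sup>2 * (norm (?E (circ b \<Omega>)))\<^sup>2 + B\<^sup>2 * \<psi> \<eta> (inverse (circ b \<Omega>)))"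
        using b by (intro h2_mean_mono[OF D b(1)] integrable_add i1 i2 pw) simp
      also have "integral {-pi..pi} (\<lambda>\<Omega>. (C / \<eta>)\<^sup>2 * (norm (?E (circ b \<Omega>)))\<^sup>2 + B\<^sup>2 * \<psi> \<eta> (inverse (circ b \<Omega>)))
          = (C / \<eta>)\<^sup>2 * integral {-pi..pi} (\<lambda>\<Omega>. (norm (?E (circ b \<Omega>)))\<^sup>2) + B\<^sup>2 * I \<eta> b"
        by (subst integral_add[OF i1 i2]) (simp only: integral_mult_right I_def inverse_circ cbox_interval)
      finally show ?thesis
        unfolding h2_mean_eq[of ?E] by (simp only: distrib_left mult_ac times_divide_eq_right times_divide_eq_left mult_1)
    qed
    have "(h2_norm D)\<^sup>2 \<le> (C / \<eta>)\<^sup>2 * (h2_norm ?E)\<^sup>2 + B\<^sup>2 / (2 * pi) * I \<eta> 0"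
    proof (rule tendsto_le[OF trivial_limit_at_right_real])
      show "(h2_mean D \<longlongrightarrow> (h2_norm D)\<^sup>2) (at_right 0)" by (rule h2_mean_tendsto[OF D])
      show "((\<lambda>b. (C / \<eta>)\<^sup>2 * h2_mean ?E b + B\<^sup>2 / (2 * pi) * I \<eta> b) \<longlongrightarrow>
          (C / \<eta>)\<^sup>2 * (h2_norm ?E)\<^sup>2 + B\<^sup>2 / (2 * pi) * I \<eta> 0) (at_right 0)"
        by (intro tendsto_add tendsto_mult tendsto_const h2_mean_tendsto E Icont)
      show "eventually (\<lambda>b. h2_mean D b \<le> (C / \<eta>)\<^sup>2 * h2_mean ?E b + B\<^sup>2 / (2 * pi) * I \<eta> b) (at_right 0)"
        unfolding eventually_at_right_field by (rule exI[of _ 1]) (use mean in auto)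
    qed
    moreover have "(C / \<eta>)\<^sup>2 * (h2_norm ?E)\<^sup>2 \<le> e / 2"
      using close C\<eta> by (simp only: pos_le_divide_eq mult.commute)
    ultimately show "(h2_norm D)\<^sup>2 \<le> e" using small by linarith
  qed
qed

context youla_design
begin

text \<open>Besides convexity of the inequality, the midpoint needs boundary values almost
  everywhere; they are read off from the upper left block of the two given limits. The weight 1 -
  1/2 matches \<open>interior_pc_convex\<close>.\<close>

lemma OP3_feasible_midpoint:
  assumes "Q \<in> OP3_feasible F" "Q' \<in> OP3_feasible F"
  shows "(\<lambda>q. (1 - 1 / 2) *\<^sub>R Q q + (1 / 2) *\<^sub>R Q' q) \<in> OP3_feasible F"
proof -
  note Q = OP3_feasible_interior[OF assms(1)] and Q' = OP3_feasible_interior[OF assms(2)]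
  let ?R = "\<lambda>q. (1 - 1 / 2 :: real) *\<^sub>R Q q + (1 / 2 :: real) *\<^sub>R Q' q"
  have lim: "AE \<Omega> in lebesgue_on {-pi..pi}. \<exists>L. boundary_limit G \<Omega> L" if "G \<in> OP3_feasible F" for G
  proof -
    have "AE \<Omega> in lebesgue_on {-pi..pi}. \<exists>L. boundary_limit (\<lambda>q. block2 (G q) (G q) 0 (F q)) \<Omega> L"
      using that by (simp add: OP3_feasible_def passivity_constraint_def Let_def)
    then show ?thesis by eventually_elim (blast dest: boundary_limit_block2D)
  qed
  have "interior_pc F ?R ((1 - 1 / 2) * 0 + 1 / 2 * 0)"
    using Q Q' by (intro interior_pc_convex) auto
  then have int: "interior_pc F ?R 0" by simp
  have "passivity_constraint F ?R"
  proof (rule interior_imp_passivity[OF int F_cont])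
    show "AE \<Omega> in lebesgue_on {-pi..pi}. \<exists>L. boundary_limit ?R \<Omega> L"
      using lim[OF assms(1)] lim[OF assms(2)]
    proof eventually_elim
      case (elim \<Omega>)
      then obtain L L' where "boundary_limit Q \<Omega> L" "boundary_limit Q' \<Omega> L'" by blast
      then have "boundary_limit ?R \<Omega> ((1 - 1 / 2) *\<^sub>R L + (1 / 2) *\<^sub>R L')"
        unfolding boundary_limit_def by (intro tendsto_intros)
      then show ?case by blast
    qed
  qed
  moreover have "?R \<in> Hinf_ext" using Q Q' by (intro Hinf_ext_add Hinf_ext_scaleR) auto
  ultimately show ?thesis by (simp add: OP3_feasible_def)
qed

text \<open>The residual is affine in \<open>Q\<close>, and the midpoint is feasible, so the sum of
  the two residuals has squared norm at least 4 \<tau> times the optimal value. The parallelogram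
  identity then leaves at most 2 \<tau> times the gap for their difference.\<close>

lemma optimal_residual_gap:
  assumes opt: "OP3_solution P \<tau> F Q" and Q': "Q' \<in> OP3_feasible F"
  shows "(h2_norm (\<lambda>q. Puz q ** (Q q - Q' q) ** Pfy q))\<^sup>2 \<le> 2 * \<tau> * (objective P \<tau> Q' - objective P \<tau> Q)"
proof -
  have Qf: "Q \<in> OP3_feasible F" using opt by (simp add: OP3_solution_def)
  have H: "resid Q \<in> Hinf_ext" and G: "resid Q' \<in> Hinf_ext"
    using OP3_feasible_interior Qf Q' by (auto intro: resid_Hinf)
  let ?R = "\<lambda>q. (1 - 1 / 2 :: real) *\<^sub>R Q q + (1 / 2 :: real) *\<^sub>R Q' q"
  have Rf: "?R \<in> OP3_feasible F" by (rule OP3_feasible_midpoint[OF Qf Q'])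
  have Rr: "resid ?R q = (1 / 2 :: real) *\<^sub>R (resid Q' q + resid Q q)" for q
  proof -
    have "Pfz q = (1 / 2 :: real) *\<^sub>R Pfz q + (1 / 2 :: real) *\<^sub>R Pfz q"
      by (simp flip: scaleR_left_distrib)
    then show ?thesis
      by (simp add: resid_def matrix_mult_distribs matrix_mult_scaleR scaleR_right_distrib
          scaleR_right_diff_distrib)
  qed
  have "(h2_norm (resid ?R))\<^sup>2 \<le> (1 / 2)\<^sup>2 * (h2_norm (\<lambda>q. resid Q' q + resid Q q))\<^sup>2"
  proof (rule h2_norm_sq_dominated)
    show "resid ?R \<in> Hinf_ext" using OP3_feasible_interior[OF Rf] by (intro resid_Hinf) blast
    show "(\<lambda>q. resid Q' q + resid Q q) \<in> Hinf_ext" by (rule Hinf_ext_add[OF G H])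
    show "norm (resid ?R q) \<le> 1 / 2 * norm (resid Q' q + resid Q q)" for q
      unfolding Rr norm_scaleR by simp
  qed
  moreover have "\<tau> * objective P \<tau> Q \<le> (h2_norm (resid ?R))\<^sup>2"
  proof -
    have "objective P \<tau> Q \<le> objective P \<tau> ?R" using opt Rf by (simp add: OP3_solution_def)
    then have "\<tau> * objective P \<tau> Q \<le> \<tau> * objective P \<tau> ?R"
      using tau by (intro mult_left_mono) auto
    also have "\<tau> * objective P \<tau> ?R = (h2_norm (resid ?R))\<^sup>2"
      unfolding objective_resid using tau by simp
    finally show ?thesis .
  qed
  moreover have "(h2_norm (resid Q))\<^sup>2 = \<tau> * objective P \<tau> Q" "(h2_norm (resid Q'))\<^sup>2 = \<tau> * objective P \<tau> Q'"
    using tau by (simp_all add: objective_resid)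
  ultimately have "(h2_norm (\<lambda>q. resid Q' q - resid Q q))\<^sup>2 \<le> 2 * (\<tau> * objective P \<tau> Q') - 2 * (\<tau> * objective P \<tau> Q)"
    using h2_norm_parallelogram[OF G H] by (simp add: power2_eq_square)
  moreover have "(\<lambda>q. resid Q' q - resid Q q) = (\<lambda>q. Puz q ** (Q q - Q' q) ** Pfy q)"
    by (rule ext) (simp add: resid_def matrix_mult_distribs)
  ultimately show ?thesis by (simp add: algebra_simps)
qed

text \<open>The gap of the values tends to 0, hence so does the residual difference; uniform
  boundedness of feasible points turns this into convergence of the parameters.\<close>

lemma youla_tendsto:
  assumes opt: "OP3_solution P \<tau> F Q"
    and sol: "\<And>n. 0 < n \<Longrightarrow> OP4_solution P \<tau> F J Y n (Qs n)"
    and reg: "{-pi..pi} - regular_frequencies P \<tau> \<in> null_sets lebesgue"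
  shows "(\<lambda>n. h2_norm (\<lambda>q. Q q - youla n (Qs n) q)) \<longlonglongrightarrow> 0"
proof -
  have Qf: "Q \<in> OP3_feasible F" using opt by (simp add: OP3_solution_def)
  have Yf: "youla n (Qs n) \<in> OP3_feasible F" if "0 < n" for n
    using sol[OF that] OP4_feasible_OP3 by (simp add: OP4_solution_def)
  obtain C where C: "0 < C" "\<And>q. 1 < norm q \<Longrightarrow> norm (F q) \<le> C"
    using Hinf_ext_bound[OF F_Hinf] by blast
  \<comment> \<open>Twice the uniform bound, since it has to cover a difference of two feasible
    points.\<close>
  define B where "B = 2 * (CARD('u) * CARD('u) * (4 * C))"
  have B: "0 < B" using C by (simp add: B_def)
  have bound: "norm (G q) \<le> B / 2" if "G \<in> OP3_feasible F" "1 < norm q" for G q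
    using interior_pc_bound[where F = F and Q = G, OF _ C that(2)] OP3_feasible_interior[OF that(1)]
    by (simp add: B_def mult_ac)
  define N where "N = {-pi..pi} - regular_frequencies P \<tau>"
  have N: "negligible N" using reg by (simp add: N_def negligible_iff_null_sets)
  have regN: "\<exists>V U. boundary_limit Puz \<Omega> V \<and> boundary_limit Pfy \<Omega> U \<and> hpd (V\<^sup>H ** V) \<and> hpd (U ** U\<^sup>H)"
    if "\<Omega> \<in> {-pi..pi}" "\<Omega> \<notin> N" for \<Omega>
    using that unfolding N_def regular_frequencies_def by blast
  have "(\<lambda>n. (h2_norm (\<lambda>q. Q q - youla n (Qs n) q))\<^sup>2) \<longlonglongrightarrow> 0"
  proof (rule LIMSEQ_I)
    fix e :: real assume e: "0 < e"
    then have e2: "0 < e / 2" by simp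
    obtain d where d: "0 < d" "\<And>D. D \<in> Hinf_ext \<Longrightarrow> \<forall>q. 1 < norm q \<longrightarrow> norm (D q) \<le> B \<Longrightarrow>
        (h2_norm (\<lambda>q. Puz q ** D q ** Pfy q))\<^sup>2 \<le> d \<Longrightarrow> (h2_norm D)\<^sup>2 \<le> e / 2"
      using sandwich_coercive[OF Puz Pfy N regN B e2] by blast
    have "0 < d / (2 * \<tau>)" using d tau by simp
    then obtain n0 where n0: "\<And>n. n0 \<le> n \<Longrightarrow> norm (OP4_value P \<tau> F J Y n - OP3_value P \<tau> F) < d / (2 * \<tau>)"
      using LIMSEQ_D[OF OP4_value_tendsto[OF opt sol]] by blast
    show "\<exists>no. \<forall>n\<ge>no. norm ((h2_norm (\<lambda>q. Q q - youla n (Qs n) q))\<^sup>2 - 0) < e"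
    proof (intro exI[of _ "Suc n0"] allI impI)
      fix n assume n: "Suc n0 \<le> n"
      then have n1: "0 < n" by simp
      have "objective P \<tau> (youla n (Qs n)) - objective P \<tau> Q < d / (2 * \<tau>)"
        using n0[of n] n OP4_value_solution[OF sol[OF n1]] OP3_value_solution[OF opt] by simp
      then have "2 * \<tau> * (objective P \<tau> (youla n (Qs n)) - objective P \<tau> Q) \<le> d"
        using tau by (simp add: field_simps)
      then have le: "(h2_norm (\<lambda>q. Puz q ** (Q q - youla n (Qs n) q) ** Pfy q))\<^sup>2 \<le> d"
        using optimal_residual_gap[OF opt Yf[OF n1]] by linarith
      have "norm (Q q - youla n (Qs n) q) \<le> B" if "1 < norm q" for q
        using bound[OF Qf that] bound[OF Yf[OF n1] that] norm_triangle_ineq4[of "Q q" "youla n (Qs n) q"]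
        by linarith
      moreover have "(\<lambda>q. Q q - youla n (Qs n) q) \<in> Hinf_ext"
        using OP3_feasible_interior[OF Qf] by (intro Hinf_ext_diff youla) auto
      ultimately have "(h2_norm (\<lambda>q. Q q - youla n (Qs n) q))\<^sup>2 \<le> e / 2"
        using le by (intro d(2)) auto
      then show "norm ((h2_norm (\<lambda>q. Q q - youla n (Qs n) q))\<^sup>2 - 0) < e" using e by simp
    qed
  qed
  then have "(\<lambda>n. sqrt ((h2_norm (\<lambda>q. Q q - youla n (Qs n) q))\<^sup>2)) \<longlonglongrightarrow> sqrt 0"
    by (rule tendsto_real_sqrt)
  then have "(\<lambda>n. \<bar>h2_norm (\<lambda>q. Q q - youla n (Qs n) q)\<bar>) \<longlonglongrightarrow> 0" by simp
  then show ?thesis by (rule tendsto_rabs_zero_cancel)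
qed

end

theorem theorem7:
  fixes P :: "('x::finite, 'w::finite, 'u::finite, 'z::finite) plant"
    and \<epsilon> \<tau> :: real
    and F :: "complex \<Rightarrow> complex^'u^'u"
    and J Z0 X0 X Y :: "complex^'x^'x"
    and S \<Psi> :: "complex^'u^'u"
    and Qopt :: "complex \<Rightarrow> complex^'u^'u"
    and Q1opt :: "nat \<Rightarrow> nat \<Rightarrow> complex^'u^'u"
  assumes "plant_class P" and "0 < \<epsilon>" and "0 < \<tau>"
    and "is_factor P \<epsilon> \<tau> F"
    and "reference_design P \<epsilon> J S Z0 X0 \<Psi> X Y"
    and "OP3_solution P \<tau> F Qopt"
    and "\<And>n. 0 < n \<Longrightarrow> OP4_solution P \<tau> F J Y n (Q1opt n)"
  shows "(\<forall>m n. 0 < m \<and> m \<le> n \<longrightarrow> OP4_value P \<tau> F J Y n \<le> OP4_value P \<tau> F J Y m)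
    \<and> (\<lambda>n. OP4_value P \<tau> F J Y n) \<longlonglongrightarrow> OP3_value P \<tau> F
    \<and> ({-pi..pi} - regular_frequencies P \<tau> \<in> null_sets lebesgue \<longrightarrow>
        (\<lambda>n. h2_norm (\<lambda>q. Qopt q - OP4_youla P \<tau> J Y n (Q1opt n) q)) \<longlonglongrightarrow> 0)"
proof -
  interpret youla_design P \<epsilon> \<tau> F J Z0 X0 X Y S \<Psi>
    by unfold_locales (rule assms)+
  show ?thesis
    using OP4_value_antimono assms(7) OP4_value_tendsto[OF assms(6,7)] youla_tendsto[OF assms(6,7)]
    by blast
qed

end
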